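(* Let $\ell>0$, let $r$ be a vocal-tract radius in class $\mathcal{A}$ on $[0,\ell]$, and let $P(k,x)$ be the corresponding pressure. Let $$\mathcal{D}_1=\{P(k,\ell):k\in\mathbf{R}^+\},\qquad \mathcal{D}_2=\{|P(k,\ell)|:k\in\mathbf{R}^+;\ \{k_j^-\}_{j=1}^{N^-}\},$$ $$\mathcal{D}_3=\{\ell;\{k_j^-\}_{j=1}^{N^-};\{k_j^+\}_{j=1}^{N^+}\},\qquad \mathcal{D}_4=\{r_\ell;\{k_j^-\}_{j=1}^{N^-};\{k_j^+\}_{j=1}^{N^+}\},$$ $$\mathcal{D}_5=\{\ell;\ E(k):k\in\mathbf{C}\},\qquad \mathcal{D}_6=\{r_\ell;\ E(k):k\in\mathbf{C}\}.$$ Then these six data sets are equivalent; that is, for any $i,j\in\{1,\dots,6\}$, if two pairs $(\ell,r)$ and $(\tilde\ell,\tilde r)$ (with $r$, $\tilde r$ in class $\mathcal{A}$ on $[0,\ell]$, $[0,\tilde\ell]$) have the same data set $\mathcal{D}_i$, then they have the same data set $\mathcal{D}_j$.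
   Context: Class $\mathcal{A}$: $r:[0,\ell]\to\mathbf{R}$ with $r(x)>0$ on $[0,\ell]$, $r'$ continuous on $[0,\ell]$ (and absolutely continuous), $r''$ integrable on $(0,\ell)$. Notation: prime is $d/dx$, $r_0=r(0)$, $r_\ell=r(\ell)$, $\mathbf{R}^+=(0,+\infty)$. The constants $c,\mu>0$ are fixed and known (the same for all $r$). Normalized impedance: $z(k)=1-\dfrac{J_1(2kr_\ell)}{kr_\ell}+i\,\dfrac{\mathbf{H}_1(2kr_\ell)}{kr_\ell}$, $k\in\mathbf{C}$ (value at $k=0$ by removing the singularity), $J_1$ the Bessel function and $\mathbf{H}_1$ the Struve function of order one. Pressure: $P(k,x)$ is the solution of $[r(x)^2P'(k,x)]'+k^2r(x)^2P(k,x)=0$, $x\in(0,\ell)$, with $P'(k,0)=-\dfrac{ikc\mu}{\pi r_0^2}$ and $P'(k,\ell)+\dfrac{ik}{z(k)}P(k,\ell)=0$ (for the $k$ for which this boundary value problem is uniquely solvable); $P(k,\ell)$ is regarded as a meromorphic function of $k\in\mathbf{C}$. $\{k_j^+\}_{j=1}^{N^+}$ and $\{k_j^-\}_{j=1}^{N^-}$ are the poles of $P(k,\ell)$, listed with multiplicity and in order of nondecreasing modulus, in the open first quadrant and in the open fourth quadrant of $\mathbf{C}$, respectively ($N^-$ finite, $N^+=+\infty$). Further, $$E(k)=-ik\prod_{\sigma\in\{-,+\}}\ \prod_{j=1}^{N^\sigma}\Big(1-\frac{k}{k_j^\sigma}\Big)e^{k/k_j^\sigma}\Big(1+\frac{k}{(k_j^\sigma)^*}\Big)e^{-k/(k_j^\sigma)^*},$$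 where $*$ is complex conjugation. *)

theory Defs
  imports
    "HOL-Complex_Analysis.Complex_Analysis"
    "HOL-Library.Extended_Nat"
    "HOL-Library.FuncSet"
begin

definition abs_continuous_between :: "real \<Rightarrow> real \<Rightarrow> (real \<Rightarrow> real) \<Rightarrow> bool" where
  "abs_continuous_between a b f \<longleftrightarrow>
     (\<forall>\<epsilon>>0. \<exists>\<delta>>0. \<forall>(n::nat) u v.
        (\<forall>i<n. a \<le> u i \<and> u i \<le> v i \<and> v i \<le> b) \<longrightarrow>
        (\<forall>i<n. \<forall>j<n. i \<noteq> j \<longrightarrow> {u i<..<v i} \<inter> {u j<..<v j} = {}) \<longrightarrow>
        (\<Sum>i<n. v i - u i) < \<delta> \<longrightarrow>
        (\<Sum>i<n. \<bar>f (v i) - f (u i)\<bar>) < \<epsilon>)"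

text \<open>Radii are total functions of which only the values on \<open>[0, L]\<close> matter; the derivatives at the
  end points are one-sided.  The second derivative \<open>r2\<close> is only required almost everywhere.\<close>

definition class_A :: "real \<Rightarrow> (real \<Rightarrow> real) \<Rightarrow> bool" where
  "class_A L r \<longleftrightarrow>
     (\<forall>x\<in>{0..L}. r x > 0) \<and>
     (\<exists>r1 r2.
        (\<forall>x\<in>{0..L}. (r has_real_derivative r1 x) (at x within {0..L})) \<and>
        continuous_on {0..L} r1 \<and>
        abs_continuous_between 0 L r1 \<and>
        (AE x in lebesgue. x \<in> {0<..<L} \<longrightarrow> (r1 has_real_derivative r2 x) (at x)) \<and>
        set_integrable lebesgue {0<..<L} r2)"

definition Bessel_J :: "nat \<Rightarrow> complex \<Rightarrow> complex" where
  "Bessel_J n w = (\<Sum>m. (-1) ^ m / (fact m * fact (m + n)) * (w / 2) ^ (2 * m + n))"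

definition Struve_H :: "nat \<Rightarrow> complex \<Rightarrow> complex" where
  "Struve_H n w =
     (\<Sum>m. (-1) ^ m / (Gamma (of_nat m + 3 / 2) * Gamma (of_nat m + of_nat n + 3 / 2))
            * (w / 2) ^ (2 * m + n + 1))"

text \<open>The argument \<open>a\<close> is the radius at the lips; \<^const>\<open>remove_sings\<close> supplies the value at
  \<open>k = 0\<close>.\<close>

definition impedance :: "real \<Rightarrow> complex \<Rightarrow> complex" where
  "impedance a = remove_sings (\<lambda>k.
     1 - Bessel_J 1 (2 * k * of_real a) / (k * of_real a)
       + \<i> * Struve_H 1 (2 * k * of_real a) / (k * of_real a))"

text \<open>\<open>Q\<close> is \<open>P'\<close>.  Where the impedance vanishes the boundary condition at the lips
  makes no sense, and no function counts as a solution.\<close>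

definition solves_tract_bvp ::
  "real \<Rightarrow> real \<Rightarrow> real \<Rightarrow> (real \<Rightarrow> real) \<Rightarrow> complex \<Rightarrow> (real \<Rightarrow> complex) \<Rightarrow> bool" where
  "solves_tract_bvp c \<mu> L r k P \<longleftrightarrow>
     impedance (r L) k \<noteq> 0 \<and>
     (\<exists>Q. (\<forall>x\<in>{0..L}. (P has_vector_derivative Q x) (at x within {0..L})) \<and>
          continuous_on {0..L} Q \<and>
          (\<forall>x\<in>{0<..<L}. ((\<lambda>y. of_real ((r y)\<^sup>2) * Q y) has_vector_derivative
                             - (k\<^sup>2 * of_real ((r x)\<^sup>2) * P x)) (at x)) \<and>
          Q 0 = - (\<i> * k * of_real c * of_real \<mu> / of_real (pi * (r 0)\<^sup>2)) \<and>
          Q L + \<i> * k / impedance (r L) k * P L = 0)"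

definition pressure ::
  "real \<Rightarrow> real \<Rightarrow> real \<Rightarrow> (real \<Rightarrow> real) \<Rightarrow> complex \<Rightarrow> real \<Rightarrow> complex" where
  "pressure c \<mu> L r k x = (THE p. \<exists>P. solves_tract_bvp c \<mu> L r k P \<and> P x = p)"

text \<open>The pressure at the lips as a meromorphic function: the isolated points where the boundary
  value problem is not uniquely solvable (there \<^const>\<open>pressure\<close> is unspecified), or where the
  impedance vanishes, are either poles or filled in by continuity.\<close>

definition lip_pressure ::
  "real \<Rightarrow> real \<Rightarrow> real \<Rightarrow> (real \<Rightarrow> real) \<Rightarrow> complex \<Rightarrow> complex" where
  "lip_pressure c \<mu> L r = remove_sings (\<lambda>k. pressure c \<mu> L r k L)"

text \<open>\<open>a 0, a 1, \<dots>\<close> (with \<open>N\<close> entries, padded by zeros) lists the poles of \<open>f\<close> in \<open>S\<close> with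
  multiplicity and in order of nondecreasing modulus.\<close>

definition lists_poles ::
  "(complex \<Rightarrow> complex) \<Rightarrow> complex set \<Rightarrow> enat \<Rightarrow> (nat \<Rightarrow> complex) \<Rightarrow> bool" where
  "lists_poles f S N a \<longleftrightarrow>
     (\<forall>j. enat j < N \<longrightarrow> a j \<in> S) \<and>
     (\<forall>j. N \<le> enat j \<longrightarrow> a j = 0) \<and>
     (\<forall>k\<in>S. finite {j. enat j < N \<and> a j = k} \<and>
             card {j. enat j < N \<and> a j = k} = (if is_pole f k then nat (- zorder f k) else 0)) \<and>
     (\<forall>i j. i \<le> j \<and> enat j < N \<longrightarrow> cmod (a i) \<le> cmod (a j))"

text \<open>Poles of equal modulus may be listed in several orders.  The order chosen here depends only on
  the poles and their multiplicities, so equality of two pole sequences means equality of the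
  poles with multiplicity.\<close>

definition pole_sequence ::
  "(complex \<Rightarrow> complex) \<Rightarrow> complex set \<Rightarrow> enat \<times> (nat \<Rightarrow> complex)" where
  "pole_sequence f S = (SOME (N, a). lists_poles f S N a)"

definition poles_plus ::
  "real \<Rightarrow> real \<Rightarrow> real \<Rightarrow> (real \<Rightarrow> real) \<Rightarrow> enat \<times> (nat \<Rightarrow> complex)" where
  "poles_plus c \<mu> L r = pole_sequence (lip_pressure c \<mu> L r) {k. Re k > 0 \<and> Im k > 0}"

definition poles_minus ::
  "real \<Rightarrow> real \<Rightarrow> real \<Rightarrow> (real \<Rightarrow> real) \<Rightarrow> enat \<times> (nat \<Rightarrow> complex)" where
  "poles_minus c \<mu> L r = pole_sequence (lip_pressure c \<mu> L r) {k. Re k > 0 \<and> Im k < 0}"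

definition pole_product :: "enat \<times> (nat \<Rightarrow> complex) \<Rightarrow> complex \<Rightarrow> complex" where
  "pole_product s k = (case s of (N, a) \<Rightarrow>
     (\<Prod>j. if enat j < N
           then (1 - k / a j) * exp (k / a j) * (1 + k / cnj (a j)) * exp (- (k / cnj (a j)))
           else 1))"

definition E_fun :: "real \<Rightarrow> real \<Rightarrow> real \<Rightarrow> (real \<Rightarrow> real) \<Rightarrow> complex \<Rightarrow> complex" where
  "E_fun c \<mu> L r k =
     - \<i> * k * pole_product (poles_minus c \<mu> L r) k * pole_product (poles_plus c \<mu> L r) k"

text \<open>Data given for \<open>k \<in> (0, \<infinity>)\<close> are functions of \<open>k\<close>, not their sets of values.\<close>

definition D1 where
  "D1 c \<mu> L r = (\<lambda>k::real\<in>{0<..}. lip_pressure c \<mu> L r (of_real k))"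

definition D2 where
  "D2 c \<mu> L r =
     ((\<lambda>k::real\<in>{0<..}. cmod (lip_pressure c \<mu> L r (of_real k))), poles_minus c \<mu> L r)"

definition D3 where
  "D3 c \<mu> L r = (L, poles_minus c \<mu> L r, poles_plus c \<mu> L r)"

definition D4 where
  "D4 c \<mu> L r = (r L, poles_minus c \<mu> L r, poles_plus c \<mu> L r)"

definition D5 where
  "D5 c \<mu> L r = (L, E_fun c \<mu> L r)"

definition D6 where
  "D6 c \<mu> L r = (r L, E_fun c \<mu> L r)"

definition same_data ::
  "real \<Rightarrow> real \<Rightarrow> nat \<Rightarrow> real \<Rightarrow> (real \<Rightarrow> real) \<Rightarrow> real \<Rightarrow> (real \<Rightarrow> real) \<Rightarrow> bool" where
  "same_data c \<mu> i L r L' r' \<longleftrightarrow>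
     i = 1 \<and> D1 c \<mu> L r = D1 c \<mu> L' r' \<or>
     i = 2 \<and> D2 c \<mu> L r = D2 c \<mu> L' r' \<or>
     i = 3 \<and> D3 c \<mu> L r = D3 c \<mu> L' r' \<or>
     i = 4 \<and> D4 c \<mu> L r = D4 c \<mu> L' r' \<or>
     i = 5 \<and> D5 c \<mu> L r = D5 c \<mu> L' r' \<or>
     i = 6 \<and> D6 c \<mu> L r = D6 c \<mu> L' r'"

end

theory Submission
  imports Defs "HOL-Real_Asymp.Real_Asymp"
begin

text \<open>With \<open>\<kappa> = \<i> * k\<close> the pressure at the lips is
  \<open>c * \<mu> / pi * piston (\<kappa> * a) / (a\<^sup>2 * den k)\<close>, where \<open>a = r L\<close>,
  \<open>piston (\<i> * k * a)\<close> is the impedance and \<open>den\<close> is an entire function of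
  exponential type with \<open>den 0 = 1\<close> and \<open>den (- cnj k) = cnj (den k)\<close>.  Since the impedance has positive
  real part in the closed lower half plane away from 0, an energy argument shows that \<open>den\<close> has no zeros there (so
  that \<open>N\<^sup>- = 0\<close>), none on the imaginary axis, and none in common with the impedance: the poles of
  the pressure in the first quadrant determine all zeros of \<open>den\<close>.  If two such functions have
  the same zeros, their quotient is \<open>exp (\<alpha> + \<beta> * k)\<close>.  Along the imaginary axis
  \<open>ln \<bar>den (- \<i> * t)\<bar> / t\<close> tends to \<open>L\<close> and \<open>ln \<bar>den (\<i> * t)\<bar> / t\<close> tends to
  \<open>2 * a + L\<close>; hence \<open>a + L\<close> is determined by the zeros, and once \<open>a\<close> or \<open>L\<close> is known too,
  so are \<open>den\<close> and the pressure.  The modulus on the positive axis determines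
  \<open>P(k) * P(-k)\<close>, whose poles in the first quadrant are those of \<open>P\<close>, and whose behaviour at
  \<open>k = 0\<close> yields \<open>a\<close>.\<close>

section \<open>Entire functions of exponential type\<close>

text \<open>The data supply zeros only, so everything depends on
  \<open>exp (\<alpha> + \<beta> * k)\<close> being the whole ambiguity. The obstacle: a quotient of
  two functions of exponential type is not visibly of exponential type, since the divisor may be
  small. No lower bound for the divisor is sought; its zeros in a disc are divided out and
  logarithms of the zero-free remainders are compared. The exponent \<beta> shifts the rates along
  the two halves of the imaginary axis by opposite amounts, so only their sum
  \<open>2 * a + 2 * L\<close> is an invariant of the zeros. The value at 0, the reflection symmetry
  and one known length then remove \<alpha> and \<beta>. The energy argument plays two signs against
  each other: the flux at the lips has the sign of \<open>- Im k\<close>, while at a zero of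
  \<open>den\<close> the lip condition gives it the sign opposite to that of the real part of the
  impedance, or makes it vanish. Zeros of the impedance in the upper half plane are not excluded, so
  a numerator zero of one tract might be mistaken for a zero of the other tract's
  \<open>den\<close>; the absence of common zeros within each tract prevents this.\<close>

lemma borel_caratheodory:
  fixes g :: "complex \<Rightarrow> complex"
  assumes hol: "g holomorphic_on ball 0 R" and "R > 0" and "g 0 = 0" and "M > 0"
    and bound: "\<And>z. norm z < R \<Longrightarrow> Re (g z) < M"
    and z: "norm z \<le> R / 2"
  shows "norm (g z) \<le> 2 * M"
proof -
  \<comment> \<open>The Moebius map \<open>u / (2 * M - u)\<close> takes the half plane
    \<open>Re u < M\<close> into the unit disc and fixes 0, so Schwarz's lemma applies to the
    rescaled function.\<close>
  define h where "h w = g (of_real R * w) / (2 * of_real M - g (of_real R * w))" for w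
  have in_ball: "norm (of_real R * w) < R" if "norm w < 1" for w :: complex
    using that \<open>R > 0\<close> by (simp add: norm_mult)
  have re: "Re (2 * of_real M - g (of_real R * w)) > 0" if "norm w < 1" for w
    using bound[OF in_ball[OF that]] \<open>M > 0\<close> by simp
  have nz: "2 * of_real M - g (of_real R * w) \<noteq> 0" if "norm w < 1" for w
    using re[OF that] by force
  have gcomp: "(\<lambda>w. g (of_real R * w)) holomorphic_on ball 0 1"
  proof -
    have "(g \<circ> (\<lambda>w. of_real R * w)) holomorphic_on ball 0 1"
      by (rule holomorphic_on_compose_gen[OF _ hol]) (auto intro!: holomorphic_intros simp: in_ball)
    thus ?thesis by (simp add: o_def)
  qed
  have "h holomorphic_on ball 0 1"
    unfolding h_def by (intro holomorphic_intros gcomp) (use nz in auto)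
  moreover have "h 0 = 0" by (simp add: h_def \<open>g 0 = 0\<close>)
  moreover have "norm (h w) < 1" if "norm w < 1" for w
  proof -
    define u where "u = g (of_real R * w)"
    have "Re u < M" unfolding u_def by (rule bound[OF in_ball[OF that]])
    have "norm u < norm (2 * of_real M - u)"
    proof (rule power2_less_imp_less)
      have "M * Re u < M * M" using \<open>Re u < M\<close> \<open>M > 0\<close> by simp
      thus "norm u ^ 2 < norm (2 * of_real M - u) ^ 2"
        unfolding cmod_power2 by (simp add: power2_eq_square algebra_simps)
    qed auto
    thus ?thesis using nz[OF that] by (simp add: h_def u_def norm_divide)
  qed
  ultimately have Schwarz: "norm (h w) \<le> norm w" if "norm w < 1" for w
    using Schwarz_Lemma(1)[of h w] that by blast
  define w where "w = z / of_real R"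
  have w: "norm w \<le> 1 / 2" and zw: "of_real R * w = z"
    using z \<open>R > 0\<close> by (auto simp: w_def norm_divide field_simps)
  define u where "u = g z"
  have "norm u / norm (2 * of_real M - u) \<le> 1 / 2"
    using order_trans[OF Schwarz[of w] w] w by (simp only: h_def zw u_def norm_divide)
  moreover have "norm (2 * of_real M - u) > 0" using nz[of w] w by (simp add: zw u_def)
  ultimately have "2 * norm u \<le> norm (2 * of_real M - u)" by (simp add: field_simps)
  also have "\<dots> \<le> 2 * M + norm u"
    using norm_triangle_ineq4[of "2 * of_real M" u] \<open>M > 0\<close> by (simp add: norm_mult)
  finally show ?thesis by (simp add: u_def)
qed

lemma entire_eventually_nonzero:
  fixes f :: "complex \<Rightarrow> complex"
  assumes "f holomorphic_on UNIV" "f w \<noteq> 0"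
  shows "eventually (\<lambda>z. f z \<noteq> 0) (at z)"
  using non_zero_neighbour_alt[OF assms(1), of z w] assms(2) by (auto elim: eventually_mono)

lemma entire_frequently_nonzero:
  fixes f :: "complex \<Rightarrow> complex"
  assumes "f holomorphic_on UNIV" "f w \<noteq> 0"
  shows "frequently (\<lambda>z. f z \<noteq> 0) (at z)"
  by (rule eventually_frequently[OF _ entire_eventually_nonzero[OF assms]]) simp

lemma entire_analytic: "f holomorphic_on UNIV \<Longrightarrow> f analytic_on A"
  using analytic_on_holomorphic by blast

lemma entire_zorder_eq_0_iff:
  fixes f :: "complex \<Rightarrow> complex"
  assumes "f holomorphic_on UNIV" "f w \<noteq> 0"
  shows "zorder f z = 0 \<longleftrightarrow> f z \<noteq> 0"
  by (rule zorder_eq_0_iff[OF entire_analytic[OF assms(1)] entire_frequently_nonzero[OF assms]])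

lemma entire_zorder_nonneg:
  fixes f :: "complex \<Rightarrow> complex"
  assumes "f holomorphic_on UNIV" "f w \<noteq> 0"
  shows "zorder f z \<ge> 0"
  by (rule zorder_ge_0[OF entire_analytic[OF assms(1)] entire_frequently_nonzero[OF assms]])

lemma zorder_linear_factor:
  fixes a :: complex
  assumes "a \<noteq> 0"
  shows "zorder (\<lambda>z. 1 - z / a) z = (if z = a then 1 else 0)"
proof (cases "z = a")
  case True
  have "zorder (\<lambda>z. 1 - z / a) a = 1"
    by (rule zorder_eqI[of UNIV _ "\<lambda>_. - 1 / a"]) (use assms in \<open>auto simp: field_simps\<close>)
  with True show ?thesis by simp
next
  case False
  have "zorder (\<lambda>z. 1 - z / a) z = 0"
    by (rule zorder_eq_0I) (use assms False in \<open>auto intro!: analytic_intros\<close>)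
  with False show ?thesis by simp
qed

text \<open>Multiplicity is carried by the index set: a zero listed by n indices is divided out n
  times, one per induction step. Factors equal to 1 at 0 keep the value there, and the order
  identity shows where the cofactor still vanishes.\<close>

lemma entire_factor_out_zeros:
  fixes f :: "complex \<Rightarrow> complex"
  assumes "finite I" and "f holomorphic_on UNIV" and "f 0 \<noteq> 0"
    and "\<And>z. int (card {i\<in>I. a i = z}) \<le> zorder f z"
  shows "\<exists>g. g holomorphic_on UNIV \<and> g 0 = f 0 \<and> (\<forall>i\<in>I. a i \<noteq> 0) \<and>
           (\<forall>z. f z = (\<Prod>i\<in>I. 1 - z / a i) * g z) \<and>
           (\<forall>z. zorder f z = zorder g z + int (card {i\<in>I. a i = z}))"
  using assms
proof (induction I arbitrary: f rule: finite_induct)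
  case empty
  thus ?case by (intro exI[of _ f]) auto
next
  case (insert i I)
  define b where "b = a i"
  have ev: "eventually (\<lambda>z. f z \<noteq> 0) (at z)" for z
    by (rule entire_eventually_nonzero[OF insert.prems(1,2)])
  have count: "card {j \<in> insert i I. a j = z} = card {j\<in>I. a j = z} + (if z = b then 1 else 0)" for z
  proof -
    have "{j \<in> insert i I. a j = z} = (if z = b then insert i {j\<in>I. a j = z} else {j\<in>I. a j = z})"
      by (auto simp: b_def)
    thus ?thesis using insert.hyps by auto
  qed
  have "zorder f b \<noteq> 0" using insert.prems(3)[of b] unfolding count by auto
  hence fb: "f b = 0" using entire_zorder_eq_0_iff[OF insert.prems(1,2), of b] by simp
  hence b0: "b \<noteq> 0" using insert.prems(2) by auto
  \<comment> \<open>As \<open>f b = 0\<close>, this is \<open>f z / (1 - z / b)\<close> with the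
    singularity at \<open>b\<close> removed; \<open>- b\<close> turns \<open>z - b\<close> into
    \<open>1 - z / b\<close>.\<close>
  define g where "g z = - b * (if z = b then deriv f b else (f z - f b) / (z - b))" for z
  have g: "g holomorphic_on UNIV"
    unfolding g_def by (intro holomorphic_intros pole_lemma_open insert.prems(1)) auto
  have fg: "f z = (1 - z / b) * g z" for z
    by (cases "z = b") (use fb b0 in \<open>auto simp: g_def field_simps\<close>)
  have zo: "zorder f z = (if z = b then 1 else 0) + zorder g z" for z
  proof -
    have "zorder (\<lambda>z. (1 - z / b) * g z) z = zorder (\<lambda>z. 1 - z / b) z + zorder g z"
      by (intro zorder_times_analytic analytic_intros entire_analytic[OF g])
         (use ev b0 in \<open>auto simp flip: fg\<close>)
    moreover have "f = (\<lambda>z. (1 - z / b) * g z)" using fg by blast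
    ultimately show ?thesis using zorder_linear_factor[OF b0] by simp
  qed
  have "g 0 \<noteq> 0" using fg[of 0] insert.prems(2) by auto
  moreover have "int (card {j\<in>I. a j = z}) \<le> zorder g z" for z
    using insert.prems(3)[of z] unfolding count zo[of z] by (auto split: if_splits)
  ultimately obtain h where h: "h holomorphic_on UNIV" "h 0 = g 0" "\<forall>i\<in>I. a i \<noteq> 0"
      "\<forall>z. g z = (\<Prod>i\<in>I. 1 - z / a i) * h z"
      "\<forall>z. zorder g z = zorder h z + int (card {i\<in>I. a i = z})"
    using insert.IH[OF g] by blast
  show ?case
  proof (intro exI[of _ h] conjI allI ballI)
    show "h 0 = f 0" using fg[of 0] h(2) by simp
    show "f z = (\<Prod>i\<in>insert i I. 1 - z / a i) * h z" for z
      using fg[of z] h(4) insert.hyps by (simp add: b_def mult_ac)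
    show "zorder f z = zorder h z + int (card {j \<in> insert i I. a j = z})" for z
      using zo[of z] h(5) unfolding count by simp
  qed (use h b0 b_def in auto)
qed

lemma norm_le_on_cball:
  fixes f :: "complex \<Rightarrow> complex"
  assumes "f holomorphic_on UNIV" and "\<And>z. norm z = R \<Longrightarrow> norm (f z) \<le> B" and "norm z \<le> R" and "R > 0"
  shows "norm (f z) \<le> B"
  by (rule maximum_modulus_frontier[of f "cball 0 R"])
     (use assms in \<open>auto intro: holomorphic_on_subset holomorphic_on_imp_continuous_on\<close>)

text \<open>Jensen's estimate by maximum modulus: on the circle of radius \<open>4 * R\<close> a
  factor with zero in the disc of radius \<open>R\<close> has modulus at least 3, so the cofactor at
  0 yields \<open>3 ^ card I * norm (f 0) \<le> exp (C * (1 + 4 * R))\<close>. It serves the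
  convergence of the product in \<open>E_fun\<close>.\<close>

lemma zero_count_linear_bound:
  fixes f :: "complex \<Rightarrow> complex"
  assumes "f holomorphic_on UNIV" and "f 0 \<noteq> 0" and "\<And>z. norm (f z) \<le> exp (C * (1 + norm z))"
  shows "\<exists>B. \<forall>R>0. \<forall>(I::'i set) a. finite I \<longrightarrow> (\<forall>i\<in>I. norm (a i) \<le> R) \<longrightarrow>
           (\<forall>z. int (card {i\<in>I. a i = z}) \<le> zorder f z) \<longrightarrow> real (card I) \<le> B * (1 + R)"
proof (intro exI allI impI)
  fix R :: real and I :: "'i set" and a :: "'i \<Rightarrow> complex"
  assume R: "R > 0" and I: "finite I" "\<forall>i\<in>I. norm (a i) \<le> R"
    "\<forall>z. int (card {i\<in>I. a i = z}) \<le> zorder f z"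
  then obtain g where g: "g holomorphic_on UNIV" "g 0 = f 0" "\<forall>i\<in>I. a i \<noteq> 0"
      "\<And>z. f z = (\<Prod>i\<in>I. 1 - z / a i) * g z"
    using entire_factor_out_zeros[OF I(1) assms(1,2), of a] by blast
  have "norm (3 ^ card I * g 0) \<le> exp (C * (1 + 4 * R))"
  proof (rule norm_le_on_cball[where f = "\<lambda>z. 3 ^ card I * g z" and R = "4 * R"])
    fix z :: complex assume z: "norm z = 4 * R"
    have "(\<Prod>i\<in>I. (3::real)) \<le> (\<Prod>i\<in>I. norm (1 - z / a i))"
    proof (intro prod_mono conjI)
      fix i assume i: "i \<in> I"
      have "3 * norm (a i) \<le> norm z - norm (a i)" using I(2) i z by auto
      also have "\<dots> \<le> norm (a i - z)" by (metis norm_minus_commute norm_triangle_ineq2)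
      also have "\<dots> = norm (1 - z / a i) * norm (a i)"
          using g(3) i by (subst norm_mult [symmetric]) (simp add: left_diff_distrib)
      finally show "3 \<le> norm (1 - z / a i)" using g(3) i by simp
    qed auto
    hence "3 ^ card I * norm (g z) \<le> norm (\<Prod>i\<in>I. 1 - z / a i) * norm (g z)"
      by (intro mult_right_mono) (auto simp: prod_norm)
    also have "\<dots> = norm (f z)" by (simp add: g(4) norm_mult)
    also have "\<dots> \<le> exp (C * (1 + 4 * R))" using assms(3)[of z] z by simp
    finally show "norm (3 ^ card I * g z) \<le> exp (C * (1 + 4 * R))" by (simp add: norm_mult norm_power)
  qed (use R in \<open>auto intro!: holomorphic_intros g(1)\<close>)
  hence "3 ^ card I * norm (f 0) \<le> exp (C * (1 + 4 * R))"
    by (simp add: g(2) norm_mult norm_power)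
  moreover have pos: "3 ^ card I * norm (f 0) > 0" using assms(2) by simp
  ultimately have "ln (3 ^ card I * norm (f 0)) \<le> C * (1 + 4 * R)"
    using ln_mono[of "3 ^ card I * norm (f 0)" "exp (C * (1 + 4 * R))"] by simp
  hence *: "real (card I) * ln 3 + ln (norm (f 0)) \<le> C * (1 + 4 * R)"
    using assms(2) by (simp add: ln_mult ln_realpow)
  have "(1::real) \<le> ln 3" using exp_le by (simp add: ln_ge_iff)
  hence "real (card I) \<le> real (card I) * ln 3" by (simp add: mult_left_mono mult_le_cancel_left1)
  also have "\<dots> \<le> \<bar>C\<bar> * (1 + 4 * R) + \<bar>ln (norm (f 0))\<bar> * 1"
    using * mult_right_mono[OF abs_ge_self[of C], of "1 + 4 * R"] R by linarith
  also have "\<dots> \<le> \<bar>C\<bar> * (4 * (1 + R)) + \<bar>ln (norm (f 0))\<bar> * (1 + R)"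
    using R by (intro add_mono mult_left_mono) auto
  also have "\<dots> = (4 * \<bar>C\<bar> + \<bar>ln (norm (f 0))\<bar>) * (1 + R)" by (simp add: algebra_simps)
  finally show "real (card I) \<le> (4 * \<bar>C\<bar> + \<bar>ln (norm (f 0))\<bar>) * (1 + R)" .
qed

lemma entire_zeros_finite_cball:
  fixes f :: "complex \<Rightarrow> complex"
  assumes "f holomorphic_on UNIV" and "f w \<noteq> 0"
  shows "finite {z. f z = 0 \<and> norm z \<le> R}"
proof -
  have "finite (cball 0 R \<inter> {z. f z = 0})"
  proof (rule ccontr)
    assume inf: "infinite (cball 0 R \<inter> {z. f z = 0})"
    then obtain x where "x islimpt (cball 0 R \<inter> {z. f z = 0})"
      using Heine_Borel_imp_Bolzano_Weierstrass[of "cball 0 R" "cball 0 R \<inter> {z. f z = 0}"] by auto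
    moreover have "eventually (\<lambda>z. f z \<noteq> 0) (at x)" by (rule entire_eventually_nonzero[OF assms])
    ultimately show False
      by (metis (mono_tags, lifting) Int_iff eventually_mono islimpt_iff_eventually mem_Collect_eq)
  qed
  thus ?thesis by (rule finite_subset[rotated]) auto
qed

lemma exists_exp_representation:
  fixes g :: "complex \<Rightarrow> complex"
  assumes "g holomorphic_on S" and "convex S" "open S" and "\<And>z. z \<in> S \<Longrightarrow> g z \<noteq> 0"
  obtains h where "h holomorphic_on S" "\<And>z. z \<in> S \<Longrightarrow> g z = exp (h z)"
proof -
  have "\<exists>h. h holomorphic_on S \<and> (\<forall>z\<in>S. g z = exp (h z))"
    using simply_connected_eq_holomorphic_log[OF \<open>open S\<close>] convex_imp_simply_connected[OF \<open>convex S\<close>] assms(1,4)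
    by blast
  thus ?thesis using that by blast
qed

text \<open>Dividing \<open>f\<close> by its zeros in a disc leaves \<open>g\<close> such that both \<open>ln g\<close> and \<open>ln (q g)\<close> are
  controlled by Borel--Caratheodory, hence so is their difference \<open>ln q\<close>.\<close>

lemma entire_quotient_exp_linear:
  fixes f q :: "complex \<Rightarrow> complex"
  assumes f: "f holomorphic_on UNIV" "f 0 \<noteq> 0" "\<And>z. norm (f z) \<le> exp (C * (1 + norm z))"
    and q: "q holomorphic_on UNIV" "\<And>z. q z \<noteq> 0"
    and qf: "\<And>z. norm (q z * f z) \<le> exp (D * (1 + norm z))"
  shows "\<exists>\<alpha> \<beta>. \<forall>z. q z = exp (\<alpha> + \<beta> * z)"
proof -
  obtain G where G: "G holomorphic_on UNIV" "\<And>z. q z = exp (G z)"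
    using exists_exp_representation[OF q(1)] q(2) by (metis UNIV_I convex_UNIV open_UNIV)
  \<comment> \<open>\<open>1 + 2 * R\<close> comes from the circle of radius \<open>2 * R\<close>
    used below; the final \<open>+ 1\<close> provides the strict inequality that
    \<open>borel_caratheodory\<close> requires.\<close>
  define M where "M C c R = \<bar>C\<bar> * (1 + 2 * R) + \<bar>ln (norm c)\<bar> + 1" for C R and c :: complex
  have main: "norm (G z - G 0) \<le> 2 * M C (f 0) R + 2 * M D (q 0 * f 0) R"
    if R: "R > 0" and z: "norm z \<le> R / 2" for R z
  proof -
    \<comment> \<open>Pairs of a zero and a copy number: the fibres of \<open>fst\<close> have
      exactly the order of the zero as cardinality.\<close>
    define I where "I = (SIGMA z:{z. f z = 0 \<and> norm z \<le> R}. {..<nat (zorder f z)})"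
    have finI: "finite I" unfolding I_def by (intro finite_SigmaI entire_zeros_finite_cball[OF f(1,2)]) auto
    have count: "card {i\<in>I. fst i = z} = (if norm z \<le> R then nat (zorder f z) else 0)" for z
    proof -
      have "{i\<in>I. fst i = z} = (if f z = 0 \<and> norm z \<le> R then {z} \<times> {..<nat (zorder f z)} else {})"
        by (auto simp: I_def)
      thus ?thesis using entire_zorder_eq_0_iff[OF f(1,2), of z] by auto
    qed
    have "int (card {i\<in>I. fst i = z}) \<le> zorder f z" for z
      using entire_zorder_nonneg[OF f(1,2), of z] by (simp add: count)
    then obtain g where g: "g holomorphic_on UNIV" "g 0 = f 0" "\<forall>i\<in>I. fst i \<noteq> 0"
        "\<And>z. f z = (\<Prod>i\<in>I. 1 - z / fst i) * g z"
        "\<And>z. zorder f z = zorder g z + int (card {i\<in>I. fst i = z})"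
      using entire_factor_out_zeros[OF finI f(1,2), of fst] by blast
    have g_nz: "g z \<noteq> 0" if "norm z < R" for z
    proof -
      have "zorder g z = 0"
        using g(5)[of z] that entire_zorder_nonneg[OF f(1,2), of z] by (simp add: count)
      thus ?thesis using entire_zorder_eq_0_iff[OF g(1), of 0 z] g(2) f(2) by simp
    qed
    \<comment> \<open>At radius \<open>2 * R\<close> every factor has modulus at least 1, so
      dividing out the zeros does not enlarge the function there.\<close>
    have prod_ge: "1 \<le> norm (\<Prod>i\<in>I. 1 - z / fst i)" if z: "norm z = 2 * R" for z
    proof -
      have "(\<Prod>i\<in>I. (1::real)) \<le> (\<Prod>i\<in>I. norm (1 - z / fst i))"
      proof (intro prod_mono conjI)
        fix i assume i: "i \<in> I"
        have "1 * norm (fst i) \<le> norm z - norm (fst i)" using i z by (auto simp: I_def)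
        also have "\<dots> \<le> norm (fst i - z)" by (metis norm_minus_commute norm_triangle_ineq2)
        also have "\<dots> = norm (1 - z / fst i) * norm (fst i)"
          using g(3) i by (subst norm_mult [symmetric]) (simp add: left_diff_distrib)
        finally show "1 \<le> norm (1 - z / fst i)" using g(3) i by simp
      qed auto
      thus ?thesis by (simp add: prod_norm)
    qed
    \<comment> \<open>The multiplier \<open>s\<close> is 1 for the logarithm of \<open>g\<close> and
      \<open>q\<close> for that of \<open>q * g\<close>; the difference of the two estimates bounds
      \<open>G\<close>.\<close>
    have log_bound: "norm (h w - h 0) \<le> 2 * M E (s 0 * f 0) R"
      if s: "s holomorphic_on UNIV" "\<And>z. s z \<noteq> 0"
        "\<And>z. norm (s z * f z) \<le> exp (E * (1 + norm z))"
        and h: "h holomorphic_on ball 0 R" "\<And>z. norm z < R \<Longrightarrow> s z * g z = exp (h z)"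
        and w: "norm w \<le> R / 2" for s h E w
    proof (rule borel_caratheodory[of "\<lambda>w. h w - h 0", OF _ R _ _ _ w])
      show "(\<lambda>w. h w - h 0) holomorphic_on ball 0 R" by (intro holomorphic_intros h)
      show "M E (s 0 * f 0) R > 0" unfolding M_def using R by (intro add_nonneg_pos add_nonneg_nonneg mult_nonneg_nonneg) auto
      fix z :: complex assume z: "norm z < R"
      have "norm (s z * g z) \<le> exp (E * (1 + 2 * R))"
      proof (rule norm_le_on_cball[where f = "\<lambda>z. s z * g z" and R = "2 * R"])
        fix z :: complex assume z: "norm z = 2 * R"
        have "1 * norm (s z * g z) \<le> norm (\<Prod>i\<in>I. 1 - z / fst i) * norm (s z * g z)"
          by (intro mult_right_mono prod_ge z) auto
        also have "\<dots> = norm (s z * f z)" by (simp add: g(4) norm_mult)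
        also have "\<dots> \<le> exp (E * (1 + 2 * R))" using s(3)[of z] z by simp
        finally show "norm (s z * g z) \<le> exp (E * (1 + 2 * R))" by simp
      qed (use z R in \<open>auto intro!: holomorphic_intros s g\<close>)
      hence "exp (Re (h z)) \<le> exp (E * (1 + 2 * R))" using h(2)[OF z] by simp
      hence 1: "Re (h z) \<le> E * (1 + 2 * R)" by simp
      have "exp (h 0) = s 0 * f 0" using h(2)[of 0] R g(2) by simp
      hence "norm (s 0 * f 0) = exp (Re (h 0))" by (metis norm_exp_eq_Re)
      hence 2: "Re (h 0) = ln (norm (s 0 * f 0))" by simp
      have "E * (1 + 2 * R) \<le> \<bar>E\<bar> * (1 + 2 * R)" using R by (intro mult_right_mono) auto
      thus "Re (h z - h 0) < M E (s 0 * f 0) R" using 1 2 unfolding M_def by simp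
    qed auto
    obtain h where h: "h holomorphic_on ball 0 R" "\<And>z. z \<in> ball 0 R \<Longrightarrow> g z = exp (h z)"
      using exists_exp_representation[of g "ball 0 R"] g_nz g(1) holomorphic_on_subset
      by (metis convex_ball open_ball mem_ball_0 subset_UNIV)
    have 1: "norm (h z - h 0) \<le> 2 * M C (f 0) R"
      using log_bound[of "\<lambda>_. 1" C h z] f(3) h z by simp
    have 2: "norm ((G z + h z) - (G 0 + h 0)) \<le> 2 * M D (q 0 * f 0) R"
      by (rule log_bound[of q D "\<lambda>z. G z + h z" z, OF q qf _ _ z])
         (use h G holomorphic_on_subset[OF G(1)] in \<open>auto intro!: holomorphic_intros simp: exp_add\<close>)
    have "G z - G 0 = ((G z + h z) - (G 0 + h 0)) - (h z - h 0)" by simp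
    also have "norm \<dots> \<le> norm ((G z + h z) - (G 0 + h 0)) + norm (h z - h 0)" by (rule norm_triangle_ineq4)
    finally show ?thesis using 1 2 by linarith
  qed
  define B where "B = 10 * \<bar>C\<bar> + 10 * \<bar>D\<bar> + 2 * \<bar>ln (norm (f 0))\<bar> + 2 * \<bar>ln (norm (q 0 * f 0))\<bar> + 4"
  have lin: "norm (G z - G 0) \<le> B * norm z ^ 1" if "1 \<le> norm z" for z
  proof -
    have "norm (G z - G 0) \<le> 2 * M C (f 0) (2 * norm z) + 2 * M D (q 0 * f 0) (2 * norm z)"
      using that by (intro main) auto
    also have "\<dots> = (2 * \<bar>C\<bar> + 2 * \<bar>D\<bar> + 2 * \<bar>ln (norm (f 0))\<bar> + 2 * \<bar>ln (norm (q 0 * f 0))\<bar> + 4) * 1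
        + 8 * \<bar>C\<bar> * norm z + 8 * \<bar>D\<bar> * norm z"
      by (simp add: M_def algebra_simps)
    also have "\<dots> \<le> (2 * \<bar>C\<bar> + 2 * \<bar>D\<bar> + 2 * \<bar>ln (norm (f 0))\<bar> + 2 * \<bar>ln (norm (q 0 * f 0))\<bar> + 4) * norm z
        + 8 * \<bar>C\<bar> * norm z + 8 * \<bar>D\<bar> * norm z"
      using that by (intro add_mono mult_left_mono) auto
    also have "\<dots> = B * norm z ^ 1" by (simp add: B_def algebra_simps)
    finally show ?thesis .
  qed
  \<comment> \<open>Linear growth, obtained from \<open>main\<close> with
    \<open>R = 2 * norm z\<close>, makes \<open>G\<close> a polynomial of degree at most 1.\<close>
  have taylor: "G z - G 0 = (\<Sum>k\<le>1. (deriv ^^ k) (\<lambda>z. G z - G 0) 0 / fact k * z ^ k)" for z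
    by (rule Liouville_polynomial[OF _ lin]) (intro holomorphic_intros G(1))
  have "G z - G 0 = deriv (\<lambda>z. G z - G 0) 0 * z" for z
    using taylor[of z] by simp
  hence "G z = G 0 + deriv (\<lambda>z. G z - G 0) 0 * z" for z
    by (metis diff_add_cancel add.commute)
  thus ?thesis using G(2) by metis
qed

section \<open>The impedance\<close>

text \<open>Poisson's integrals for the Bessel and the Struve function of order one, merged into a
  single exponential. Positivity of the real part and growth on the real axis are visible here, but
  not in the power series.\<close>

definition piston :: "complex \<Rightarrow> complex" where
  "piston w = of_real (4 / pi) * integral {0..pi/2} (\<lambda>t. (1 - exp (- 2 * w * of_real (cos t))) * of_real ((sin t)\<^sup>2))"

definition piston_moment :: "nat \<Rightarrow> real" where
  "piston_moment n = 4 / pi * integral {0..pi/2} (\<lambda>t. cos t ^ n * (sin t)\<^sup>2)"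

lemma piston_moment_integrable: "(\<lambda>t. cos t ^ n * (sin t)\<^sup>2) integrable_on {0..pi/2}"
  by (intro integrable_continuous_interval continuous_intros)

lemma piston_moment_0: "piston_moment 0 = 1"
proof -
  have "((\<lambda>t. cos t ^ 0 * (sin t)\<^sup>2) has_integral
          (pi/2 - sin (pi/2) * cos (pi/2)) / 2 - (0 - sin 0 * cos 0) / 2) {0..pi/2}"
  proof (rule fundamental_theorem_of_calculus)
    fix t :: real
    have "((\<lambda>t. (t - sin t * cos t) / 2) has_real_derivative cos t ^ 0 * (sin t)\<^sup>2) (at t within {0..pi/2})"
    proof -
      have "((\<lambda>t. (t - sin t * cos t) / 2) has_real_derivative (1 - (cos t * cos t + (- sin t) * sin t)) / 2) (at t within {0..pi/2})"
        by (rule derivative_eq_intros refl)+ simp_all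
      moreover have "cos t * cos t = 1 - sin t * sin t"
        using sin_cos_squared_add[of t] by (simp add: power2_eq_square)
      ultimately show ?thesis by (simp add: power2_eq_square)
    qed
    thus "((\<lambda>t. (t - sin t * cos t) / 2) has_vector_derivative cos t ^ 0 * (sin t)\<^sup>2) (at t within {0..pi/2})"
      by (simp add: has_real_derivative_iff_has_vector_derivative)
  qed auto
  thus ?thesis by (simp add: piston_moment_def integral_unique)
qed

lemma piston_moment_1: "piston_moment (Suc 0) = 4 / (3 * pi)"
proof -
  have "((\<lambda>t. cos t ^ Suc 0 * (sin t)\<^sup>2) has_integral
          (sin (pi/2)) ^ 3 / 3 - (sin 0) ^ 3 / 3) {0..pi/2}"
  proof (rule fundamental_theorem_of_calculus)
    fix t :: real
    have "((\<lambda>t. (sin t) ^ 3 / 3) has_real_derivative cos t ^ Suc 0 * (sin t)\<^sup>2) (at t within {0..pi/2})"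
      by (auto intro!: derivative_eq_intros simp: power2_eq_square)
    thus "((\<lambda>t. (sin t) ^ 3 / 3) has_vector_derivative cos t ^ Suc 0 * (sin t)\<^sup>2) (at t within {0..pi/2})"
      by (simp add: has_real_derivative_iff_has_vector_derivative)
  qed auto
  thus ?thesis by (simp add: piston_moment_def integral_unique)
qed

text \<open>Integrating the derivative of \<open>cos t ^ (n + 1) * (sin t) ^ 3\<close>, which
  vanishes at both ends, gives the relation.\<close>

lemma piston_moment_rec: "real (n + 4) * piston_moment (n + 2) = real (n + 1) * piston_moment n"
proof -
  have "((\<lambda>t. real (n + 4) * (cos t ^ (n + 2) * (sin t)\<^sup>2) - real (n + 1) * (cos t ^ n * (sin t)\<^sup>2)) has_integral
          cos (pi/2) ^ (n + 1) * (sin (pi/2)) ^ 3 - cos 0 ^ (n + 1) * (sin 0) ^ 3) {0..pi/2}"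
  proof (rule fundamental_theorem_of_calculus)
    fix t :: real
    have "((\<lambda>t. cos t ^ (n + 1) * (sin t) ^ 3) has_real_derivative
        cos t ^ (n + 1) * (3 * (sin t)\<^sup>2 * cos t) + real (n + 1) * cos t ^ n * (- sin t) * (sin t) ^ 3) (at t within {0..pi/2})"
      by (rule derivative_eq_intros refl)+ simp
    moreover have "cos t ^ (n + 1) * (3 * (sin t)\<^sup>2 * cos t) + real (n + 1) * cos t ^ n * (- sin t) * (sin t) ^ 3
       = real (n + 4) * (cos t ^ (n + 2) * (sin t)\<^sup>2) - real (n + 1) * (cos t ^ n * (sin t)\<^sup>2)"
    proof -
      have "- sin t * (sin t) ^ 3 = (sin t)\<^sup>2 * ((cos t)\<^sup>2 - 1)"
      proof -
        have c: "cos t * cos t = 1 - sin t * sin t"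
          using sin_cos_squared_add[of t] by (simp add: power2_eq_square)
        show ?thesis by (simp add: c power2_eq_square power3_eq_cube)
      qed
      hence "real (n + 1) * cos t ^ n * (- sin t) * (sin t) ^ 3 = real (n + 1) * cos t ^ n * ((sin t)\<^sup>2 * ((cos t)\<^sup>2 - 1))"
        by (metis mult.assoc)
      thus ?thesis by (simp add: algebra_simps power2_eq_square)
    qed
    ultimately show "((\<lambda>t. cos t ^ (n + 1) * (sin t) ^ 3) has_vector_derivative
        real (n + 4) * (cos t ^ (n + 2) * (sin t)\<^sup>2) - real (n + 1) * (cos t ^ n * (sin t)\<^sup>2)) (at t within {0..pi/2})"
      by (simp add: has_real_derivative_iff_has_vector_derivative)
  qed auto
  hence "integral {0..pi/2} (\<lambda>t. real (n + 4) * (cos t ^ (n + 2) * (sin t)\<^sup>2) - real (n + 1) * (cos t ^ n * (sin t)\<^sup>2)) = 0"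
    by (simp add: integral_unique)
  hence "real (n + 4) * integral {0..pi/2} (\<lambda>t. cos t ^ (n + 2) * (sin t)\<^sup>2) =
         real (n + 1) * integral {0..pi/2} (\<lambda>t. cos t ^ n * (sin t)\<^sup>2)"
    by (subst (asm) integral_diff) (intro integrable_on_mult_right piston_moment_integrable, intro integrable_on_mult_right piston_moment_integrable, simp only: integral_mult_right right_minus_eq)
  thus ?thesis unfolding piston_moment_def by (simp add: field_simps)
qed

text \<open>The recursion moves in steps of two and so separates parities: even moments produce the
  Bessel coefficients, odd ones in \<open>piston_moment_odd\<close> the Struve coefficients.\<close>

lemma piston_moment_even: "2 ^ (2 * m) * piston_moment (2 * m) / fact (2 * m) = 1 / (fact m * fact (m + 1))"
proof (induction m)
  case 0
  show ?case by (simp add: piston_moment_0)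
next
  case (Suc m)
  have "real (2 * m + 4) * piston_moment (2 * m + 2) = real (2 * m + 1) * piston_moment (2 * m)"
    by (rule piston_moment_rec)
  hence M: "piston_moment (2 * Suc m) = real (2 * m + 1) * piston_moment (2 * m) / real (2 * m + 4)"
    by (simp add: field_simps)
  have f: "fact (2 * Suc m) = (2 * real m + 2) * (2 * real m + 1) * (fact (2 * m) :: real)"
    by (simp add: algebra_simps)
  have "2 ^ (2 * Suc m) * piston_moment (2 * Suc m) / fact (2 * Suc m)
      = (2 ^ (2 * m) * piston_moment (2 * m) / fact (2 * m)) * (1 / ((real m + 1) * (real m + 2)))"
    unfolding M f by (simp add: divide_simps) (simp add: algebra_simps)
  also have "\<dots> = 1 / (fact (Suc m) * fact (Suc m + 1))"
    unfolding Suc.IH by (simp add: field_simps)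
  finally show ?case .
qed

lemma Gamma_plus1_pos: "x > 0 \<Longrightarrow> Gamma (x + 1) = x * Gamma x" for x :: real
  using nonpos_Ints_nonpos[of x] by (intro Gamma_plus1) force

lemma piston_moment_odd:
  "2 ^ (2 * m + 1) * piston_moment (2 * m + 1) / fact (2 * m + 1) = 1 / (Gamma (real m + 3/2) * Gamma (real m + 5/2))"
proof (induction m)
  case 0
  have "Gamma (1/2 + 1 :: real) = sqrt pi / 2"
    using Gamma_plus1_pos[of "1/2"] by (simp add: Gamma_one_half_real)
  moreover have "Gamma (3/2 + 1 :: real) = 3/2 * Gamma (3/2)"
    by (rule Gamma_plus1_pos) simp
  ultimately have G: "Gamma (3/2 :: real) = sqrt pi / 2" "Gamma (5/2 :: real) = 3 * sqrt pi / 4"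
    by simp_all
  show ?case by (simp add: G piston_moment_1)
next
  case (Suc m)
  have "real (2 * m + 1 + 4) * piston_moment (2 * m + 1 + 2) = real (2 * m + 1 + 1) * piston_moment (2 * m + 1)"
    by (rule piston_moment_rec)
  hence M: "piston_moment (2 * Suc m + 1) = real (2 * m + 2) * piston_moment (2 * m + 1) / real (2 * m + 5)"
    by (simp add: field_simps numeral_eq_Suc)
  have f: "fact (2 * Suc m + 1) = (2 * real m + 3) * (2 * real m + 2) * (fact (2 * m + 1) :: real)"
    by (simp add: algebra_simps)
  have G1: "Gamma (real (Suc m) + 3/2) = (real m + 3/2) * Gamma (real m + 3/2)"
    using Gamma_plus1_pos[of "real m + 3/2"] by (simp add: algebra_simps)
  have G2: "Gamma (real (Suc m) + 5/2) = (real m + 5/2) * Gamma (real m + 5/2)"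
    using Gamma_plus1_pos[of "real m + 5/2"] by (simp add: algebra_simps)
  have "2 ^ (2 * Suc m + 1) * piston_moment (2 * Suc m + 1) / fact (2 * Suc m + 1)
      = (2 ^ (2 * m + 1) * piston_moment (2 * m + 1) / fact (2 * m + 1)) * (1 / ((real m + 3/2) * (real m + 5/2)))"
    unfolding M f by (simp add: divide_simps del: fact_Suc) (simp add: algebra_simps del: fact_Suc)
  also have "\<dots> = 1 / (Gamma (real (Suc m) + 3/2) * Gamma (real (Suc m) + 5/2))"
    unfolding Suc.IH G1 G2 by (simp add: field_simps)
  finally show ?case .
qed

text \<open>The exponential series converges uniformly in \<open>t\<close> and may be integrated
  term by term; the constant 1 in the integrand of \<open>piston\<close> contributes the zeroth
  moment, which is 1.\<close>

lemma piston_sums: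
  "(\<lambda>n. - of_real (piston_moment n / fact n) * (- 2 * w) ^ n) sums (piston w - 1)"
proof -
  define d where "d n t = - ((- 2 * w) ^ n * of_real (cos t ^ n * (sin t)\<^sup>2) / fact n)" for n t
  have sums_d: "(\<lambda>n. d n t) sums (- exp (- 2 * w * of_real (cos t)) * of_real ((sin t)\<^sup>2))" for t
  proof -
    have "(\<lambda>n. - (((- 2 * w * of_real (cos t)) ^ n /\<^sub>R fact n) * of_real ((sin t)\<^sup>2)))
            sums - (exp (- 2 * w * of_real (cos t)) * of_real ((sin t)\<^sup>2))"
      by (intro sums_minus sums_mult2 exp_converges)
    also have "(\<lambda>n. - (((- 2 * w * of_real (cos t)) ^ n /\<^sub>R fact n) * of_real ((sin t)\<^sup>2))) = (\<lambda>n. d n t)"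
      by (rule ext, unfold d_def power_mult_distrib[of "- 2 * w"])
         (simp add: scaleR_conv_of_real divide_inverse mult_ac)
    finally show ?thesis by simp
  qed
  have bound: "norm (d n t) \<le> (2 * norm w) ^ n / fact n" for n t
  proof -
    have "norm (d n t) = (2 * norm w) ^ n / fact n * (\<bar>cos t\<bar> ^ n * (sin t)\<^sup>2)"
      by (simp add: d_def norm_mult norm_divide norm_power power_abs abs_mult flip: of_real_mult of_real_power)
    also have "\<dots> \<le> (2 * norm w) ^ n / fact n * (1 * 1)"
      by (intro mult_left_mono mult_mono power_le_one abs_square_le_1[THEN iffD2]) auto
    finally show ?thesis by simp
  qed
  have "summable (\<lambda>n. (2 * norm w) ^ n / fact n)"
    using sums_summable[OF exp_converges[of "2 * norm w"]] by (simp add: divide_inverse mult.commute)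
  hence "uniform_limit {0..pi/2} (\<lambda>n t. \<Sum>i<n. d i t) (\<lambda>t. \<Sum>i. d i t) sequentially"
    by (rule Weierstrass_m_test[OF bound])
  also have "(\<lambda>t. \<Sum>i. d i t) = (\<lambda>t. - exp (- 2 * w * of_real (cos t)) * of_real ((sin t)\<^sup>2))"
    using sums_d by (simp add: sums_iff)
  finally obtain I J where I: "\<And>n. ((\<lambda>t. \<Sum>i<n. d i t) has_integral I n) {0..pi/2}"
      and J: "((\<lambda>t. - exp (- 2 * w * of_real (cos t)) * of_real ((sin t)\<^sup>2)) has_integral J) {0..pi/2}"
      and lim: "I \<longlonglongrightarrow> J"
    by (rule uniform_limit_integral) (auto simp: d_def intro!: continuous_intros)
  have hi: "((\<lambda>t. complex_of_real (cos t ^ n * (sin t)\<^sup>2)) has_integral of_real (pi / 4 * piston_moment n)) {0..pi/2}" for n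
    using integrable_integral[OF piston_moment_integrable[of n]]
    by (intro has_integral_of_real) (simp add: piston_moment_def)
  have d_int: "(d n has_integral pi / 4 * (- of_real (piston_moment n / fact n) * (- 2 * w) ^ n)) {0..pi/2}" for n
    using has_integral_mult_right[OF hi[of n], of "- ((- 2 * w) ^ n / fact n)"]
    by (simp add: d_def[abs_def] field_simps)
  have "I n = (\<Sum>i<n. pi / 4 * (- of_real (piston_moment i / fact i) * (- 2 * w) ^ i))" for n
    by (rule has_integral_unique[OF I]) (intro has_integral_sum d_int, auto)
  hence "I = (\<lambda>n. \<Sum>i<n. pi / 4 * (- of_real (piston_moment i / fact i) * (- 2 * w) ^ i))" by (rule ext)
  hence "(\<lambda>i. pi / 4 * (- of_real (piston_moment i / fact i) * (- 2 * w) ^ i)) sums J"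
    using lim unfolding sums_def by (simp only:)
  hence s: "(\<lambda>i. of_real (4 / pi) * (pi / 4 * (- of_real (piston_moment i / fact i) * (- 2 * w) ^ i))) sums (of_real (4 / pi) * J)"
    by (rule sums_mult)
  have "piston w = of_real (4 / pi) * (of_real (pi / 4) + J)"
  proof -
    have "((\<lambda>t. of_real (cos t ^ 0 * (sin t)\<^sup>2) + - exp (- 2 * w * of_real (cos t)) * of_real ((sin t)\<^sup>2)) has_integral
             of_real (pi / 4 * piston_moment 0) + J) {0..pi/2}"
      by (intro has_integral_add hi J)
    thus ?thesis unfolding piston_def piston_moment_0 by (simp add: integral_unique left_diff_distrib)
  qed
  moreover have "complex_of_real (4 / pi) * of_real (pi / 4) = 1" by (simp flip: of_real_mult)
  ultimately have "of_real (4 / pi) * J = piston w - 1" by (simp only: distrib_left) simp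
  with s show ?thesis by simp
qed

lemma piston_0 [simp]: "piston 0 = 0"
  by (simp add: piston_def)

lemma piston_power_series:
  "(\<lambda>n. - of_real (piston_moment n / fact n) * (- 2) ^ n * w ^ n) sums (piston w - 1)"
  using piston_sums[of w] by (simp only: power_mult_distrib mult.assoc)

text \<open>The value is twice the first moment. That it is not 0 lets the pressure near
  \<open>k = 0\<close> reveal the lip radius.\<close>

lemma piston_has_deriv_0: "(piston has_field_derivative 8 / (3 * of_real pi)) (at 0)"
proof -
  define c where "c n = - complex_of_real (piston_moment n / fact n) * (- 2) ^ n" for n
  have s: "(\<lambda>n. c n * w ^ n) sums (piston w - 1)" for w
    using piston_power_series by (simp add: c_def)
  have "((\<lambda>z. \<Sum>n. c n * z ^ n) has_field_derivative (\<Sum>n. diffs c n * 0 ^ n)) (at 0)"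
    by (rule termdiffs_strong'[of 1]) (use s in \<open>auto simp: sums_iff\<close>)
  moreover have "(\<lambda>z. \<Sum>n. c n * z ^ n) = (\<lambda>z. piston z - 1)" using s by (simp add: sums_iff fun_eq_iff)
  ultimately have "((\<lambda>z. (piston z - 1) + 1) has_field_derivative (\<Sum>n. diffs c n * 0 ^ n) + 0) (at 0)"
    by (intro derivative_intros) auto
  thus ?thesis by (simp add: powser_zero diffs_def c_def piston_moment_1)
qed

lemma piston_holomorphic: "piston holomorphic_on A"
proof -
  have "(\<lambda>w. piston w - 1) holomorphic_on ball 0 R" for R
    by (rule power_series_holomorphic[where a = "\<lambda>n. - of_real (piston_moment n / fact n) * (- 2) ^ n"])
       (use piston_power_series in \<open>simp only: diff_zero\<close>)
  hence "(\<lambda>w. (piston w - 1) + 1) holomorphic_on ball 0 R" for R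
    by (rule holomorphic_on_add) (rule holomorphic_on_const)
  hence "piston holomorphic_on (\<Union>R. ball 0 R)"
    by (intro holomorphic_on_UN_open) auto
  moreover have "(\<Union>R. ball (0::complex) R) = UNIV" by (auto intro: gt_ex)
  ultimately show ?thesis using holomorphic_on_subset by fastforce
qed

lemma piston_holomorphic' [holomorphic_intros]:
  "f holomorphic_on A \<Longrightarrow> (\<lambda>z. piston (f z)) holomorphic_on A"
  using holomorphic_on_compose[OF _ piston_holomorphic, of f A] by (simp add: o_def)

lemma piston_cnj: "piston (cnj w) = cnj (piston w)"
proof -
  have "(\<lambda>n. cnj (- of_real (piston_moment n / fact n) * (- 2 * w) ^ n)) sums cnj (piston w - 1)"
    unfolding sums_cnj by (rule piston_sums)
  thus ?thesis using piston_sums[of "cnj w"] sums_unique2 by fastforce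
qed

lemma impedance_eq_piston:
  assumes "a \<noteq> 0"
  shows "impedance a k = piston (\<i> * k * of_real a)"
proof -
  have eq: "1 - Bessel_J 1 (2 * k * of_real a) / (k * of_real a)
       + \<i> * Struve_H 1 (2 * k * of_real a) / (k * of_real a) = piston (\<i> * k * of_real a)"
    if "k \<noteq> 0" for k
  proof -
    define y where "y = k * complex_of_real a"
    have y: "y \<noteq> 0" using that assms by (simp add: y_def)
    define e where "e n = - of_real (piston_moment n / fact n) * (- 2 * (\<i> * y)) ^ n" for n
    have es: "e sums (piston (\<i> * y) - 1)" unfolding e_def by (rule piston_sums)
    have abs_e: "summable (\<lambda>n. norm (e n))"
    proof -
      have "summable (\<lambda>n. - of_real (piston_moment n / fact n) * (- 2) ^ n * of_real (norm y + 1) ^ n :: complex)"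
        using piston_power_series sums_summable by blast
      hence "summable (\<lambda>n. norm (- of_real (piston_moment n / fact n) * (- 2) ^ n * (\<i> * y) ^ n))"
        by (rule powser_insidea) (simp add: norm_mult del: of_real_add)
      thus ?thesis by (simp only: e_def power_mult_distrib mult.assoc)
    qed
    \<comment> \<open>Absolute convergence permits splitting the series into its even (Bessel) and
      odd (Struve) part.\<close>
    have sum_even: "summable (\<lambda>m. e (2 * m))" and sum_odd: "summable (\<lambda>m. e (2 * m + 1))"
      using summable_reindex[OF abs_e, of "\<lambda>m. 2 * m"] summable_reindex[OF abs_e, of "\<lambda>m. 2 * m + 1"]
      by (auto simp: o_def inj_def intro: summable_norm_cancel)
    have "(\<lambda>m. sum e {m * 2..<m * 2 + 2}) sums (piston (\<i> * y) - 1)"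
      by (rule sums_group[OF es]) simp
    moreover have "sum e {m * 2..<m * 2 + 2} = e (2 * m) + e (2 * m + 1)" for m
      by (simp add: numeral_eq_Suc mult.commute)
    ultimately have split: "piston (\<i> * y) - 1 = (\<Sum>m. e (2 * m)) + (\<Sum>m. e (2 * m + 1))"
      using suminf_add[OF sum_even sum_odd] by (simp add: sums_iff)
    have pow: "(- 2 * (\<i> * y)) ^ (2 * m) = 2 ^ (2 * m) * ((-1) ^ m * y ^ (2 * m))" for m
    proof -
      have "- 2 * (\<i> * y) = 2 * ((- \<i>) * y)" by simp
      thus ?thesis unfolding power_mult_distrib by (simp add: power_mult power_mult_distrib)
    qed
    have "(\<lambda>m. - y * e (2 * m)) = (\<lambda>m. (-1) ^ m / (fact m * fact (m + 1)) * (2 * y / 2) ^ (2 * m + 1))"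
    proof
      fix m
      have "e (2 * m) = - of_real (2 ^ (2 * m) * piston_moment (2 * m) / fact (2 * m)) * ((-1) ^ m * y ^ (2 * m))"
        unfolding e_def pow by simp
      also have "\<dots> = - (1 / (fact m * fact (m + 1))) * ((-1) ^ m * y ^ (2 * m))"
        unfolding piston_moment_even by (simp del: fact_Suc)
      finally show "- y * e (2 * m) = (-1) ^ m / (fact m * fact (m + 1)) * (2 * y / 2) ^ (2 * m + 1)"
        by (simp del: fact_Suc)
    qed
    hence J: "Bessel_J 1 (2 * y) = - y * (\<Sum>m. e (2 * m))"
      unfolding Bessel_J_def by (simp only: suminf_mult[OF sum_even, symmetric])
    have "(\<lambda>m. - \<i> * y * e (2 * m + 1)) =
      (\<lambda>m. (-1) ^ m / (Gamma (of_nat m + 3 / 2) * Gamma (of_nat m + of_nat 1 + 3 / 2)) * (2 * y / 2) ^ (2 * m + 1 + 1))"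
    proof
      fix m
      have "e (2 * m + 1) = of_real (2 ^ (2 * m + 1) * piston_moment (2 * m + 1) / fact (2 * m + 1)) * (\<i> * (-1) ^ m * y ^ (2 * m + 1))"
        unfolding e_def power_add pow by (simp del: fact_Suc)
      also have "\<dots> = of_real (1 / (Gamma (real m + 3/2) * Gamma (real m + 5/2))) * (\<i> * (-1) ^ m * y ^ (2 * m + 1))"
        unfolding piston_moment_odd ..
      also have "complex_of_real (1 / (Gamma (real m + 3/2) * Gamma (real m + 5/2))) =
          1 / (Gamma (of_nat m + 3 / 2) * Gamma (of_nat m + of_nat 1 + 3 / 2))"
        using Gamma_complex_of_real[of "real m + 3/2"] Gamma_complex_of_real[of "real m + 5/2"] by (simp add: add.assoc)
      finally have e: "e (2 * m + 1) = 1 / (Gamma (of_nat m + 3 / 2) * Gamma (of_nat m + of_nat 1 + 3 / 2)) * (\<i> * (-1) ^ m * y ^ (2 * m + 1))" .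
      have "- \<i> * y * (X * (\<i> * s * Y)) = - (\<i> * \<i>) * (s * X * (y * Y))" for X Y s :: complex
        by algebra
      hence "- \<i> * y * (X * (\<i> * s * Y)) = s * X * (y * Y)" for X Y s :: complex
        by simp
      hence "- \<i> * y * e (2 * m + 1) = (-1) ^ m * (1 / (Gamma (of_nat m + 3 / 2) * Gamma (of_nat m + of_nat 1 + 3 / 2))) * (y * y ^ (2 * m + 1))"
        unfolding e .
      thus "- \<i> * y * e (2 * m + 1) =
          (-1) ^ m / (Gamma (of_nat m + 3 / 2) * Gamma (of_nat m + of_nat 1 + 3 / 2)) * (2 * y / 2) ^ (2 * m + 1 + 1)"
        by simp
    qed
    hence H: "Struve_H 1 (2 * y) = - \<i> * y * (\<Sum>m. e (2 * m + 1))"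
      unfolding Struve_H_def by (simp only: suminf_mult[OF sum_odd, symmetric])
    have "1 - Bessel_J 1 (2 * y) / y + \<i> * Struve_H 1 (2 * y) / y = piston (\<i> * y)"
    proof -
      have "- y * A / y = - A" "\<i> * (- \<i> * y * B) / y = B" for A B using y by auto
      thus ?thesis unfolding J H using split by (simp add: algebra_simps)
    qed
    thus ?thesis by (simp add: y_def mult.assoc)
  qed
  have "impedance a k = remove_sings (\<lambda>k. piston (\<i> * k * of_real a)) k"
    unfolding impedance_def
    by (intro remove_sings_cong eventually_mono[OF eventually_neq_at_within[of 0 k]] eq) auto
  also have "\<dots> = piston (\<i> * k * of_real a)"
  proof (rule remove_sings_at_analytic)
    have "(\<lambda>k. piston (\<i> * k * of_real a)) holomorphic_on UNIV" by (intro holomorphic_intros)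
    thus "(\<lambda>k. piston (\<i> * k * of_real a)) analytic_on {k}" using analytic_on_holomorphic by blast
  qed
  finally show ?thesis .
qed

lemma piston_integrable:
  "(\<lambda>t. (1 - exp (- 2 * w * of_real (cos t))) * complex_of_real ((sin t)\<^sup>2)) integrable_on {0..pi/2}"
  by (intro integrable_continuous_interval continuous_intros)

lemma norm_piston_le: "norm (piston w) \<le> 1 + exp (2 * norm w)"
proof -
  have "norm (integral {0..pi/2} (\<lambda>t. (1 - exp (- 2 * w * of_real (cos t))) * of_real ((sin t)\<^sup>2)))
     \<le> integral {0..pi/2} (\<lambda>t. (1 + exp (2 * norm w)) * (cos t ^ 0 * (sin t)\<^sup>2))"
  proof (rule integral_norm_bound_integral)
    fix t :: real
    have "norm (exp (- 2 * w * of_real (cos t))) \<le> exp (norm (- 2 * w * of_real (cos t)))" by (rule norm_exp)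
    also have "\<dots> \<le> exp (2 * norm w)" by (simp add: norm_mult mult_left_le)
    finally have "norm (1 - exp (- 2 * w * of_real (cos t))) \<le> 1 + exp (2 * norm w)"
      by (intro order.trans[OF norm_triangle_ineq4]) simp
    thus "norm ((1 - exp (- 2 * w * of_real (cos t))) * of_real ((sin t)\<^sup>2)) \<le> (1 + exp (2 * norm w)) * (cos t ^ 0 * (sin t)\<^sup>2)"
      by (simp add: norm_mult norm_power mult_right_mono)
  qed (intro piston_integrable integrable_on_mult_right piston_moment_integrable)+
  also have "\<dots> = (1 + exp (2 * norm w)) * integral {0..pi/2} (\<lambda>t. cos t ^ 0 * (sin t)\<^sup>2)"
    by (rule integral_mult_right)
  also have "integral {0..pi/2} (\<lambda>t. cos t ^ 0 * (sin t)\<^sup>2) = pi / 4"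
    using piston_moment_0 by (simp add: piston_moment_def field_simps)
  finally have "4 / pi * norm (integral {0..pi/2} (\<lambda>t. (1 - exp (- 2 * w * of_real (cos t))) * complex_of_real ((sin t)\<^sup>2)))
     \<le> 4 / pi * ((1 + exp (2 * norm w)) * (pi / 4))" by (intro mult_left_mono) auto
  thus ?thesis unfolding piston_def norm_mult norm_of_real by simp
qed

text \<open>For \<open>Re w \<ge> 0\<close> the exponential has modulus at most 1, so the real part
  of the integrand is nonnegative and continuous; a vanishing integral would force it to be 0 at
  every \<open>t\<close>.\<close>

lemma Re_piston_pos:
  assumes "Re w \<ge> 0" and "w \<noteq> 0"
  shows "Re (piston w) > 0"
proof -
  define f where "f t = (1 - Re (exp (- 2 * w * of_real (cos t)))) * (sin t)\<^sup>2" for t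
  have Re_le: "Re (exp (- 2 * w * of_real c)) \<le> 1" if "c \<ge> 0" for c
  proof -
    have "norm (exp (- 2 * w * of_real c)) \<le> 1" using assms that by simp
    thus ?thesis using complex_Re_le_cmod order_trans by blast
  qed
  have cos_nonneg: "cos t \<ge> 0" if "t \<in> {0..pi/2}" for t
    using that by (intro cos_ge_zero) auto
  have "Re (piston w) = 4 / pi * integral {0..pi/2} f"
  proof -
    have "((\<lambda>t. Re ((1 - exp (- 2 * w * of_real (cos t))) * complex_of_real ((sin t)\<^sup>2))) has_integral
       Re (integral {0..pi/2} (\<lambda>t. (1 - exp (- 2 * w * of_real (cos t))) * complex_of_real ((sin t)\<^sup>2)))) {0..pi/2}"
      by (intro has_integral_Re integrable_integral piston_integrable)
    hence "Re (integral {0..pi/2} (\<lambda>t. (1 - exp (- 2 * w * of_real (cos t))) * complex_of_real ((sin t)\<^sup>2))) = integral {0..pi/2} f"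
      unfolding f_def by (intro integral_unique[symmetric]) (simp del: of_real_power)
    thus ?thesis unfolding piston_def by (simp del: of_real_power of_real_divide)
  qed
  moreover have nonneg: "f t \<ge> 0" if "t \<in> {0..pi/2}" for t
    unfolding f_def using Re_le cos_nonneg[OF that] by (intro mult_nonneg_nonneg) auto
  moreover have cont: "continuous_on {0..pi/2} f" unfolding f_def by (intro continuous_intros)
  moreover have "integral {0..pi/2} f \<noteq> 0"
  proof
    assume "integral {0..pi/2} f = 0"
    hence f0: "f t = 0" if "t \<in> {0..pi/2}" for t
      using integral_eq_0_iff[OF cont _ nonneg] that by simp
    \<comment> \<open>On the line \<open>Re w = 0\<close> this value of \<open>cos t\<close> keeps
      \<open>\<bar>2 * Im w * c\<bar>\<close> strictly between 0 and 2, hence below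
      \<open>pi\<close>, so that its cosine is less than 1.\<close>
    define c where "c = 1 / (2 + \<bar>Im w\<bar>)"
    have c: "0 < c" "c < 1" by (auto simp: c_def)
    define t where "t = arccos c"
    have t: "t \<in> {0..pi/2}" "cos t = c" "sin t > 0"
      using c arccos_le_pi2[of c] arccos_lbound[of c] arccos_lt_bounded[of c] sin_gt_zero[of t]
      by (auto simp: t_def)
    have "Re (exp (- 2 * w * of_real c)) < 1"
    proof (cases "Re w > 0")
      case True
      have "Re (exp (- 2 * w * of_real c)) \<le> norm (exp (- 2 * w * of_real c))" by (rule complex_Re_le_cmod)
      also have "\<dots> < 1" using True c by simp
      finally show ?thesis .
    next
      case False
      with assms have w: "Re w = 0" "Im w \<noteq> 0" by (auto simp: complex_eq_iff)
      have "\<bar>2 * Im w * c\<bar> < 2" "0 < \<bar>2 * Im w * c\<bar>" using w by (auto simp: c_def abs_mult divide_simps)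
      hence "cos \<bar>2 * Im w * c\<bar> < cos 0" using pi_gt3 by (intro cos_monotone_0_pi) auto
      moreover have "cos \<bar>x\<bar> = cos x" for x :: real by (cases "x \<ge> 0") auto
      ultimately have "cos (2 * Im w * c) < 1" by simp
      thus ?thesis using w by (simp add: Re_exp)
    qed
    hence "f t > 0" using t unfolding f_def by simp
    thus False using f0[OF t(1)] by simp
  qed
  ultimately show ?thesis
    using integral_nonneg[OF integrable_continuous_interval[OF cont] nonneg] by simp
qed

lemma piston_of_real:
  "piston (of_real s) = of_real (4 / pi * integral {0..pi/2} (\<lambda>t. (1 - exp (- 2 * s * cos t)) * (sin t)\<^sup>2))"
proof -
  have "(\<lambda>t. (1 - exp (- 2 * s * cos t)) * (sin t)\<^sup>2) integrable_on {0..pi/2}"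
    by (intro integrable_continuous_interval continuous_intros)
  from has_integral_of_real[OF integrable_integral[OF this], where 'b = complex]
  show ?thesis unfolding piston_def by (simp add: integral_unique exp_of_real[symmetric])
qed

lemma piston_pos_real:
  assumes "s \<ge> 0"
  obtains z where "piston (of_real s) = of_real z" "0 \<le> z" "z \<le> 1"
proof -
  define z where "z = 4 / pi * integral {0..pi/2} (\<lambda>t. (1 - exp (- 2 * s * cos t)) * (sin t)\<^sup>2)"
  have int: "(\<lambda>t. (1 - exp (- 2 * s * cos t)) * (sin t)\<^sup>2) integrable_on {0..pi/2}"
    by (intro integrable_continuous_interval continuous_intros)
  have cos_nonneg: "cos t \<ge> 0" if "t \<in> {0..pi/2}" for t
    using that by (intro cos_ge_zero) auto
  have "z \<ge> 0" unfolding z_def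
    by (intro mult_nonneg_nonneg integral_nonneg int) (use assms cos_nonneg in auto)
  have "integral {0..pi/2} (\<lambda>t. (1 - exp (- 2 * s * cos t)) * (sin t)\<^sup>2) \<le> integral {0..pi/2} (\<lambda>t. cos t ^ 0 * (sin t)\<^sup>2)"
  proof (intro integral_le int piston_moment_integrable)
    fix t :: real
    have "(1 - exp (- 2 * s * cos t)) * (sin t)\<^sup>2 \<le> 1 * (sin t)\<^sup>2" by (rule mult_right_mono) auto
    thus "(1 - exp (- 2 * s * cos t)) * (sin t)\<^sup>2 \<le> cos t ^ 0 * (sin t)\<^sup>2" by simp
  qed
  hence "z \<le> 1" using piston_moment_0 by (simp add: z_def piston_moment_def mult_left_mono field_simps)
  with \<open>z \<ge> 0\<close> show ?thesis using that piston_of_real z_def by metis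
qed

text \<open>The logarithmic rate only sees \<open>exp (2 * s)\<close> up to a power of
  \<open>s\<close>. For the lower bound \<open>(sin t)\<^sup>2\<close> is replaced by the smaller
  \<open>sin t * (1 - cos t)\<close>, which can be integrated in closed form.\<close>

lemma piston_neg_real:
  assumes "s > 0"
  obtains z where "piston (- of_real s) = - of_real z"
    "1 / pi * (exp (2 * s) - 1 - 2 * s - 2 * s\<^sup>2) / s\<^sup>2 \<le> z" "z \<le> exp (2 * s)"
proof -
  define f where "f t = (exp (2 * s * cos t) - 1) * (sin t)\<^sup>2" for t
  define z where "z = 4 / pi * integral {0..pi/2} f"
  have "piston (of_real (- s)) = of_real (4 / pi * integral {0..pi/2} (\<lambda>t. - f t))"
  proof -
    have "(1 - exp (- 2 * (- s) * cos t)) * (sin t)\<^sup>2 = - f t" for t by (simp add: f_def algebra_simps)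
    thus ?thesis unfolding piston_of_real by simp
  qed
  hence eq: "piston (- of_real s) = - of_real z" by (simp add: z_def)
  have int: "f integrable_on {0..pi/2}"
    unfolding f_def by (intro integrable_continuous_interval continuous_intros)
  have cos_nonneg: "cos t \<ge> 0" if "t \<in> {0..pi/2}" for t
    using that by (intro cos_ge_zero) auto
  have "integral {0..pi/2} f \<le> integral {0..pi/2} (\<lambda>t. exp (2 * s) * (cos t ^ 0 * (sin t)\<^sup>2))"
  proof (intro integral_le int integrable_on_mult_right piston_moment_integrable)
    fix t :: real
    have "exp (2 * s * cos t) \<le> exp (2 * s)" using assms by simp
    hence "exp (2 * s * cos t) - 1 \<le> exp (2 * s)" by linarith
    hence "(exp (2 * s * cos t) - 1) * (sin t)\<^sup>2 \<le> exp (2 * s) * (sin t)\<^sup>2" by (rule mult_right_mono) auto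
    thus "f t \<le> exp (2 * s) * (cos t ^ 0 * (sin t)\<^sup>2)" unfolding f_def by simp
  qed
  also have "\<dots> = exp (2 * s) * integral {0..pi/2} (\<lambda>t. cos t ^ 0 * (sin t)\<^sup>2)"
    by (rule integral_mult_right)
  also have "integral {0..pi/2} (\<lambda>t. cos t ^ 0 * (sin t)\<^sup>2) = pi / 4"
    using piston_moment_0 by (simp add: piston_moment_def field_simps)
  finally have upper: "z \<le> exp (2 * s)" by (simp add: z_def field_simps)
  define p q where "p = 1 / (2 * s)" and "q = 1 / (4 * s\<^sup>2)"
  \<comment> \<open>Found by substituting \<open>x = cos t\<close>: an antiderivative of
    \<open>(1 - exp (2 * s * x)) * (1 - x)\<close> in \<open>x\<close>.\<close>
  define A where "A t = cos t - 1 / 2 * (cos t * cos t) - p * ((1 - cos t) * exp (2 * s * cos t)) - q * exp (2 * s * cos t)" for t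
  define g where "g t = (exp (2 * s * cos t) - 1) * (sin t * (1 - cos t))" for t
  have hg: "(g has_integral (A (pi/2) - A 0)) {0..pi/2}"
  proof (rule fundamental_theorem_of_calculus)
    fix t :: real
    have "(A has_real_derivative - sin t + 1 / 2 * (2 * cos t * sin t)
       - p * (sin t * exp (2 * s * cos t) - (1 - cos t) * (exp (2 * s * cos t) * (2 * s * sin t)))
       + q * (exp (2 * s * cos t) * (2 * s * sin t))) (at t within {0..pi/2})"
      unfolding A_def by (rule derivative_eq_intros refl)+ (simp add: algebra_simps)
    also have "- sin t + 1 / 2 * (2 * cos t * sin t)
       - p * (sin t * exp (2 * s * cos t) - (1 - cos t) * (exp (2 * s * cos t) * (2 * s * sin t)))
       + q * (exp (2 * s * cos t) * (2 * s * sin t)) = g t"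
      using assms by (simp add: g_def p_def q_def field_simps power2_eq_square)
    finally show "(A has_vector_derivative g t) (at t within {0..pi/2})"
      by (simp add: has_real_derivative_iff_has_vector_derivative)
  qed auto
  have "integral {0..pi/2} g \<le> integral {0..pi/2} f"
  proof (intro integral_le int has_integral_integrable[OF hg])
    fix t :: real assume t: "t \<in> {0..pi/2}"
    have "sin t \<ge> 0" using t by (intro sin_ge_zero) auto
    have "1 \<le> sin t + cos t"
    proof (rule power2_le_imp_le)
      have "2 * sin t * cos t \<ge> 0" using \<open>sin t \<ge> 0\<close> cos_nonneg[OF t] by simp
      thus "1\<^sup>2 \<le> (sin t + cos t)\<^sup>2" using sin_cos_squared_add[of t] by (simp add: power2_sum)
    qed (use \<open>sin t \<ge> 0\<close> cos_nonneg[OF t] in auto)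
    hence "sin t * (1 - cos t) \<le> sin t * sin t" using \<open>sin t \<ge> 0\<close> by (intro mult_left_mono) auto
    moreover have "exp (2 * s * cos t) - 1 \<ge> 0" using assms cos_nonneg[OF t] by simp
    ultimately show "g t \<le> f t" unfolding f_def g_def power2_eq_square by (rule mult_left_mono)
  qed
  also have "integral {0..pi/2} g = (exp (2 * s) - 1 - 2 * s - 2 * s\<^sup>2) / (4 * s\<^sup>2)"
  proof -
    have "A (pi/2) - A 0 = q * exp (2 * s) - q - p - 1 / 2" by (simp add: A_def)
    also have "\<dots> = (exp (2 * s) - 1 - 2 * s - 2 * s\<^sup>2) / (4 * s\<^sup>2)"
      using assms by (simp add: p_def q_def divide_simps) (simp add: algebra_simps power2_eq_square)
    finally show ?thesis using integral_unique[OF hg] by simp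
  qed
  finally have "4 / pi * ((exp (2 * s) - 1 - 2 * s - 2 * s\<^sup>2) / (4 * s\<^sup>2)) \<le> z"
    unfolding z_def by (intro mult_left_mono) auto
  moreover have "4 / pi * (x / (4 * s\<^sup>2)) = 1 / pi * x / s\<^sup>2" for x by simp
  ultimately have lower: "1 / pi * (exp (2 * s) - 1 - 2 * s - 2 * s\<^sup>2) / s\<^sup>2 \<le> z" by metis
  show ?thesis by (rule that[OF eq lower upper])
qed

section \<open>Power series solutions of a symmetric first-order system\<close>

lemma has_vector_derivative_series:
  fixes f :: "nat \<Rightarrow> real \<Rightarrow> 'a::banach"
  assumes "convex S"
    and "\<And>n x. x \<in> S \<Longrightarrow> (f n has_vector_derivative f' n x) (at x within S)"
    and "uniform_limit S (\<lambda>n x. \<Sum>i<n. f' i x) g' sequentially"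
    and "\<And>x. x \<in> S \<Longrightarrow> summable (\<lambda>n. f n x)"
    and "x \<in> S"
  shows "((\<lambda>x. \<Sum>n. f n x) has_vector_derivative g' x) (at x within S)"
proof -
  have "\<exists>g. \<forall>x\<in>S. (\<lambda>n. f n x) sums g x \<and> (g has_derivative (\<lambda>h. h *\<^sub>R g' x)) (at x within S)"
  proof (rule has_derivative_series[OF assms(1), where f' = "\<lambda>n x h. h *\<^sub>R f' n x"])
    show "\<forall>\<^sub>F n in sequentially. \<forall>x\<in>S. \<forall>h. norm ((\<Sum>i<n. h *\<^sub>R f' i x) - h *\<^sub>R g' x) \<le> e * norm h"
      if "e > 0" for e
      using uniform_limitD[OF assms(3) that]
    proof eventually_elim
      case (elim n)
      show ?case
      proof (intro ballI allI)
        fix x h assume "x \<in> S"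
        have "norm ((\<Sum>i<n. h *\<^sub>R f' i x) - h *\<^sub>R g' x) = \<bar>h\<bar> * norm ((\<Sum>i<n. f' i x) - g' x)"
          by (simp flip: scaleR_sum_right scaleR_diff_right)
        also have "\<dots> \<le> \<bar>h\<bar> * e"
          using elim \<open>x \<in> S\<close> by (intro mult_left_mono) (auto simp: dist_norm less_imp_le)
        finally show "norm ((\<Sum>i<n. h *\<^sub>R f' i x) - h *\<^sub>R g' x) \<le> e * norm h" by (simp add: mult.commute)
      qed
    qed
  qed (use assms in \<open>auto simp: has_vector_derivative_def summable_sums\<close>)
  then obtain g where g: "\<And>x. x \<in> S \<Longrightarrow> (\<lambda>n. f n x) sums g x"
      "\<And>x. x \<in> S \<Longrightarrow> (g has_vector_derivative g' x) (at x within S)"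
    unfolding has_vector_derivative_def by blast
  show ?thesis
    by (rule has_vector_derivative_transform[OF \<open>x \<in> S\<close> _ g(2)[OF \<open>x \<in> S\<close>]])
       (use g(1) in \<open>auto simp: sums_iff\<close>)
qed

text \<open>Picard iteration for \<open>p' = \<kappa> * u * q\<close>,
  \<open>q' = \<kappa> * v * p\<close> from the initial values 1 and 0: these are the coefficients
  of the powers of \<kappa>. The weights alternate because each integration passes from one
  component to the other.\<close>

primrec iter_int :: "(real \<Rightarrow> real) \<Rightarrow> (real \<Rightarrow> real) \<Rightarrow> nat \<Rightarrow> real \<Rightarrow> real" where
  "iter_int u v 0 x = 1"
| "iter_int u v (Suc n) x = integral {0..x} (\<lambda>t. (if even n then v t else u t) * iter_int u v n t)"

definition iter_series :: "(real \<Rightarrow> real) \<Rightarrow> (real \<Rightarrow> real) \<Rightarrow> complex \<Rightarrow> real \<Rightarrow> complex" where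
  "iter_series u v \<kappa> x = (\<Sum>n. \<kappa> ^ n * of_real (iter_int u v n x))"

text \<open>The two components of the system are the parts of \<open>iter_series\<close> that are
  even and odd in \<kappa>, so one series serves both.\<close>

definition sol_even :: "(real \<Rightarrow> real) \<Rightarrow> (real \<Rightarrow> real) \<Rightarrow> complex \<Rightarrow> real \<Rightarrow> complex" where
  "sol_even u v \<kappa> x = (iter_series u v \<kappa> x + iter_series u v (- \<kappa>) x) / 2"

definition sol_odd :: "(real \<Rightarrow> real) \<Rightarrow> (real \<Rightarrow> real) \<Rightarrow> complex \<Rightarrow> real \<Rightarrow> complex" where
  "sol_odd u v \<kappa> x = (iter_series u v \<kappa> x - iter_series u v (- \<kappa>) x) / 2"

locale weight_pair =
  fixes u v :: "real \<Rightarrow> real" and L :: real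
  assumes L_pos: "L > 0"
    and cont_u: "continuous_on {0..L} u" and cont_v: "continuous_on {0..L} v"
    and u_pos: "\<And>x. x \<in> {0..L} \<Longrightarrow> u x > 0" and v_pos: "\<And>x. x \<in> {0..L} \<Longrightarrow> v x > 0"
begin

lemma weights_bounded: "\<exists>M>0. \<forall>x\<in>{0..L}. u x \<le> M \<and> v x \<le> M"
proof -
  have "compact (u ` {0..L} \<union> v ` {0..L})"
    by (intro compact_Un compact_continuous_image cont_u cont_v) auto
  then obtain B where "\<And>y. y \<in> u ` {0..L} \<union> v ` {0..L} \<Longrightarrow> norm y \<le> B"
    using compact_imp_bounded bounded_iff by metis
  thus ?thesis by (intro exI[of _ "\<bar>B\<bar> + 1"]) fastforce
qed

definition M where "M = (SOME M. M > 0 \<and> (\<forall>x\<in>{0..L}. u x \<le> M \<and> v x \<le> M))"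

lemma M: "M > 0" "\<And>x. x \<in> {0..L} \<Longrightarrow> u x \<le> M" "\<And>x. x \<in> {0..L} \<Longrightarrow> v x \<le> M"
  using someI_ex[OF weights_bounded] unfolding M_def by auto

lemma iter_int_cont: "continuous_on {0..L} (iter_int u v n)"
proof (induction n)
  case (Suc n)
  have "continuous_on {0..L} (\<lambda>t. (if even n then v t else u t) * iter_int u v n t)"
    by (cases "even n") (auto intro!: continuous_intros cont_u cont_v Suc)
  hence "(\<lambda>t. (if even n then v t else u t) * iter_int u v n t) integrable_on {0..L}"
    by (rule integrable_continuous_interval)
  thus ?case by (simp add: indefinite_integral_continuous_1)
qed auto

lemma integrand_cont: "continuous_on {0..L} (\<lambda>t. (if even n then v t else u t) * iter_int u v n t)"
  by (cases "even n") (auto intro!: continuous_intros cont_u cont_v iter_int_cont)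

lemma iter_int_deriv:
  assumes "x \<in> {0..L}"
  shows "(iter_int u v (Suc n) has_real_derivative (if even n then v x else u x) * iter_int u v n x)
           (at x within {0..L})"
proof -
  have "iter_int u v (Suc n) = (\<lambda>x. integral {0..x} (\<lambda>t. (if even n then v t else u t) * iter_int u v n t))"
    by (rule ext) simp
  thus ?thesis using integral_has_real_derivative[OF integrand_cont assms] by metis
qed

text \<open>The factorial is that of the volume of a simplex; it makes the series entire of
  exponential type in \<kappa>. Nonnegativity comes from the positive weights.\<close>

lemma iter_int_bounds:
  assumes "x \<in> {0..L}"
  shows "0 \<le> iter_int u v n x \<and> iter_int u v n x \<le> (M * x) ^ n / fact n"
  using assms
proof (induction n arbitrary: x)
  case (Suc n)
  let ?f = "\<lambda>t. (if even n then v t else u t) * iter_int u v n t"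
  have sub: "{0..x} \<subseteq> {0..L}" using Suc.prems by auto
  have int: "?f integrable_on {0..x}"
    by (intro integrable_continuous_interval continuous_on_subset[OF integrand_cont sub])
  have w: "0 \<le> (if even n then v t else u t) \<and> (if even n then v t else u t) \<le> M" if "t \<in> {0..x}" for t
    using M u_pos v_pos that sub by (auto simp: less_imp_le subset_iff)
  have "0 \<le> integral {0..x} ?f"
    by (intro integral_nonneg int mult_nonneg_nonneg) (use w Suc.IH sub in \<open>auto simp del: iter_int.simps\<close>)
  moreover have hi: "((\<lambda>t. M * ((M * t) ^ n / fact n)) has_integral (M * x) ^ Suc n / fact (Suc n) - (M * 0) ^ Suc n / fact (Suc n)) {0..x}"
  proof (rule fundamental_theorem_of_calculus)
    show "0 \<le> x" using Suc.prems by simp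
    fix t
    have "((\<lambda>t. (M * t) ^ Suc n / fact (Suc n)) has_real_derivative M * ((M * t) ^ n / fact n)) (at t within {0..x})"
      by (auto intro!: derivative_eq_intros simp del: power_Suc)
    thus "((\<lambda>t. (M * t) ^ Suc n / fact (Suc n)) has_vector_derivative M * ((M * t) ^ n / fact n)) (at t within {0..x})"
      by (simp add: has_real_derivative_iff_has_vector_derivative)
  qed
  have "integral {0..x} ?f \<le> integral {0..x} (\<lambda>t. M * ((M * t) ^ n / fact n))"
  proof (rule integral_le[OF int])
    show "(\<lambda>t. M * ((M * t) ^ n / fact n)) integrable_on {0..x}" using hi by blast
    fix t assume t: "t \<in> {0..x}"
    show "?f t \<le> M * ((M * t) ^ n / fact n)"
      using w[OF t] Suc.IH[of t] t sub M(1) by (intro mult_mono) auto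
  qed
  ultimately show ?case using integral_unique[OF hi] by simp
qed auto

lemma iter_int_zero: "iter_int u v n 0 = (if n = 0 then 1 else 0)"
  by (cases n) auto

lemma iter_int_le: "x \<in> {0..L} \<Longrightarrow> \<bar>iter_int u v n x\<bar> \<le> (M * L) ^ n / fact n"
  using iter_int_bounds[of x n] M(1) L_pos
  by (auto intro!: order.trans[OF conjunct2[OF iter_int_bounds[of x n]]] divide_right_mono power_mono mult_nonneg_nonneg)

lemma term_bound:
  fixes \<kappa> :: complex
  assumes "x \<in> {0..L}"
  shows "norm (\<kappa> ^ n * of_real (iter_int u v n x)) \<le> (norm \<kappa> * (M * L)) ^ n / fact n"
proof -
  have "norm (\<kappa> ^ n * of_real (iter_int u v n x)) \<le> norm \<kappa> ^ n * ((M * L) ^ n / fact n)"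
    unfolding norm_mult norm_power norm_of_real by (intro mult_left_mono iter_int_le assms) auto
  thus ?thesis by (simp add: power_mult_distrib)
qed

lemma exp_terms_sums: "(\<lambda>n. (c::real) ^ n / fact n) sums exp c"
  using exp_converges[of c] by (simp add: divide_inverse mult.commute)

lemma iter_series_summable:
  fixes \<kappa> :: complex
  assumes "x \<in> {0..L}"
  shows "summable (\<lambda>n. \<kappa> ^ n * of_real (iter_int u v n x))"
  by (rule summable_comparison_test'[OF sums_summable[OF exp_terms_sums] term_bound[OF assms]])

lemma norm_iter_series_le:
  assumes "x \<in> {0..L}"
  shows "norm (iter_series u v \<kappa> x) \<le> exp (norm \<kappa> * (M * L))"
proof -
  have "norm (iter_series u v \<kappa> x) \<le> (\<Sum>n. (norm \<kappa> * (M * L)) ^ n / fact n)"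
    unfolding iter_series_def
    by (rule norm_suminf_le[OF term_bound[OF assms]]) (rule sums_summable[OF exp_terms_sums])
  thus ?thesis using sums_unique[OF exp_terms_sums] by simp
qed

lemma iter_series_holomorphic:
  assumes "x \<in> {0..L}"
  shows "(\<lambda>\<kappa>. iter_series u v \<kappa> x) holomorphic_on A"
proof -
  have "(\<lambda>\<kappa>. iter_series u v \<kappa> x) holomorphic_on ball 0 R" for R
  proof (rule power_series_holomorphic)
    fix w :: complex
    show "(\<lambda>n. of_real (iter_int u v n x) * (w - 0) ^ n) sums iter_series u v w x"
      using summable_sums[OF iter_series_summable[OF assms, of w]] by (simp add: iter_series_def mult.commute)
  qed
  hence "(\<lambda>\<kappa>. iter_series u v \<kappa> x) holomorphic_on (\<Union>R. ball 0 R)"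
    by (intro holomorphic_on_UN_open) auto
  moreover have "(\<Union>R. ball (0::complex) R) = UNIV" by (auto intro: gt_ex)
  ultimately show ?thesis using holomorphic_on_subset by fastforce
qed

lemma iter_series_deriv:
  assumes "x \<in> {0..L}"
  shows "(iter_series u v \<kappa> has_vector_derivative
           \<kappa> * (of_real (v x) * sol_even u v \<kappa> x + of_real (u x) * sol_odd u v \<kappa> x)) (at x within {0..L})"
proof -
  \<comment> \<open>The index is shifted: differentiating coefficient \<open>Suc m\<close> returns
    coefficient \<open>m\<close> with the weight chosen by the parity of \<open>m\<close>, and
    coefficient 0 is constant.\<close>
  define d where "d n x = (case n of 0 \<Rightarrow> 0 | Suc m \<Rightarrow>
    \<kappa> ^ n * of_real ((if even m then v x else u x) * iter_int u v m x))" for n x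
  have d_bound: "norm (d n x) \<le> norm \<kappa> * M * (case n of 0 \<Rightarrow> 0 | Suc m \<Rightarrow> (norm \<kappa> * (M * L)) ^ m / fact m)"
    if x: "x \<in> {0..L}" for n x
  proof (cases n)
    case (Suc m)
    have "norm (d n x) = norm \<kappa> * \<bar>if even m then v x else u x\<bar> * norm (\<kappa> ^ m * of_real (iter_int u v m x))"
      by (simp add: d_def Suc norm_mult norm_power abs_mult del: iter_int.simps)
    also have "\<dots> \<le> norm \<kappa> * M * ((norm \<kappa> * (M * L)) ^ m / fact m)"
      using M x u_pos[OF x] v_pos[OF x] by (intro mult_mono mult_nonneg_nonneg term_bound) auto
    finally show ?thesis by (simp add: Suc)
  qed (simp add: d_def)
  have summ: "summable (\<lambda>n. norm \<kappa> * M * (case n of 0 \<Rightarrow> 0 | Suc m \<Rightarrow> (norm \<kappa> * (M * L)) ^ m / fact m))"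
    by (intro summable_mult) (subst summable_Suc_iff [symmetric], simp add: sums_summable[OF exp_terms_sums])
  have ul: "uniform_limit {0..L} (\<lambda>n x. \<Sum>i<n. d i x) (\<lambda>x. \<Sum>i. d i x) sequentially"
    by (rule Weierstrass_m_test[OF d_bound summ])
  have "(iter_series u v \<kappa> has_vector_derivative (\<Sum>i. d i x)) (at x within {0..L})"
    unfolding iter_series_def
  proof (rule has_vector_derivative_series[OF _ _ ul iter_series_summable assms])
    fix n x assume x: "x \<in> {0..L}"
    show "((\<lambda>x. \<kappa> ^ n * complex_of_real (iter_int u v n x)) has_vector_derivative d n x) (at x within {0..L})"
    proof (cases n)
      case (Suc m)
      show ?thesis
        unfolding d_def Suc nat.case
        by (intro has_vector_derivative_mult_right has_vector_derivative_of_real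
              iter_int_deriv[OF x, of m])
    qed (simp add: d_def)
  qed auto
  moreover have "(\<lambda>n. d n x) sums (\<kappa> * (of_real (v x) * sol_even u v \<kappa> x + of_real (u x) * sol_odd u v \<kappa> x))"
  proof -
    have s: "(\<lambda>n. k ^ n * of_real (iter_int u v n x)) sums iter_series u v k x" for k
      unfolding iter_series_def by (rule summable_sums[OF iter_series_summable[OF assms]])
    \<comment> \<open>Half sum and half difference of the weights, the latter with the sign of
      \<open>(- \<kappa>) ^ m\<close>, select \<open>v\<close> for even and \<open>u\<close> for odd
      \<open>m\<close>.\<close>
    have "(\<lambda>m. \<kappa> * (of_real ((v x + u x) / 2) * (\<kappa> ^ m * of_real (iter_int u v m x)) +
                   of_real ((v x - u x) / 2) * ((- \<kappa>) ^ m * of_real (iter_int u v m x))))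
          sums (\<kappa> * (of_real ((v x + u x) / 2) * iter_series u v \<kappa> x + of_real ((v x - u x) / 2) * iter_series u v (- \<kappa>) x))"
      by (intro sums_mult sums_add s)
    also have "(\<lambda>m. \<kappa> * (of_real ((v x + u x) / 2) * (\<kappa> ^ m * of_real (iter_int u v m x)) +
                   of_real ((v x - u x) / 2) * ((- \<kappa>) ^ m * of_real (iter_int u v m x)))) = (\<lambda>m. d (Suc m) x)"
      by (auto simp: d_def fun_eq_iff field_simps del: iter_int.simps)
    also have "\<kappa> * (of_real ((v x + u x) / 2) * iter_series u v \<kappa> x + of_real ((v x - u x) / 2) * iter_series u v (- \<kappa>) x)
      = \<kappa> * (of_real (v x) * sol_even u v \<kappa> x + of_real (u x) * sol_odd u v \<kappa> x)"
      by (simp add: sol_even_def sol_odd_def field_simps)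
    finally show ?thesis by (subst (asm) sums_Suc_iff) (simp add: d_def)
  qed
  ultimately show ?thesis by (simp add: sums_iff)
qed

lemma sol_even_minus: "sol_even u v (- \<kappa>) x = sol_even u v \<kappa> x"
  and sol_odd_minus: "sol_odd u v (- \<kappa>) x = - sol_odd u v \<kappa> x"
  by (simp_all add: sol_even_def sol_odd_def field_simps)

lemma sol_even_deriv:
  assumes "x \<in> {0..L}"
  shows "(sol_even u v \<kappa> has_vector_derivative \<kappa> * of_real (u x) * sol_odd u v \<kappa> x) (at x within {0..L})"
proof -
  have "((\<lambda>x. (iter_series u v \<kappa> x + iter_series u v (- \<kappa>) x) / 2) has_vector_derivative
     (\<kappa> * (of_real (v x) * sol_even u v \<kappa> x + of_real (u x) * sol_odd u v \<kappa> x) +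
     (- \<kappa>) * (of_real (v x) * sol_even u v (-\<kappa>) x + of_real (u x) * sol_odd u v (-\<kappa>) x)) / 2) (at x within {0..L})"
    by (intro has_vector_derivative_divide has_vector_derivative_add iter_series_deriv assms)
  moreover have "sol_even u v \<kappa> = (\<lambda>x. (iter_series u v \<kappa> x + iter_series u v (- \<kappa>) x) / 2)"
    by (rule ext) (simp add: sol_even_def)
  ultimately show ?thesis unfolding sol_even_minus sol_odd_minus by (simp add: field_simps)
qed

lemma sol_odd_deriv:
  assumes "x \<in> {0..L}"
  shows "(sol_odd u v \<kappa> has_vector_derivative \<kappa> * of_real (v x) * sol_even u v \<kappa> x) (at x within {0..L})"
proof -
  have "((\<lambda>x. (iter_series u v \<kappa> x - iter_series u v (- \<kappa>) x) / 2) has_vector_derivative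
     (\<kappa> * (of_real (v x) * sol_even u v \<kappa> x + of_real (u x) * sol_odd u v \<kappa> x) -
     (- \<kappa>) * (of_real (v x) * sol_even u v (-\<kappa>) x + of_real (u x) * sol_odd u v (-\<kappa>) x)) / 2) (at x within {0..L})"
    by (intro has_vector_derivative_divide has_vector_derivative_diff iter_series_deriv assms)
  moreover have "sol_odd u v \<kappa> = (\<lambda>x. (iter_series u v \<kappa> x - iter_series u v (- \<kappa>) x) / 2)"
    by (rule ext) (simp add: sol_odd_def)
  ultimately show ?thesis unfolding sol_even_minus sol_odd_minus by (simp add: field_simps)
qed

lemma iter_series_0: "iter_series u v \<kappa> 0 = 1"
proof -
  have "(\<lambda>n. \<kappa> ^ n * complex_of_real (iter_int u v n 0)) = (\<lambda>n. if n = 0 then 1 else 0)"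
    by (auto simp: iter_int_zero)
  thus ?thesis unfolding iter_series_def by (subst suminf_finite[of "{0}"]) (auto simp: iter_int_zero)
qed

lemma sol_even_0 [simp]: "sol_even u v \<kappa> 0 = 1" and sol_odd_0 [simp]: "sol_odd u v \<kappa> 0 = 0"
  by (simp_all add: sol_even_def sol_odd_def iter_series_0)

lemma iter_series_kappa_0: "iter_series u v 0 x = 1"
  unfolding iter_series_def by (subst suminf_finite[of "{0}"]) auto

lemma sol_holomorphic [holomorphic_intros]:
  assumes "x \<in> {0..L}"
  shows "(\<lambda>\<kappa>. sol_even u v \<kappa> x) holomorphic_on A" "(\<lambda>\<kappa>. sol_odd u v \<kappa> x) holomorphic_on A"
proof -
  have "((\<lambda>\<kappa>. iter_series u v \<kappa> x) \<circ> uminus) holomorphic_on A"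
    by (intro holomorphic_on_compose iter_series_holomorphic assms holomorphic_intros)
  thus "(\<lambda>\<kappa>. sol_even u v \<kappa> x) holomorphic_on A" "(\<lambda>\<kappa>. sol_odd u v \<kappa> x) holomorphic_on A"
    unfolding sol_even_def sol_odd_def
    by (auto intro!: holomorphic_intros iter_series_holomorphic[OF assms] simp: o_def)
qed

lemma norm_sol_le:
  assumes "x \<in> {0..L}"
  shows "norm (sol_even u v \<kappa> x) \<le> exp (norm \<kappa> * (M * L))" "norm (sol_odd u v \<kappa> x) \<le> exp (norm \<kappa> * (M * L))"
proof -
  have "norm (iter_series u v \<kappa> x + iter_series u v (- \<kappa>) x) \<le> 2 * exp (norm \<kappa> * (M * L))"
    using norm_triangle_le[OF add_mono[OF norm_iter_series_le[OF assms, of \<kappa>] norm_iter_series_le[OF assms, of "-\<kappa>"]]] by simp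
  thus "norm (sol_even u v \<kappa> x) \<le> exp (norm \<kappa> * (M * L))" by (simp add: sol_even_def norm_divide)
  have "norm (iter_series u v \<kappa> x - iter_series u v (- \<kappa>) x) \<le> 2 * exp (norm \<kappa> * (M * L))"
    using norm_triangle_le_diff[OF add_mono[OF norm_iter_series_le[OF assms, of \<kappa>] norm_iter_series_le[OF assms, of "-\<kappa>"]]] by simp
  thus "norm (sol_odd u v \<kappa> x) \<le> exp (norm \<kappa> * (M * L))" by (simp add: sol_odd_def norm_divide)
qed

lemma iter_series_cnj: 
  assumes "x \<in> {0..L}"
  shows "iter_series u v (cnj \<kappa>) x = cnj (iter_series u v \<kappa> x)"
proof -
  have "(\<lambda>n. cnj (\<kappa> ^ n * of_real (iter_int u v n x))) sums cnj (iter_series u v \<kappa> x)"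
    unfolding iter_series_def sums_cnj by (rule summable_sums[OF iter_series_summable[OF assms]])
  thus ?thesis by (simp add: sums_iff iter_series_def)
qed

lemma sol_cnj:
  assumes "x \<in> {0..L}"
  shows "sol_even u v (cnj \<kappa>) x = cnj (sol_even u v \<kappa> x)" "sol_odd u v (cnj \<kappa>) x = cnj (sol_odd u v \<kappa> x)"
  using iter_series_cnj[OF assms, of \<kappa>] iter_series_cnj[OF assms, of "-\<kappa>"]
  by (simp_all add: sol_even_def sol_odd_def)

text \<open>All coefficients are nonnegative: the odd part is a sum of nonnegative terms, and the
  even part is at least its term of index 0, which is 1.\<close>

lemma sol_real:
  assumes "x \<in> {0..L}" and "t \<ge> 0"
  shows "\<exists>p q. sol_even u v (of_real t) x = of_real p \<and> sol_odd u v (of_real t) x = of_real q \<and> p \<ge> 1 \<and> q \<ge> 0"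
proof -
  define S where "S k = (\<Sum>n. k ^ n * iter_int u v n x)" for k
  have summ: "summable (\<lambda>n. k ^ n * iter_int u v n x)" for k
    using iter_series_summable[OF assms(1), of "of_real k"]
    by (subst summable_of_real_iff [symmetric, where 'a = complex]) simp
  have S: "iter_series u v (of_real k) x = of_real (S k)" for k
    unfolding iter_series_def S_def suminf_of_real[OF summ] by simp
  have nonneg: "iter_int u v n x \<ge> 0" for n using iter_int_bounds[OF assms(1), of n] by simp
  have "0 \<le> (\<Sum>n. t ^ n * iter_int u v n x - (- t) ^ n * iter_int u v n x)"
  proof (rule suminf_nonneg)
    show "0 \<le> t ^ n * iter_int u v n x - (- t) ^ n * iter_int u v n x" for n
      using assms(2) nonneg[of n] by (cases "even n") auto
  qed (intro summable_diff summ)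
  hence odd: "S t - S (- t) \<ge> 0" unfolding S_def suminf_diff[OF summ summ] .
  have "(\<Sum>n<1. t ^ n * iter_int u v n x + (- t) ^ n * iter_int u v n x) \<le> (\<Sum>n. t ^ n * iter_int u v n x + (- t) ^ n * iter_int u v n x)"
  proof (rule sum_le_suminf)
    show "0 \<le> t ^ n * iter_int u v n x + (- t) ^ n * iter_int u v n x" for n
      using assms(2) nonneg[of n] by (cases "even n") auto
  qed (auto intro!: summable_add summ)
  hence even: "S t + S (- t) \<ge> 2" unfolding S_def suminf_add[OF summ summ] by simp
  show ?thesis
    by (intro exI[of _ "(S t + S (- t)) / 2"] exI[of _ "(S t - S (- t)) / 2"])
       (use S[of t] S[of "-t"] odd even in \<open>auto simp: sol_even_def sol_odd_def\<close>)
qed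

end

section \<open>The pressure at the lips\<close>

text \<open>\<open>lo\<close> multiplies the lower bounds for the piston factor and for
  \<open>chi\<close> found in \<open>den_growth_upper\<close>, with
  \<open>b = 1 / a\<^sup>2\<close>. Only the exponentials survive the division of the logarithm by
  \<open>t\<close>.\<close>

lemma growth_rate_asymp:
  fixes a b C K L :: real
  assumes "a > 0" "b > 0" "L > 0" "C > 0"
  defines "lo \<equiv> \<lambda>t. exp (2 * (t * a)) / (2 * pi * (t * a)\<^sup>2) * (exp ((t - K) * L) / (2 * (C * t + b))) * b"
  shows "((\<lambda>t. ln (lo t) / t) \<longlongrightarrow> 2 * a + L) at_top"
proof -
  have "((\<lambda>t. (2 * a * t - ln (2 * pi * (a * t)\<^sup>2) + (L * t - K * L) - ln (2 * (C * t + b)) + ln b) / t)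
          \<longlongrightarrow> 2 * a + L) at_top"
    using assms(1-4) by real_asymp
  moreover have "eventually (\<lambda>t. (2 * a * t - ln (2 * pi * (a * t)\<^sup>2) + (L * t - K * L) - ln (2 * (C * t + b)) + ln b) / t
      = ln (lo t) / t) at_top"
    using eventually_gt_at_top[of 0]
  proof eventually_elim
    case (elim t)
    have "C * t + b > 0" "2 * pi * (a * t)\<^sup>2 > 0" using elim assms(1-4) by (auto intro: add_pos_pos)
    hence "ln (lo t) = (2 * (t * a) - ln (2 * pi * (t * a)\<^sup>2)) + ((t - K) * L - ln (2 * (C * t + b))) + ln b"
    proof -
      have ln_eq: "ln (X / Y * (U / V) * b) = (ln X - ln Y) + (ln U - ln V) + ln b"
        if "X > 0" "Y > 0" "U > 0" "V > 0" for X Y U V :: real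
        using that \<open>b > 0\<close> by (simp add: ln_mult_pos ln_divide_pos)
      show ?thesis unfolding lo_def
        by (subst ln_eq) (use \<open>C * t + b > 0\<close> assms(1-4) elim in \<open>simp_all only: ln_exp exp_gt_zero\<close>, auto)
    qed
    thus ?case by (simp add: algebra_simps)
  qed
  ultimately show ?thesis by (rule Lim_transform_eventually)
qed

lemma affine_rate: "((\<lambda>t. (2 * a * t + (t + K) * L) / t) \<longlongrightarrow> 2 * a + L) at_top" for a K L :: real
proof -
  have "((\<lambda>t. 2 * a + L + K * L / t) \<longlongrightarrow> 2 * a + L) at_top" by real_asymp
  moreover have "eventually (\<lambda>t. 2 * a + L + K * L / t = (2 * a * t + (t + K) * L) / t) at_top"
    using eventually_gt_at_top[of 0] by eventually_elim (simp add: field_simps)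
  ultimately show ?thesis by (rule Lim_transform_eventually)
qed

lemma eventually_exp_dominates:
  fixes a K L :: real
  assumes "a > 0" "L > 0"
  shows "eventually (\<lambda>t. exp (2 * (t * a)) / 2 \<le> exp (2 * (t * a)) - 1 - 2 * (t * a) - 2 * (t * a)\<^sup>2) at_top"
    and "eventually (\<lambda>t. exp ((t - K) * L) / 2 \<le> exp ((t - K) * L) - 1) at_top"
proof -
  show "eventually (\<lambda>t. exp (2 * (t * a)) / 2 \<le> exp (2 * (t * a)) - 1 - 2 * (t * a) - 2 * (t * a)\<^sup>2) at_top"
    using assms by real_asymp
  show "eventually (\<lambda>t. exp ((t - K) * L) / 2 \<le> exp ((t - K) * L) - 1) at_top"
    using assms by real_asymp
qed

lemma weierstrass_factor_1_eq: "weierstrass_factor (Suc 0) z = (1 - z) * exp z"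
  by (simp add: weierstrass_factor_def)

abbreviation first_quadrant :: "complex set" where "first_quadrant \<equiv> {k. Re k > 0 \<and> Im k > 0}"

section \<open>The first-order system of a tract and its energy flux\<close>

locale tract =
  fixes L :: real and r :: "real \<Rightarrow> real"
  assumes length_pos: "L > 0" and radius: "class_A L r"
begin

definition w1 where "w1 x = 1 / (r x)\<^sup>2"
definition w2 where "w2 x = (r x)\<^sup>2"

lemma r_pos: "x \<in> {0..L} \<Longrightarrow> r x > 0"
  using radius by (auto simp: class_A_def)

lemma r_deriv: "\<exists>r1. (\<forall>x\<in>{0..L}. (r has_real_derivative r1 x) (at x within {0..L})) \<and> continuous_on {0..L} r1"
  using radius unfolding class_A_def by blast

lemma r_cont: "continuous_on {0..L} r"
  using r_deriv unfolding continuous_on_eq_continuous_within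
  by (meson DERIV_continuous)

sublocale A: weight_pair w1 w2 L
proof
  show "continuous_on {0..L} w1" "continuous_on {0..L} w2"
    unfolding w1_def w2_def using r_pos by (force intro!: continuous_intros r_cont)+
qed (use length_pos r_pos in \<open>force simp: w1_def w2_def\<close>)+

sublocale B: weight_pair w2 w1 L
  by standard (use length_pos A.cont_u A.cont_v A.u_pos A.v_pos in auto)

lemma w1w2: "x \<in> {0..L} \<Longrightarrow> w1 x * w2 x = 1"
  using r_pos[of x] by (simp add: w1_def w2_def)

text \<open>For \<open>\<kappa> = \<i> * k\<close> the pair of \<open>P\<close> and \<open>r\<^sup>2 * P' / \<kappa>\<close> solves the symmetric system
  \<open>P' = \<kappa> * w1 * V\<close>, \<open>V' = \<kappa> * w2 * P\<close>; \<open>(phi, chi)\<close> and \<open>(chi2, phi2)\<close> are its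
  solutions with initial values \<open>(1, 0)\<close> and \<open>(0, 1)\<close>.\<close>

definition phi where "phi = sol_even w1 w2"
definition chi where "chi = sol_odd w1 w2"
definition phi2 where "phi2 = sol_even w2 w1"
definition chi2 where "chi2 = sol_odd w2 w1"

lemma phi_deriv: "x \<in> {0..L} \<Longrightarrow> (phi \<kappa> has_vector_derivative \<kappa> * of_real (w1 x) * chi \<kappa> x) (at x within {0..L})"
  and chi_deriv: "x \<in> {0..L} \<Longrightarrow> (chi \<kappa> has_vector_derivative \<kappa> * of_real (w2 x) * phi \<kappa> x) (at x within {0..L})"
  and phi2_deriv: "x \<in> {0..L} \<Longrightarrow> (phi2 \<kappa> has_vector_derivative \<kappa> * of_real (w2 x) * chi2 \<kappa> x) (at x within {0..L})"
  and chi2_deriv: "x \<in> {0..L} \<Longrightarrow> (chi2 \<kappa> has_vector_derivative \<kappa> * of_real (w1 x) * phi2 \<kappa> x) (at x within {0..L})"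
  unfolding phi_def chi_def phi2_def chi2_def
  by (rule A.sol_even_deriv A.sol_odd_deriv B.sol_even_deriv B.sol_odd_deriv; assumption)+

lemma init: "phi \<kappa> 0 = 1" "chi \<kappa> 0 = 0" "phi2 \<kappa> 0 = 1" "chi2 \<kappa> 0 = 0"
  by (simp_all add: phi_def chi_def phi2_def chi2_def)

text \<open>The derivative is demanded in the open interval only, since the boundary value problem
  differentiates \<open>r\<^sup>2 * P'\<close> only there.\<close>

lemma zero_deriv_const:
  fixes f :: "real \<Rightarrow> complex"
  assumes "continuous_on {0..L} f" and "\<And>x. x \<in> {0<..<L} \<Longrightarrow> (f has_vector_derivative 0) (at x within {0..L})"
    and "x \<in> {0..L}"
  shows "f x = f 0"
proof (rule has_derivative_zero_unique_strong_convex[of "{0..L}" "{0, L}"])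
  fix x assume "x \<in> {0..L} - {0, L}"
  thus "(f has_derivative (\<lambda>h. 0)) (at x within {0..L})"
    using assms(2)[of x] by (auto simp: has_vector_derivative_def)
qed (use assms length_pos in auto)

text \<open>The coefficient matrix of the system has trace 0. The identity is used to exclude that
  \<open>phi\<close> and \<open>chi\<close> vanish at the same point.\<close>

lemma wronskian:
  assumes "x \<in> {0..L}"
  shows "phi \<kappa> x * phi2 \<kappa> x - chi \<kappa> x * chi2 \<kappa> x = 1"
proof -
  define f where "f x = phi \<kappa> x * phi2 \<kappa> x - chi \<kappa> x * chi2 \<kappa> x" for x
  have d: "(f has_vector_derivative 0) (at x within {0..L})" if "x \<in> {0..L}" for x
  proof -
    have "(f has_vector_derivative
        (phi \<kappa> x * (\<kappa> * of_real (w2 x) * chi2 \<kappa> x) + \<kappa> * of_real (w1 x) * chi \<kappa> x * phi2 \<kappa> x) -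
        (chi \<kappa> x * (\<kappa> * of_real (w1 x) * phi2 \<kappa> x) + \<kappa> * of_real (w2 x) * phi \<kappa> x * chi2 \<kappa> x)) (at x within {0..L})"
      unfolding f_def using that
      by (intro has_vector_derivative_diff has_vector_derivative_mult phi_deriv chi_deriv phi2_deriv chi2_deriv)
    thus ?thesis by (simp add: algebra_simps)
  qed
  have "f x = f 0"
  proof (rule zero_deriv_const[OF _ _ assms])
    show "continuous_on {0..L} f"
      using d has_vector_derivative_continuous continuous_on_eq_continuous_within by blast
  qed (use d in auto)
  thus ?thesis by (simp add: f_def init)
qed

text \<open>The flux \<open>Re (chi * cnj phi)\<close> has a derivative of the sign of \<open>Re \<kappa>\<close>; this
  carries all information on the location of poles.\<close>

lemma flux:
  "\<exists>s>0. Re (chi \<kappa> L * cnj (phi \<kappa> L)) = Re \<kappa> * s"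
proof -
  define g where "g x = Re (chi \<kappa> x * cnj (phi \<kappa> x))" for x
  have d: "(g has_vector_derivative Re \<kappa> * (w2 x * (norm (phi \<kappa> x))\<^sup>2 + w1 x * (norm (chi \<kappa> x))\<^sup>2)) (at x within {0..L})"
    if x: "x \<in> {0..L}" for x
  proof -
    have "((\<lambda>x. chi \<kappa> x * cnj (phi \<kappa> x)) has_vector_derivative
       chi \<kappa> x * cnj (\<kappa> * of_real (w1 x) * chi \<kappa> x) + \<kappa> * of_real (w2 x) * phi \<kappa> x * cnj (phi \<kappa> x)) (at x within {0..L})"
      by (intro has_vector_derivative_mult has_vector_derivative_cnj chi_deriv phi_deriv x)
    hence "(g has_vector_derivative
       Re (chi \<kappa> x * cnj (\<kappa> * of_real (w1 x) * chi \<kappa> x) + \<kappa> * of_real (w2 x) * phi \<kappa> x * cnj (phi \<kappa> x))) (at x within {0..L})"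
      unfolding g_def by (rule bounded_linear.has_vector_derivative[OF bounded_linear_Re])
    also have "chi \<kappa> x * cnj (\<kappa> * of_real (w1 x) * chi \<kappa> x) + \<kappa> * of_real (w2 x) * phi \<kappa> x * cnj (phi \<kappa> x)
      = cnj \<kappa> * of_real (w1 x) * (chi \<kappa> x * cnj (chi \<kappa> x)) + \<kappa> * of_real (w2 x) * (phi \<kappa> x * cnj (phi \<kappa> x))"
      by (simp add: mult_ac)
    also have "Re \<dots> = Re \<kappa> * (w2 x * (norm (phi \<kappa> x))\<^sup>2 + w1 x * (norm (chi \<kappa> x))\<^sup>2)"
      unfolding complex_norm_square[symmetric]
      by (simp only: of_real_mult[symmetric] mult.assoc plus_complex.sel times_complex.sel Re_complex_of_real
          Im_complex_of_real cnj.sel) (simp add: algebra_simps)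
    finally show ?thesis .
  qed
  \<comment> \<open>The mean value theorem replaces integration of the derivative: positivity of the
    weighted squares at one point is enough for the sign.\<close>
  have "\<exists>x\<in>{0<..<L}. g L - g 0 = (L - 0) *\<^sub>R (Re \<kappa> * (w2 x * (norm (phi \<kappa> x))\<^sup>2 + w1 x * (norm (chi \<kappa> x))\<^sup>2))"
    by (rule mvt_simple[OF length_pos]) (use d in \<open>auto simp: has_vector_derivative_def\<close>)
  then obtain x where x: "x \<in> {0<..<L}"
    "g L - g 0 = L * (Re \<kappa> * (w2 x * (norm (phi \<kappa> x))\<^sup>2 + w1 x * (norm (chi \<kappa> x))\<^sup>2))" by auto
  have "phi \<kappa> x \<noteq> 0 \<or> chi \<kappa> x \<noteq> 0" using wronskian[of x \<kappa>] x by auto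
  hence "w2 x * (norm (phi \<kappa> x))\<^sup>2 + w1 x * (norm (chi \<kappa> x))\<^sup>2 > 0"
  proof
    assume "phi \<kappa> x \<noteq> 0"
    thus ?thesis using A.u_pos[of x] A.v_pos[of x] x by (intro add_pos_nonneg) auto
  next
    assume "chi \<kappa> x \<noteq> 0"
    thus ?thesis using A.u_pos[of x] A.v_pos[of x] x by (intro add_nonneg_pos) auto
  qed
  moreover have "g 0 = 0" by (simp add: g_def init)
  ultimately show ?thesis using x length_pos unfolding g_def
    by (intro exI[of _ "L * (w2 x * (norm (phi \<kappa> x))\<^sup>2 + w1 x * (norm (chi \<kappa> x))\<^sup>2)"]) auto
qed

section \<open>The denominator of the pressure and the location of its zeros\<close>

definition a where "a = r L"

lemma a_pos: "a > 0" unfolding a_def using r_pos length_pos by simp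

text \<open>The zeros of \<open>den\<close> are the poles of the pressure at the lips.\<close>

definition den where
  "den k = phi (\<i> * k) L + piston (\<i> * k * of_real a) * chi (\<i> * k) L / of_real (a\<^sup>2)"

lemma L_mem: "L \<in> {0..L}" using length_pos by simp

lemma den_holomorphic: "den holomorphic_on A"
proof -
  have *: "(\<lambda>k. phi (\<i> * k) L) holomorphic_on A" "(\<lambda>k. chi (\<i> * k) L) holomorphic_on A" for A
    using holomorphic_on_compose[OF _ A.sol_holomorphic(1)[OF L_mem], of "\<lambda>k. \<i> * k" A]
      holomorphic_on_compose[OF _ A.sol_holomorphic(2)[OF L_mem], of "\<lambda>k. \<i> * k" A]
    by (auto simp: phi_def chi_def o_def intro!: holomorphic_intros)
  show ?thesis unfolding den_def by (intro holomorphic_intros *) (use a_pos in auto)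
qed

lemma den_0: "den 0 = 1"
  by (simp add: den_def phi_def chi_def sol_even_def sol_odd_def A.iter_series_kappa_0)

text \<open>All series have real coefficients in \<open>\<kappa> = \<i> * k\<close>, and passing
  from \<open>k\<close> to \<open>- cnj k\<close> conjugates \<kappa>. Zeros are therefore symmetric
  about the imaginary axis.\<close>

lemma den_cnj: "den (- cnj k) = cnj (den k)"
proof -
  have "\<i> * - cnj k = cnj (\<i> * k)" by simp
  moreover have "\<i> * - cnj k * of_real a = cnj (\<i> * k * of_real a)" by simp
  ultimately show ?thesis unfolding den_def
    by (simp only: piston_cnj phi_def chi_def A.sol_cnj[OF L_mem]) simp
qed

lemma den_exponential_type: "\<exists>C. \<forall>k. norm (den k) \<le> exp (C * (1 + norm k))"
proof -
  define c where "c = A.M * L"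
  have c: "c \<ge> 0" using A.M(1) length_pos by (simp add: c_def)
  define b where "b = 1 + 2 / a\<^sup>2"
  have b: "b \<ge> 1" by (simp add: b_def)
  have "norm (den k) \<le> exp ((ln b + c + 2 * a) * (1 + norm k))" for k
  proof -
    have 1: "norm (phi (\<i> * k) L) \<le> exp (norm k * c)" "norm (chi (\<i> * k) L) \<le> exp (norm k * c)"
      using A.norm_sol_le[OF L_mem, of "\<i> * k"] by (simp_all add: phi_def chi_def c_def norm_mult)
    have "norm (piston (\<i> * k * of_real a)) \<le> 1 + exp (2 * norm (\<i> * k * of_real a))" by (rule norm_piston_le)
    also have "\<dots> \<le> 2 * exp (2 * a * norm k)" using a_pos by (simp add: norm_mult mult_ac)
    finally have 2: "norm (piston (\<i> * k * of_real a)) \<le> 2 * exp (2 * a * norm k)" .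
    have "norm (den k) \<le> norm (phi (\<i> * k) L) + norm (piston (\<i> * k * of_real a)) * norm (chi (\<i> * k) L) / a\<^sup>2"
      unfolding den_def by (rule order.trans[OF norm_triangle_ineq]) (simp add: norm_mult norm_divide norm_power)
    also have "\<dots> \<le> exp (norm k * c) + 2 * exp (2 * a * norm k) * exp (norm k * c) / a\<^sup>2"
      by (intro add_mono divide_right_mono mult_mono 1 2) auto
    also have "\<dots> \<le> exp (2 * a * norm k) * exp (norm k * c) + 2 * exp (2 * a * norm k) * exp (norm k * c) / a\<^sup>2"
      using a_pos by simp
    also have "\<dots> = b * (exp (2 * a * norm k) * exp (norm k * c))" by (simp add: b_def algebra_simps)
    also have "\<dots> = exp (ln b + 2 * a * norm k + norm k * c)" using b by (simp add: exp_add)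
    also have "\<dots> \<le> exp ((ln b + c + 2 * a) * (1 + norm k))"
      using b c a_pos by (simp add: algebra_simps)
    finally show ?thesis .
  qed
  thus ?thesis by blast
qed

text \<open>At a zero the solution \<open>(phi, chi)\<close>, which has no source at 0, satisfies
  the lip condition. With \<open>Re Z > 0\<close> this makes the flux nonpositive, whereas
  \<open>flux\<close> makes it nonnegative for \<open>Im k \<le> 0\<close>. So \<open>chi\<close>
  vanishes at the lips, then \<open>phi\<close> too, against the Wronskian.\<close>

lemma den_nonzero_lower:
  assumes "Im k \<le> 0"
  shows "den k \<noteq> 0"
proof
  assume zero: "den k = 0"
  hence k: "k \<noteq> 0" using den_0 by auto
  define Z where "Z = piston (\<i> * k * of_real a)"
  have "Re Z > 0" unfolding Z_def using assms a_pos k by (intro Re_piston_pos) (auto simp: mult_le_0_iff)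
  have phi: "phi (\<i> * k) L = - Z * chi (\<i> * k) L / of_real (a\<^sup>2)"
    using zero by (simp add: den_def Z_def add_eq_0_iff2)
  obtain s where s: "s > 0" "Re (chi (\<i> * k) L * cnj (phi (\<i> * k) L)) = Re (\<i> * k) * s" using flux by blast
  have "chi (\<i> * k) L * cnj (phi (\<i> * k) L) = of_real (- (norm (chi (\<i> * k) L))\<^sup>2 / a\<^sup>2) * cnj Z"
  proof -
    have "chi (\<i> * k) L * cnj (phi (\<i> * k) L) = - (chi (\<i> * k) L * cnj (chi (\<i> * k) L)) / of_real (a\<^sup>2) * cnj Z"
      unfolding phi by simp
    thus ?thesis unfolding complex_norm_square[symmetric] by simp
  qed
  hence "Re (chi (\<i> * k) L * cnj (phi (\<i> * k) L)) = - (norm (chi (\<i> * k) L))\<^sup>2 / a\<^sup>2 * Re Z"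
    by (simp only: Re_complex_of_real times_complex.sel Im_complex_of_real) simp
  moreover have "Re (\<i> * k) * s \<ge> 0" using assms s by (simp add: mult_nonpos_nonneg)
  ultimately have "(norm (chi (\<i> * k) L))\<^sup>2 / a\<^sup>2 * Re Z \<le> 0" using s by simp
  hence "chi (\<i> * k) L = 0" using \<open>Re Z > 0\<close> a_pos
    by (auto simp: mult_le_0_iff divide_le_0_iff)
  with phi have "phi (\<i> * k) L = 0" by simp
  thus False using wronskian[OF L_mem, of "\<i> * k"] \<open>chi (\<i> * k) L = 0\<close> by simp
qed

text \<open>At a common zero \<open>phi\<close> vanishes at the lips and the flux is 0; but zeros of
  \<open>den\<close> have \<open>Im k > 0\<close>, where the flux is not 0. Thus the numerator never
  cancels a pole.\<close>

lemma den_piston_no_common_zero: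
  assumes "den k = 0"
  shows "piston (\<i> * k * of_real a) \<noteq> 0"
proof
  assume Z: "piston (\<i> * k * of_real a) = 0"
  have "Im k > 0" using den_nonzero_lower[of k] assms by force
  obtain s where s: "s > 0" "Re (chi (\<i> * k) L * cnj (phi (\<i> * k) L)) = Re (\<i> * k) * s" using flux by blast
  have "phi (\<i> * k) L = 0" using assms Z by (simp add: den_def)
  thus False using s \<open>Im k > 0\<close> by simp
qed

section \<open>The boundary value problem and the formula for the pressure\<close>

lemma solution_value:
  assumes "solves_tract_bvp c \<mu> L r k P" and "k \<noteq> 0" and "den k \<noteq> 0"
  shows "P L = of_real (c * \<mu> / pi) * piston (\<i> * k * of_real a) / (of_real (a\<^sup>2) * den k)"
proof -
  define Z where "Z = piston (\<i> * k * of_real a)"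
  have imp: "impedance (r L) k = Z" using impedance_eq_piston[of a k] a_pos by (simp add: Z_def a_def)
  obtain Q where Z: "Z \<noteq> 0"
    and P': "\<And>x. x \<in> {0..L} \<Longrightarrow> (P has_vector_derivative Q x) (at x within {0..L})"
    and Qc: "continuous_on {0..L} Q"
    and Q': "\<And>x. x \<in> {0<..<L} \<Longrightarrow> ((\<lambda>y. of_real ((r y)\<^sup>2) * Q y) has_vector_derivative
                             - (k\<^sup>2 * of_real ((r x)\<^sup>2) * P x)) (at x)"
    and Q0: "Q 0 = - (\<i> * k * of_real c * of_real \<mu> / of_real (pi * (r 0)\<^sup>2))"
    and QL: "Q L + \<i> * k / Z * P L = 0"
    using assms(1) unfolding solves_tract_bvp_def imp by blast
  define \<kappa> where "\<kappa> = \<i> * k"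
  have \<kappa>: "\<kappa> \<noteq> 0" using assms by (simp add: \<kappa>_def)
  have k2: "k\<^sup>2 = - \<kappa>\<^sup>2" by (simp add: \<kappa>_def power_mult_distrib)
  define V where "V x = of_real (w2 x) * Q x / \<kappa>" for x
  have Vc: "continuous_on {0..L} V"
    unfolding V_def using \<kappa> by (intro continuous_intros Qc A.cont_v) auto
  have V': "(V has_vector_derivative \<kappa> * of_real (w2 x) * P x) (at x within {0..L})" if "x \<in> {0<..<L}" for x
  proof -
    have "(V has_vector_derivative - (k\<^sup>2 * of_real ((r x)\<^sup>2) * P x) / \<kappa>) (at x)"
      unfolding V_def w2_def by (intro has_vector_derivative_divide Q' that)
    hence "(V has_vector_derivative \<kappa> * of_real (w2 x) * P x) (at x)"
      using \<kappa> unfolding k2 by (simp add: w2_def power2_eq_square mult_ac)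
    thus ?thesis by (rule has_vector_derivative_at_within)
  qed
  have QV: "Q x = \<kappa> * of_real (w1 x) * V x" if "x \<in> {0..L}" for x
    using w1w2[OF that] \<kappa> by (simp add: V_def flip: of_real_mult mult.assoc)
  \<comment> \<open>Lagrange's identity against the solution \<open>(phi, chi)\<close>: this
    expression is constant, equals the source strength at 0, and at the lips becomes a multiple of
    \<open>P L\<close> by the boundary condition.\<close>
  define f where "f x = P x * chi \<kappa> x - V x * phi \<kappa> x" for x
  have "f L = f 0"
  proof (rule zero_deriv_const[OF _ _ L_mem])
    have "continuous_on {0..L} P"
      using P' has_vector_derivative_continuous continuous_on_eq_continuous_within by blast
    moreover have "continuous_on {0..L} (phi \<kappa>)" "continuous_on {0..L} (chi \<kappa>)"
      using phi_deriv chi_deriv has_vector_derivative_continuous continuous_on_eq_continuous_within by blast+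
    ultimately show "continuous_on {0..L} f" unfolding f_def by (intro continuous_intros Vc)
    fix x assume x: "x \<in> {0<..<L}"
    hence x': "x \<in> {0..L}" by simp
    have "(f has_vector_derivative
       (P x * (\<kappa> * of_real (w2 x) * phi \<kappa> x) + Q x * chi \<kappa> x) -
       (V x * (\<kappa> * of_real (w1 x) * chi \<kappa> x) + \<kappa> * of_real (w2 x) * P x * phi \<kappa> x)) (at x within {0..L})"
      unfolding f_def
      by (intro has_vector_derivative_diff has_vector_derivative_mult phi_deriv chi_deriv P' V' x x')
    thus "(f has_vector_derivative 0) (at x within {0..L})"
      unfolding QV[OF x'] by (simp add: algebra_simps)
  qed
  moreover have "V 0 = - of_real (c * \<mu> / pi)"
    using \<kappa> r_pos[of 0] length_pos unfolding V_def Q0 w2_def by (simp add: \<kappa>_def field_simps)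
  ultimately have eq: "P L * chi \<kappa> L - V L * phi \<kappa> L = of_real (c * \<mu> / pi)"
    by (simp add: f_def init)
  have "V L = - of_real (a\<^sup>2) * P L / Z"
    using QL \<kappa> unfolding V_def w2_def a_def[symmetric] by (simp add: \<kappa>_def eq_neg_iff_add_eq_0[symmetric])
  hence "P L * (chi \<kappa> L + of_real (a\<^sup>2) * phi \<kappa> L / Z) = of_real (c * \<mu> / pi)"
    using eq by (simp add: algebra_simps)
  moreover have "chi \<kappa> L + of_real (a\<^sup>2) * phi \<kappa> L / Z = of_real (a\<^sup>2) * den k / Z"
    using Z a_pos by (simp add: den_def Z_def \<kappa>_def field_simps)
  ultimately have *: "P L * (of_real (a\<^sup>2) * den k / Z) = of_real (c * \<mu> / pi)" by simp
  have "of_real (a\<^sup>2) * den k / Z \<noteq> 0" using Z a_pos assms(3) by simp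
  hence "P L = of_real (c * \<mu> / pi) / (of_real (a\<^sup>2) * den k / Z)"
    using * by (metis nonzero_mult_div_cancel_right)
  thus ?thesis by (simp add: Z_def)
qed

lemma solution_exists:
  assumes "den k \<noteq> 0" and "k \<noteq> 0" and "piston (\<i> * k * of_real a) \<noteq> 0"
  shows "\<exists>P. solves_tract_bvp c \<mu> L r k P"
proof -
  define Z where "Z = piston (\<i> * k * of_real a)"
  have Z: "Z \<noteq> 0" using assms by (simp add: Z_def)
  have imp: "impedance (r L) k = Z" using impedance_eq_piston[of a k] a_pos by (simp add: Z_def a_def)
  define \<kappa> where "\<kappa> = \<i> * k"
  have \<kappa>: "\<kappa> \<noteq> 0" using assms by (simp add: \<kappa>_def)
  have k2: "k\<^sup>2 = - \<kappa>\<^sup>2" by (simp add: \<kappa>_def power_mult_distrib)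
  define q where "q = complex_of_real (c * \<mu> / pi)"
  \<comment> \<open>The multiple \<open>- q\<close> of \<open>(chi2, phi2)\<close> matches the
    source at 0, and \<alpha> is then solved from the lip condition, whose coefficient is
    \<open>a\<^sup>2 * den k / Z\<close>.\<close>
  define \<alpha> where "\<alpha> = q * (phi2 \<kappa> L + of_real (a\<^sup>2) * chi2 \<kappa> L / Z) / (chi \<kappa> L + of_real (a\<^sup>2) * phi \<kappa> L / Z)"
  have "chi \<kappa> L + of_real (a\<^sup>2) * phi \<kappa> L / Z = of_real (a\<^sup>2) * den k / Z"
    using Z a_pos by (simp add: den_def Z_def \<kappa>_def field_simps)
  hence nz: "chi \<kappa> L + of_real (a\<^sup>2) * phi \<kappa> L / Z \<noteq> 0" using Z a_pos assms by simp
  define P where "P x = \<alpha> * phi \<kappa> x - q * chi2 \<kappa> x" for x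
  define V where "V x = \<alpha> * chi \<kappa> x - q * phi2 \<kappa> x" for x
  define Q where "Q x = \<kappa> * of_real (w1 x) * V x" for x
  have P': "(P has_vector_derivative Q x) (at x within {0..L})" if "x \<in> {0..L}" for x
  proof -
    have "(P has_vector_derivative \<alpha> * (\<kappa> * of_real (w1 x) * chi \<kappa> x) - q * (\<kappa> * of_real (w1 x) * phi2 \<kappa> x)) (at x within {0..L})"
      unfolding P_def by (intro has_vector_derivative_diff has_vector_derivative_mult_right phi_deriv chi2_deriv that)
    thus ?thesis by (simp add: Q_def V_def algebra_simps)
  qed
  have V': "(V has_vector_derivative \<kappa> * of_real (w2 x) * P x) (at x within {0..L})" if "x \<in> {0..L}" for x
  proof -
    have "(V has_vector_derivative \<alpha> * (\<kappa> * of_real (w2 x) * phi \<kappa> x) - q * (\<kappa> * of_real (w2 x) * chi2 \<kappa> x)) (at x within {0..L})"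
      unfolding V_def by (intro has_vector_derivative_diff has_vector_derivative_mult_right phi2_deriv chi_deriv that)
    thus ?thesis by (simp add: P_def algebra_simps)
  qed
  have Vc: "continuous_on {0..L} V"
    using V' has_vector_derivative_continuous continuous_on_eq_continuous_within by blast
  have "solves_tract_bvp c \<mu> L r k P"
    unfolding solves_tract_bvp_def imp
  proof (intro conjI exI[of _ Q] ballI)
    show "continuous_on {0..L} Q" unfolding Q_def by (intro continuous_intros Vc A.cont_u)
    fix x assume x: "x \<in> {0<..<L}"
    have "at x = at x within {0..L}" using x by (simp add: at_within_Icc_at)
    hence "(V has_vector_derivative \<kappa> * of_real (w2 x) * P x) (at x)" using V'[of x] x by simp
    hence 1: "((\<lambda>y. \<kappa> * V y) has_vector_derivative \<kappa> * (\<kappa> * of_real (w2 x) * P x)) (at x)"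
      by (rule has_vector_derivative_mult_right)
    have "((\<lambda>y. of_real ((r y)\<^sup>2) * Q y) has_vector_derivative \<kappa> * (\<kappa> * of_real (w2 x) * P x)) (at x)"
    proof (rule has_vector_derivative_transform_within_open[OF 1])
      show "open {0<..<L}" "x \<in> {0<..<L}" using x by auto
      fix y assume "y \<in> {0<..<L}"
      hence "r y \<noteq> 0" using r_pos[of y] by auto
      thus "\<kappa> * V y = of_real ((r y)\<^sup>2) * Q y" by (simp add: Q_def w1_def)
    qed
    thus "((\<lambda>y. of_real ((r y)\<^sup>2) * Q y) has_vector_derivative - (k\<^sup>2 * of_real ((r x)\<^sup>2) * P x)) (at x)"
      unfolding k2 by (simp add: w2_def power2_eq_square mult_ac)
  next
    show "Q 0 = - (\<i> * k * of_real c * of_real \<mu> / of_real (pi * (r 0)\<^sup>2))"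
      by (simp add: Q_def V_def init w1_def q_def \<kappa>_def mult_ac)
    have "\<alpha> * (chi \<kappa> L + of_real (a\<^sup>2) * phi \<kappa> L / Z) = q * (phi2 \<kappa> L + of_real (a\<^sup>2) * chi2 \<kappa> L / Z)"
      unfolding \<alpha>_def using nz by simp
    hence "V L + of_real (a\<^sup>2) * P L / Z = 0"
      by (simp add: V_def P_def algebra_simps diff_divide_distrib add_divide_distrib)
    moreover have "Q L + \<i> * k / Z * P L = \<kappa> / of_real (a\<^sup>2) * (V L + of_real (a\<^sup>2) * P L / Z)"
      using a_pos by (simp add: Q_def \<kappa>_def w1_def a_def algebra_simps)
    ultimately show "Q L + \<i> * k / Z * P L = 0" by simp
  qed (use Z P' in auto)
  thus ?thesis by blast
qed

text \<open>\<open>pressure\<close> asks for a unique value at the given point, not for a unique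
  solution, so existence together with the forced value \<open>P L\<close> suffices.\<close>

lemma pressure_eq:
  assumes "den k \<noteq> 0" and "k \<noteq> 0" and "piston (\<i> * k * of_real a) \<noteq> 0"
  shows "pressure c \<mu> L r k L = of_real (c * \<mu> / pi) * piston (\<i> * k * of_real a) / (of_real (a\<^sup>2) * den k)"
  unfolding pressure_def
  using solution_exists[OF assms] solution_value[OF _ assms(2,1)] by (intro the_equality) blast+

definition lip_fun where
  "lip_fun q k = of_real q * piston (\<i> * k * of_real a) / (of_real (a\<^sup>2) * den k)"

lemma piston_nonzero_1: "piston 1 \<noteq> 0"
  using Re_piston_pos[of 1] by auto

lemma eventually_generic:
  "eventually (\<lambda>k. den k \<noteq> 0 \<and> piston (\<i> * k * of_real a) \<noteq> 0) (at z)"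
proof (intro eventually_conj)
  show "eventually (\<lambda>k. den k \<noteq> 0) (at z)"
    by (rule entire_eventually_nonzero[OF den_holomorphic, of 0]) (simp add: den_0)
  show "eventually (\<lambda>k. piston (\<i> * k * of_real a) \<noteq> 0) (at z)"
    by (rule entire_eventually_nonzero[of _ "- \<i> / of_real a"])
       (use a_pos piston_nonzero_1 in \<open>auto intro!: holomorphic_intros\<close>)
qed

text \<open>\<open>remove_sings\<close> only sees a punctured neighbourhood, and the exceptional
  points of \<open>pressure_eq\<close> are isolated, so unspecified values of
  \<open>pressure\<close> do no harm.\<close>

lemma lip_pressure_eq: "lip_pressure c \<mu> L r = remove_sings (lip_fun (c * \<mu> / pi))"
proof
  fix z
  have "eventually (\<lambda>k. pressure c \<mu> L r k L = lip_fun (c * \<mu> / pi) k) (at z)"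
    using eventually_generic[of z] eventually_neq_at_within[of 0 z]
    by eventually_elim (auto simp: lip_fun_def pressure_eq)
  thus "lip_pressure c \<mu> L r z = remove_sings (lip_fun (c * \<mu> / pi)) z"
    unfolding lip_pressure_def by (intro remove_sings_cong) auto
qed

section \<open>Exponential rates of \<open>den\<close> along the imaginary axis\<close>

lemma weight_deriv_bound:
  "\<exists>K d. K > 0 \<and> (\<forall>x\<in>{0..L}. (w1 has_real_derivative d x) (at x within {0..L}) \<and> \<bar>d x\<bar> \<le> K * w1 x)"
proof -
  obtain r1 where r1: "\<And>x. x \<in> {0..L} \<Longrightarrow> (r has_real_derivative r1 x) (at x within {0..L})"
    "continuous_on {0..L} r1" using r_deriv by blast
  \<comment> \<open>Up to sign the logarithmic derivative of \<open>w1\<close>; continuity of the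
    derivative of \<open>r\<close> enters here and bounds it.\<close>
  have "continuous_on {0..L} (\<lambda>x. 2 * r1 x / r x)"
    using r_pos by (force intro!: continuous_intros r1 r_cont)
  hence "compact ((\<lambda>x. 2 * r1 x / r x) ` {0..L})" by (intro compact_continuous_image) auto
  then obtain B where "\<forall>y\<in>(\<lambda>x. 2 * r1 x / r x) ` {0..L}. norm y \<le> B"
    using compact_imp_bounded bounded_iff by blast
  hence B: "\<bar>2 * r1 x / r x\<bar> \<le> B" if "x \<in> {0..L}" for x
    using that unfolding real_norm_def by blast
  show ?thesis
  proof (intro exI[of _ "\<bar>B\<bar> + 1"] exI[of _ "\<lambda>x. - (2 * r1 x / r x) * w1 x"] conjI ballI)
    fix x assume x: "x \<in> {0..L}"
    have "((\<lambda>x. inverse ((r x)\<^sup>2)) has_real_derivative - (inverse ((r x)\<^sup>2) * (2 * r x * r1 x) * inverse ((r x)\<^sup>2))) (at x within {0..L})"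
      using r1(1)[OF x] r_pos[OF x] by (intro DERIV_inverse') (auto intro!: derivative_eq_intros)
    moreover have "inverse ((r x)\<^sup>2) * (2 * r x * r1 x) * inverse ((r x)\<^sup>2) = 2 * r1 x / r x * w1 x"
      using r_pos[OF x] by (simp add: w1_def power2_eq_square divide_simps)
    moreover have "w1 = (\<lambda>x. inverse ((r x)\<^sup>2))" by (simp add: w1_def fun_eq_iff inverse_eq_divide)
    ultimately show "(w1 has_real_derivative - (2 * r1 x / r x) * w1 x) (at x within {0..L})" by simp
    have "\<bar>- (2 * r1 x / r x) * w1 x\<bar> = \<bar>2 * r1 x / r x\<bar> * w1 x"
      using A.u_pos[OF x] by (simp only: abs_mult[of "- (2 * r1 x / r x)"] abs_minus_cancel abs_of_pos)
    also have "\<dots> \<le> (\<bar>B\<bar> + 1) * w1 x"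
      using B[OF x] A.u_pos[OF x] by (intro mult_right_mono) auto
    finally show "\<bar>- (2 * r1 x / r x) * w1 x\<bar> \<le> (\<bar>B\<bar> + 1) * w1 x" .
  qed auto
qed

lemma mvt_on:
  fixes f :: "real \<Rightarrow> real"
  assumes "\<And>x. x \<in> {0..L} \<Longrightarrow> (f has_real_derivative f' x) (at x within {0..L})"
  shows "\<exists>x\<in>{0..L}. f L - f 0 = L * f' x"
proof -
  have "\<exists>x\<in>{0..L}. f L - f 0 = (\<lambda>h. f' x * h) (L - 0)"
    by (rule mvt_very_simple) (use assms length_pos in \<open>auto simp: has_field_derivative_def\<close>)
  thus ?thesis by (simp add: mult.commute)
qed

text \<open>Because \<open>w1 * w2 = 1\<close>, the combination \<open>W = p + y * w1\<close>
  satisfies \<open>W' = t * W + y * w1'\<close>, and the last term is at most \<open>K * W\<close>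
  in modulus. Gronwall's argument traps \<open>W L\<close>, so the leading rate depends on
  \<open>L\<close> only. The last two inequalities show that \<open>p\<close> and \<open>y\<close>
  differ by factors at most linear in \<open>t\<close>, up to a constant.\<close>

lemma growth:
  "\<exists>K>0. \<exists>C>0. \<forall>t>0. \<exists>p y. phi (of_real t) L = of_real p \<and> chi (of_real t) L = of_real y \<and>
     p \<ge> 1 \<and> y \<ge> 0 \<and> exp ((t - K) * L) \<le> p + y / a\<^sup>2 \<and> p + y / a\<^sup>2 \<le> exp ((t + K) * L) \<and>
     y \<le> C * t * p \<and> p \<le> 1 + C * t * y"
proof -
  obtain K d where K: "K > 0" and d: "\<And>x. x \<in> {0..L} \<Longrightarrow> (w1 has_real_derivative d x) (at x within {0..L})"
      and dK: "\<And>x. x \<in> {0..L} \<Longrightarrow> \<bar>d x\<bar> \<le> K * w1 x"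
    using weight_deriv_bound by blast
  define C where "C = A.M * L"
  have C: "C > 0" using A.M(1) length_pos by (simp add: C_def)
  have "\<exists>p y. phi (of_real t) L = of_real p \<and> chi (of_real t) L = of_real y \<and>
     p \<ge> 1 \<and> y \<ge> 0 \<and> exp ((t - K) * L) \<le> p + y / a\<^sup>2 \<and> p + y / a\<^sup>2 \<le> exp ((t + K) * L) \<and>
     y \<le> C * t * p \<and> p \<le> 1 + C * t * y" if t: "t > 0" for t
  proof -
    define p where "p x = Re (phi (of_real t) x)" for x
    define y where "y x = Re (chi (of_real t) x)" for x
    have real: "phi (of_real t) x = of_real (p x)" "chi (of_real t) x = of_real (y x)" "p x \<ge> 1" "y x \<ge> 0"
      if "x \<in> {0..L}" for x
      using A.sol_real[OF that, of t] t by (auto simp: p_def y_def phi_def chi_def)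
    have p': "(p has_real_derivative t * w1 x * y x) (at x within {0..L})" if x: "x \<in> {0..L}" for x
    proof -
      have "(p has_vector_derivative Re (of_real t * of_real (w1 x) * chi (of_real t) x)) (at x within {0..L})"
        unfolding p_def by (rule bounded_linear.has_vector_derivative[OF bounded_linear_Re phi_deriv[OF x]])
      thus ?thesis using real[OF x] by (simp add: has_real_derivative_iff_has_vector_derivative flip: of_real_mult)
    qed
    have y': "(y has_real_derivative t * w2 x * p x) (at x within {0..L})" if x: "x \<in> {0..L}" for x
    proof -
      have "(y has_vector_derivative Re (of_real t * of_real (w2 x) * phi (of_real t) x)) (at x within {0..L})"
        unfolding y_def by (rule bounded_linear.has_vector_derivative[OF bounded_linear_Re chi_deriv[OF x]])
      thus ?thesis using real[OF x] by (simp add: has_real_derivative_iff_has_vector_derivative flip: of_real_mult)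
    qed
    have init': "p 0 = 1" "y 0 = 0" by (simp_all add: p_def y_def init)
    have mono: "f x \<le> f L" if "\<And>x. x \<in> {0..L} \<Longrightarrow> (f has_real_derivative f' x) (at x within {0..L})"
      "\<And>x. x \<in> {0..L} \<Longrightarrow> f' x \<ge> 0" "x \<in> {0..L}" for f f' x
    proof -
      have "\<exists>z\<in>{x..L}. f L - f x = (\<lambda>h. f' z * h) (L - x)"
      proof (rule mvt_very_simple)
        fix z assume "x \<le> z" "z \<le> L"
        hence "(f has_real_derivative f' z) (at z within {x..L})"
          using that(3) by (intro has_field_derivative_subset[OF that(1)]) auto
        thus "(f has_derivative (\<lambda>h. f' z * h)) (at z within {x..L})"
          by (simp add: has_field_derivative_def)
      qed (use that in auto)
      then obtain z where "z \<in> {x..L}" "f L - f x = (L - x) * f' z" by (auto simp: mult.commute)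
      moreover have "(L - x) * f' z \<ge> 0" using that(2)[of z] that(3) \<open>z \<in> {x..L}\<close> by (intro mult_nonneg_nonneg) auto
      ultimately show ?thesis by simp
    qed
    have weights: "w1 x > 0" "w2 x > 0" "w1 x \<le> A.M" "w2 x \<le> A.M" if "x \<in> {0..L}" for x
      using that A.u_pos A.v_pos A.M by auto
    have p_mono: "p x \<le> p L" if "x \<in> {0..L}" for x
      by (rule mono[OF p' _ that]) (use weights real t in \<open>auto intro!: mult_nonneg_nonneg simp: less_imp_le\<close>)
    have y_mono: "y x \<le> y L" if "x \<in> {0..L}" for x
      by (rule mono[OF y' _ that]) (use weights real t in \<open>auto intro!: mult_nonneg_nonneg simp: less_imp_le intro: order.trans[OF zero_le_one]\<close>)
    obtain x1 where x1: "x1 \<in> {0..L}" "p L - p 0 = L * (t * w1 x1 * y x1)" using mvt_on[OF p'] by blast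
    have "w1 x1 * y x1 \<le> A.M * y L"
      using weights[OF x1(1)] y_mono[OF x1(1)] real[OF x1(1)] by (intro mult_mono) auto
    hence "(L * t) * (w1 x1 * y x1) \<le> (L * t) * (A.M * y L)" using t length_pos by (intro mult_left_mono) auto
    hence b1: "p L \<le> 1 + C * t * y L" using x1(2) init' by (simp add: C_def mult_ac)
    obtain x2 where x2: "x2 \<in> {0..L}" "y L - y 0 = L * (t * w2 x2 * p x2)" using mvt_on[OF y'] by blast
    have "w2 x2 * p x2 \<le> A.M * p L"
      using weights[OF x2(1)] p_mono[OF x2(1)] real[OF x2(1)] by (intro mult_mono) auto
    hence "(L * t) * (w2 x2 * p x2) \<le> (L * t) * (A.M * p L)" using t length_pos by (intro mult_left_mono) auto
    hence b2: "y L \<le> C * t * p L" using x2(2) init' by (simp add: C_def mult_ac)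
    define W where "W x = p x + y x * w1 x" for x
    have W': "(W has_real_derivative t * W x + y x * d x) (at x within {0..L})" if x: "x \<in> {0..L}" for x
    proof -
      have "(W has_real_derivative t * w1 x * y x + (t * w2 x * p x * w1 x + d x * y x)) (at x within {0..L})"
        unfolding W_def by (intro DERIV_add DERIV_mult p' y' d x)
      moreover have "t * w1 x * y x + (t * w2 x * p x * w1 x + d x * y x) = t * (w1 x * y x + p x * (w1 x * w2 x)) + y x * d x"
        by (simp add: algebra_simps)
      ultimately show ?thesis using w1w2[OF x] by (simp add: W_def algebra_simps)
    qed
    have yd: "\<bar>y x * d x\<bar> \<le> K * W x" if x: "x \<in> {0..L}" for x
    proof -
      have "\<bar>y x * d x\<bar> \<le> y x * (K * w1 x)"
        unfolding abs_mult using dK[OF x] real(4)[OF x] by (intro mult_mono) auto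
      also have "\<dots> = K * (y x * w1 x)" by simp
      also have "\<dots> \<le> K * W x" using K real(3)[OF x] by (intro mult_left_mono) (auto simp: W_def)
      finally show ?thesis .
    qed
    \<comment> \<open>Integrating factor, used with \<open>s = - (t - K)\<close> and
      \<open>s = - (t + K)\<close>: both differential inequalities become monotonicity
      statements.\<close>
    have e': "((\<lambda>x. W x * exp (s * x)) has_real_derivative (t * W x + y x * d x + s * W x) * exp (s * x)) (at x within {0..L})"
      if x: "x \<in> {0..L}" for x s
      by (auto intro!: derivative_eq_intros W'[OF x] simp: algebra_simps)
    have exp_cancel: "exp (- s * L) * exp (s * L) = 1" for s by (simp flip: exp_add)
    have W0: "W 0 = 1" by (simp add: W_def init')
    have "W 0 * exp (- (t - K) * 0) \<le> W L * exp (- (t - K) * L)"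
    proof (rule mono[OF e'])
      fix x assume x: "x \<in> {0..L}"
      have "0 \<le> t * W x + y x * d x + - (t - K) * W x" using yd[OF x] by (simp add: algebra_simps)
      thus "0 \<le> (t * W x + y x * d x + - (t - K) * W x) * exp (- (t - K) * x)" by simp
    qed (use length_pos in auto)
    hence "1 * exp ((t - K) * L) \<le> W L * exp (- (t - K) * L) * exp ((t - K) * L)"
      using W0 by (intro mult_right_mono) auto
    also have "\<dots> = W L" using exp_cancel[of "t - K"] by (simp only: mult.assoc mult_1_right)
    finally have l1: "exp ((t - K) * L) \<le> W L" by linarith
    have "- (W 0 * exp (- (t + K) * 0)) \<le> - (W L * exp (- (t + K) * L))"
    proof (rule mono[OF DERIV_minus[OF e']])
      fix x assume x: "x \<in> {0..L}"
      have "t * W x + y x * d x + - (t + K) * W x \<le> 0" using yd[OF x] by (simp add: algebra_simps)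
      thus "0 \<le> - ((t * W x + y x * d x + - (t + K) * W x) * exp (- (t + K) * x))"
        by (simp add: mult_nonpos_nonneg)
    qed (use length_pos in auto)
    hence "W L * exp (- (t + K) * L) * exp ((t + K) * L) \<le> 1 * exp ((t + K) * L)"
      using W0 by (intro mult_right_mono) auto
    moreover have "W L * exp (- (t + K) * L) * exp ((t + K) * L) = W L"
      using exp_cancel[of "t + K"] by (simp only: mult.assoc mult_1_right)
    ultimately have l2: "W L \<le> exp ((t + K) * L)" by linarith
    have "W L = p L + y L / a\<^sup>2" by (simp add: W_def w1_def a_def)
    thus ?thesis using real[OF L_mem] b1 b2 l1 l2 by (intro exI[of _ "p L"] exI[of _ "y L"]) auto
  qed
  thus ?thesis using K C by blast
qed

text \<open>Here \<open>\<i> * k = t\<close> and the piston factor lies in \<open>[0, 1]\<close>, so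
  \<open>den\<close> lies between \<open>p\<close> and \<open>p + y / a\<^sup>2\<close>, which agree
  up to a factor linear in \<open>t\<close>.\<close>

lemma den_growth_lower:
  "((\<lambda>t. ln (norm (den (- \<i> * of_real t))) / t) \<longlongrightarrow> L) at_top"
proof -
  obtain K C where K: "K > 0" and C: "C > 0" and gr: "\<And>t. t > 0 \<Longrightarrow>
      \<exists>p y. phi (of_real t) L = of_real p \<and> chi (of_real t) L = of_real y \<and>
     p \<ge> 1 \<and> y \<ge> 0 \<and> exp ((t - K) * L) \<le> p + y / a\<^sup>2 \<and> p + y / a\<^sup>2 \<le> exp ((t + K) * L) \<and>
     y \<le> C * t * p \<and> p \<le> 1 + C * t * y"
    using growth by metis
  define D where "D = C / a\<^sup>2"
  have D: "D > 0" using C a_pos by (simp add: D_def)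
  have bounds: "((t - K) * L - ln (1 + D * t)) / t \<le> ln (norm (den (- \<i> * of_real t))) / t \<and>
      ln (norm (den (- \<i> * of_real t))) / t \<le> (t + K) * L / t" if t: "t > 0" for t
  proof -
    obtain p y where py: "phi (of_real t) L = of_real p" "chi (of_real t) L = of_real y"
     "p \<ge> 1" "y \<ge> 0" "exp ((t - K) * L) \<le> p + y / a\<^sup>2" "p + y / a\<^sup>2 \<le> exp ((t + K) * L)" "y \<le> C * t * p"
      using gr[OF t] by blast
    obtain z where z: "piston (of_real (t * a)) = of_real z" "0 \<le> z" "z \<le> 1"
      using piston_pos_real[of "t * a"] t a_pos by auto
    have "den (- \<i> * of_real t) = of_real (p + z * y / a\<^sup>2)"
      using py(1,2) z(1) by (simp add: den_def)
    moreover have "p + z * y / a\<^sup>2 \<ge> p" using z py by simp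
    ultimately have n: "norm (den (- \<i> * of_real t)) = p + z * y / a\<^sup>2" using py by (simp del: of_real_add)
    have "p + z * y / a\<^sup>2 \<le> p + y / a\<^sup>2" using z py by (intro add_left_mono divide_right_mono mult_left_le_one_le) auto
    also note py(6)
    finally have upper: "p + z * y / a\<^sup>2 \<le> exp ((t + K) * L)" .
    have "y / a\<^sup>2 \<le> C * t * p / a\<^sup>2" by (intro divide_right_mono py) auto
    hence "p + y / a\<^sup>2 \<le> p * (1 + D * t)" by (simp add: D_def algebra_simps)
    hence "exp ((t - K) * L) \<le> p * (1 + D * t)" using py by linarith
    also have "\<dots> \<le> (p + z * y / a\<^sup>2) * (1 + D * t)"
      using \<open>p + z * y / a\<^sup>2 \<ge> p\<close> t D by (intro mult_right_mono) auto
    finally have lower: "exp ((t - K) * L) \<le> (p + z * y / a\<^sup>2) * (1 + D * t)" .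
    have pos: "p + z * y / a\<^sup>2 > 0" "1 + D * t > 0" using \<open>p + z * y / a\<^sup>2 \<ge> p\<close> py t D by (auto intro: add_pos_pos)
    have "ln (p + z * y / a\<^sup>2) \<le> (t + K) * L" using upper pos by (metis ln_exp ln_mono)
    moreover have "(t - K) * L \<le> ln (p + z * y / a\<^sup>2) + ln (1 + D * t)"
      using lower pos by (metis ln_exp ln_mono ln_mult_pos exp_gt_zero)
    ultimately show ?thesis unfolding n using t by (intro conjI divide_right_mono) auto
  qed
  show ?thesis
  proof (rule tendsto_sandwich)
    show "((\<lambda>t. ((t - K) * L - ln (1 + D * t)) / t) \<longlongrightarrow> L) at_top" using D by real_asymp
    show "((\<lambda>t. (t + K) * L / t) \<longlongrightarrow> L) at_top" by real_asymp
    show "\<forall>\<^sub>F t in at_top. ((t - K) * L - ln (1 + D * t)) / t \<le> ln (norm (den (- \<i> * of_real t))) / t"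
      using eventually_gt_at_top[of 0] by eventually_elim (use bounds in auto)
    show "\<forall>\<^sub>F t in at_top. ln (norm (den (- \<i> * of_real t))) / t \<le> (t + K) * L / t"
      using eventually_gt_at_top[of 0] by eventually_elim (use bounds in auto)
  qed
qed

text \<open>Here \<open>\<i> * k = - t\<close>: both \<open>chi\<close>, being odd, and the piston
  factor change sign, so the two terms of \<open>den\<close> add up. The piston factor contributes
  the rate \<open>2 * a\<close>, provided \<open>y\<close> is bounded below.\<close>

lemma den_growth_upper:
  "((\<lambda>t. ln (norm (den (\<i> * of_real t))) / t) \<longlongrightarrow> 2 * a + L) at_top"
proof -
  obtain K C where K: "K > 0" and C: "C > 0" and gr: "\<And>t. t > 0 \<Longrightarrow>
      \<exists>p y. phi (of_real t) L = of_real p \<and> chi (of_real t) L = of_real y \<and>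
     p \<ge> 1 \<and> y \<ge> 0 \<and> exp ((t - K) * L) \<le> p + y / a\<^sup>2 \<and> p + y / a\<^sup>2 \<le> exp ((t + K) * L) \<and>
     y \<le> C * t * p \<and> p \<le> 1 + C * t * y"
    using growth by metis
  define b where "b = 1 / a\<^sup>2"
  have b: "b > 0" using a_pos by (simp add: b_def)
  define lo where "lo t = exp (2 * (t * a)) / (2 * pi * (t * a)\<^sup>2) * (exp ((t - K) * L) / (2 * (C * t + b))) * b" for t
  have bounds: "ln (lo t) / t \<le> ln (norm (den (\<i> * of_real t))) / t \<and>
      ln (norm (den (\<i> * of_real t))) / t \<le> (2 * a * t + (t + K) * L) / t"
    if t: "t > 0"
      and dom: "exp (2 * (t * a)) / 2 \<le> exp (2 * (t * a)) - 1 - 2 * (t * a) - 2 * (t * a)\<^sup>2"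
        "exp ((t - K) * L) / 2 \<le> exp ((t - K) * L) - 1" for t
  proof -
    obtain p y where py: "phi (of_real t) L = of_real p" "chi (of_real t) L = of_real y"
     "p \<ge> 1" "y \<ge> 0" "exp ((t - K) * L) \<le> p + y / a\<^sup>2" "p + y / a\<^sup>2 \<le> exp ((t + K) * L)" "p \<le> 1 + C * t * y"
      using gr[OF t] by blast
    have ta: "t * a > 0" using t a_pos by simp
    obtain z where z: "piston (- of_real (t * a)) = - of_real z"
      "1 / pi * (exp (2 * (t * a)) - 1 - 2 * (t * a) - 2 * (t * a)\<^sup>2) / (t * a)\<^sup>2 \<le> z" "z \<le> exp (2 * (t * a))"
      using piston_neg_real[OF ta] by blast
    have "\<i> * (\<i> * of_real t) = - complex_of_real t" by (simp add: mult.assoc[symmetric])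
    hence "den (\<i> * of_real t) = phi (- of_real t) L + piston (- of_real (t * a)) * chi (- of_real t) L / of_real (a\<^sup>2)"
      by (simp add: den_def)
    also have "\<dots> = of_real (p + z * y / a\<^sup>2)"
      using py(1,2) z(1) by (simp add: phi_def chi_def A.sol_even_minus A.sol_odd_minus)
    finally have den: "den (\<i> * of_real t) = of_real (p + z * y / a\<^sup>2)" .
    have Ct: "C * t + b > 0" using C t b by (auto intro!: add_pos_pos)
    \<comment> \<open>Inserting \<open>p \<le> 1 + C * t * y\<close> turns the lower bound for
      \<open>p + y / a\<^sup>2\<close> into one for \<open>y\<close> alone; halving the exponential
      absorbs the 1.\<close>
    have y: "exp ((t - K) * L) / (2 * (C * t + b)) \<le> y"
    proof -
      have "exp ((t - K) * L) - 1 \<le> y * (C * t + b)" using py by (simp add: algebra_simps b_def)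
      hence "exp ((t - K) * L) \<le> y * (2 * (C * t + b))" using dom(2) by (simp add: algebra_simps)
      thus ?thesis using Ct by (simp only: pos_divide_le_eq mult_pos_pos zero_less_numeral)
    qed
    have z': "exp (2 * (t * a)) / (2 * pi * (t * a)\<^sup>2) \<le> z"
    proof -
      have "1 / pi * (exp (2 * (t * a)) / 2) / (t * a)\<^sup>2
          \<le> 1 / pi * (exp (2 * (t * a)) - 1 - 2 * (t * a) - 2 * (t * a)\<^sup>2) / (t * a)\<^sup>2"
        by (intro divide_right_mono mult_left_mono dom(1)) auto
      also note z(2)
      finally show ?thesis by (simp add: mult_ac)
    qed
    have lo: "lo t > 0" unfolding lo_def by (intro mult_pos_pos divide_pos_pos) (use ta Ct b in auto)
    have "0 < z" by (intro less_le_trans[OF _ z'] divide_pos_pos mult_pos_pos zero_less_power) (use t a_pos in auto)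
    have "lo t \<le> z * y * b"
      unfolding lo_def using Ct b ta \<open>0 < z\<close> by (intro mult_right_mono mult_mono z' y) auto
    hence "lo t \<le> z * y / a\<^sup>2" by (simp add: b_def)
    hence lower: "lo t \<le> p + z * y / a\<^sup>2" using py by simp
    have n: "norm (den (\<i> * of_real t)) = p + z * y / a\<^sup>2" unfolding den norm_of_real using lower lo by simp
    have "p + z * y / a\<^sup>2 \<le> exp (2 * (t * a)) * p + exp (2 * (t * a)) * y / a\<^sup>2"
      using z py ta by (intro add_mono divide_right_mono mult_right_mono) auto
    also have "\<dots> = exp (2 * (t * a)) * (p + y / a\<^sup>2)" by (simp add: algebra_simps)
    also have "\<dots> \<le> exp (2 * (t * a)) * exp ((t + K) * L)" by (intro mult_left_mono py) auto
    also have "\<dots> = exp (2 * a * t + (t + K) * L)" by (simp add: exp_add mult_ac)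
    finally have upper: "p + z * y / a\<^sup>2 \<le> exp (2 * a * t + (t + K) * L)" .
    have "ln (p + z * y / a\<^sup>2) \<le> 2 * a * t + (t + K) * L" using upper lower lo by (metis ln_exp ln_mono less_le_trans)
    moreover have "ln (lo t) \<le> ln (p + z * y / a\<^sup>2)" using lower lo by (intro ln_mono) auto
    ultimately show ?thesis unfolding n using t by (intro conjI divide_right_mono) auto
  qed
  show ?thesis
  proof (rule tendsto_sandwich)
    show "((\<lambda>t. ln (lo t) / t) \<longlongrightarrow> 2 * a + L) at_top" unfolding lo_def by (rule growth_rate_asymp[OF a_pos b length_pos C])
    show "((\<lambda>t. (2 * a * t + (t + K) * L) / t) \<longlongrightarrow> 2 * a + L) at_top"
      by (rule affine_rate)
    show "\<forall>\<^sub>F t in at_top. ln (lo t) / t \<le> ln (norm (den (\<i> * of_real t))) / t"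
      using eventually_gt_at_top[of 0] eventually_exp_dominates(1)[OF a_pos length_pos] eventually_exp_dominates(2)[OF a_pos length_pos, of K]
      by eventually_elim (use bounds in auto)
    show "\<forall>\<^sub>F t in at_top. ln (norm (den (\<i> * of_real t))) / t \<le> (2 * a * t + (t + K) * L) / t"
      using eventually_gt_at_top[of 0] eventually_exp_dominates(1)[OF a_pos length_pos] eventually_exp_dominates(2)[OF a_pos length_pos, of K]
      by eventually_elim (use bounds in auto)
  qed
qed

text \<open>For \<open>t > 0\<close> the signs of \<open>chi\<close> and of the piston factor
  cancel, so \<open>den\<close> is real and at least \<open>p\<close>; the rest of the axis lies in
  the closed lower half plane.\<close>

lemma den_nonzero_imag: "den (\<i> * of_real t) \<noteq> 0"
proof (cases "t > 0")
  case True
  obtain p y where py: "phi (of_real t) L = of_real p" "chi (of_real t) L = of_real y" "p \<ge> 1" "y \<ge> 0"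
    using growth True by blast
  have ta: "\<i> * (\<i> * of_real t) = - complex_of_real t" by (simp add: mult.assoc[symmetric])
  obtain z where z: "piston (- of_real (t * a)) = of_real z" "z \<le> 0"
  proof -
    define z where "z = 4 / pi * integral {0..pi/2} (\<lambda>x. (1 - exp (- 2 * - (t * a) * cos x)) * (sin x)\<^sup>2)"
    have "z \<le> 4 / pi * integral {0..pi/2} (\<lambda>x. 0)"
      unfolding z_def
    proof (intro mult_left_mono integral_le)
      show "(\<lambda>x. (1 - exp (- 2 * - (t * a) * cos x)) * (sin x)\<^sup>2) integrable_on {0..pi/2}"
        by (intro integrable_continuous_interval continuous_intros)
      fix x :: real assume "x \<in> {0..pi/2}"
      thus "(1 - exp (- 2 * - (t * a) * cos x)) * (sin x)\<^sup>2 \<le> 0"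
        using True a_pos cos_ge_zero[of x] by (intro mult_nonpos_nonneg) auto
    qed auto
    hence "z \<le> 0" by simp
    moreover have "piston (- of_real (t * a)) = of_real z"
      using piston_of_real[of "- (t * a)"] unfolding z_def of_real_minus .
    ultimately show ?thesis by (rule that[rotated])
  qed
  have "den (\<i> * of_real t) = phi (- of_real t) L + piston (- of_real (t * a)) * chi (- of_real t) L / of_real (a\<^sup>2)"
    by (simp add: den_def ta)
  also have "\<dots> = of_real (p + (- z) * y / a\<^sup>2)"
    using py(1,2) z(1) by (simp add: phi_def chi_def A.sol_even_minus A.sol_odd_minus)
  also have "\<dots> \<noteq> 0"
  proof -
    have "z * y / a\<^sup>2 \<le> 0" by (intro divide_nonpos_nonneg mult_nonpos_nonneg) (use py z in auto)
    hence "p + (- z) * y / a\<^sup>2 \<noteq> 0" using py by simp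
    thus ?thesis by (metis of_real_eq_0_iff)
  qed
  finally show ?thesis .
qed (use den_nonzero_lower in auto)

section \<open>Pole sequences of the pressure and the zeros of \<open>E_fun\<close>\<close>

lemma den_frequently: "frequently (\<lambda>k. den k \<noteq> 0) (at z)"
  by (rule entire_frequently_nonzero[OF den_holomorphic, of 0]) (simp add: den_0)

lemma den_zorder_eq_0_iff: "zorder den k = 0 \<longleftrightarrow> den k \<noteq> 0"
  by (rule entire_zorder_eq_0_iff[OF den_holomorphic, of 0]) (simp add: den_0)

lemma den_zorder_nonneg: "zorder den k \<ge> 0"
  by (rule entire_zorder_nonneg[OF den_holomorphic, of 0]) (simp add: den_0)

text \<open>The left side is the multiplicity used in \<open>lists_poles\<close>. The numerator is
  not 0 where \<open>den\<close> vanishes, so orders carry over without cancellation.\<close>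

lemma lip_pole_multiplicity:
  assumes "c > 0" "\<mu> > 0"
  shows "(if is_pole (lip_pressure c \<mu> L r) k then nat (- zorder (lip_pressure c \<mu> L r) k) else 0) = nat (zorder den k)"
proof -
  define q where "q = c * \<mu> / pi"
  have q: "q > 0" using assms by (simp add: q_def)
  define num where "num k = of_real (q / a\<^sup>2) * piston (\<i> * k * of_real a)" for k
  have f: "lip_fun q = (\<lambda>k. num k / den k)" by (simp add: lip_fun_def num_def fun_eq_iff)
  have num_hol: "num holomorphic_on UNIV"
    unfolding num_def[abs_def] by (intro holomorphic_intros)
  have num_ana: "num analytic_on {k}" by (rule entire_analytic[OF num_hol])
  have den_ana: "den analytic_on {k}" by (rule entire_analytic[OF den_holomorphic])
  have mero: "(\<lambda>k. num k / den k) meromorphic_on {k}"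
    by (intro meromorphic_intros analytic_on_imp_meromorphic_on num_ana den_ana)
  have iso: "isolated_singularity_at (lip_fun q) k"
    unfolding f using mero meromorphic_at_iff by blast
  have lp: "lip_pressure c \<mu> L r = remove_sings (lip_fun q)" by (simp add: lip_pressure_eq q_def)
  show ?thesis
  proof (cases "den k = 0")
    case False
    have "lip_fun q analytic_on {k}" unfolding f using False by (intro analytic_intros num_ana den_ana) auto
    hence "\<not> is_pole (lip_fun q) k" by (rule analytic_at_imp_no_pole)
    thus ?thesis using iso False den_zorder_eq_0_iff[of k] by (simp add: lp)
  next
    case True
    have num_nz: "num k \<noteq> 0" using den_piston_no_common_zero[OF True] q a_pos by (simp add: num_def)
    have num_freq: "frequently (\<lambda>k. num k \<noteq> 0) (at k)"
      by (rule entire_frequently_nonzero[OF num_hol num_nz])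
    have "zorder (lip_fun q) k = zorder num k - zorder den k"
      unfolding f using den_frequently num_freq
      by (intro zorder_divide analytic_on_imp_meromorphic_on num_ana den_ana)
    also have "zorder num k = 0" by (rule zorder_eq_0I[OF num_ana num_nz])
    finally have zo: "zorder (lip_fun q) k = - zorder den k" by simp
    have "zorder den k > 0" using True den_zorder_eq_0_iff[of k] den_zorder_nonneg[of k] by linarith
    moreover have "eventually (\<lambda>k. lip_fun q k \<noteq> 0) (at k)"
      using eventually_generic[of k] by eventually_elim (use q a_pos in \<open>auto simp: lip_fun_def\<close>)
    ultimately have "is_pole (lip_fun q) k" using mero zo unfolding f by (intro zorder_neg_imp_is_pole) auto
    thus ?thesis using iso zo by (simp add: lp)
  qed
qed

lemma den_zero_location:
  assumes "den k = 0" shows "Re k \<noteq> 0 \<and> Im k > 0"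
proof -
  have "Re k \<noteq> 0"
  proof
    assume "Re k = 0"
    hence "k = \<i> * of_real (Im k)" by (simp add: complex_eq_iff)
    thus False using den_nonzero_imag[of "Im k"] assms by simp
  qed
  moreover have "Im k > 0" using den_nonzero_lower[of k] assms by force
  ultimately show ?thesis ..
qed

text \<open>With finitely many zeros \<open>den\<close> would be a polynomial times
  \<open>exp (\<alpha> + \<beta> * k)\<close>. Between \<open>\<i> * t\<close> and
  \<open>- \<i> * t\<close> the exponent \<beta> cancels, leaving logarithmic growth, against the
  positive rate \<open>2 * a + 2 * L\<close>. An infinite zero set is what the enumeration in
  \<open>poles_plus_spec\<close> starts from.\<close>

lemma den_zeros_infinite: "infinite {k\<in>first_quadrant. den k = 0}"
proof
  assume fin: "finite {k\<in>first_quadrant. den k = 0}"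
  define Z where "Z = {k. den k = 0}"
  have "Z \<subseteq> {k\<in>first_quadrant. den k = 0} \<union> (\<lambda>k. - cnj k) ` {k\<in>first_quadrant. den k = 0}"
  proof
    fix k assume "k \<in> Z"
    hence k: "den k = 0" by (simp add: Z_def)
    have im: "Im k > 0" and re: "Re k \<noteq> 0" using den_zero_location[OF k] by auto
    show "k \<in> {k\<in>first_quadrant. den k = 0} \<union> (\<lambda>k. - cnj k) ` {k\<in>first_quadrant. den k = 0}"
    proof (cases "Re k > 0")
      case False
      have "den (- cnj k) = 0" using den_cnj[of k] k by simp
      hence "- cnj k \<in> {k\<in>first_quadrant. den k = 0}" using False re im by simp
      moreover have "k = - cnj (- cnj k)" by simp
      ultimately show ?thesis by blast
    qed (use k im in auto)
  qed
  hence finZ: "finite Z" using fin finite_subset by blast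
  define I where "I = (SIGMA z:Z. {..<nat (zorder den z)})"
  have finI: "finite I" unfolding I_def using finZ by auto
  have count: "card {i\<in>I. fst i = z} = nat (zorder den z)" for z
  proof -
    have "{i\<in>I. fst i = z} = (if den z = 0 then {z} \<times> {..<nat (zorder den z)} else {})"
      by (auto simp: I_def Z_def)
    thus ?thesis using den_zorder_eq_0_iff[of z] by auto
  qed
  have den00: "den 0 \<noteq> 0" by (simp add: den_0)
  obtain g where g: "g holomorphic_on UNIV" "g 0 = den 0" "\<forall>i\<in>I. fst i \<noteq> 0"
      "\<And>z. den z = (\<Prod>i\<in>I. 1 - z / fst i) * g z"
      "\<And>z. zorder den z = zorder g z + int (card {i\<in>I. fst i = z})"
    using entire_factor_out_zeros[OF finI den_holomorphic den00, of fst] den_zorder_nonneg by (auto simp: count)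
  have g_nz: "g z \<noteq> 0" for z
  proof -
    have "zorder g z = 0" using g(5)[of z] den_zorder_nonneg[of z] by (simp add: count)
    thus ?thesis using entire_zorder_eq_0_iff[OF g(1), of 0 z] g(2) den_0 by simp
  qed
  \<comment> \<open>The polynomial part. Bounded exponentially in \<open>p_exp\<close>, it acts as
    the divisor in \<open>entire_quotient_exp_linear\<close>, with \<open>g\<close> as the zero-free
    quotient.\<close>
  define p where "p z = (\<Prod>i\<in>I. 1 - z / fst i)" for z
  define B where "B = (\<Prod>i\<in>I. 1 + 1 / norm (fst i))"
  define n where "n = card I"
  have B: "B \<ge> 1" unfolding B_def by (intro prod_ge_1) auto
  have p_le: "norm (p z) \<le> B * (1 + norm z) ^ n" for z
  proof -
    have "norm (p z) = (\<Prod>i\<in>I. norm (1 - z / fst i))" by (simp add: p_def prod_norm)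
    also have "\<dots> \<le> (\<Prod>i\<in>I. (1 + 1 / norm (fst i)) * (1 + norm z))"
    proof (intro prod_mono conjI)
      fix i assume "i \<in> I"
      have "norm (1 - z / fst i) \<le> 1 + norm z / norm (fst i)"
        using norm_triangle_ineq4[of 1 "z / fst i"] by (simp add: norm_divide)
      also have "\<dots> \<le> (1 + 1 / norm (fst i)) * (1 + norm z)" by (simp add: algebra_simps add_divide_distrib)
      finally show "norm (1 - z / fst i) \<le> (1 + 1 / norm (fst i)) * (1 + norm z)" .
    qed auto
    also have "\<dots> = B * (1 + norm z) ^ n" by (simp add: B_def n_def prod.distrib)
    finally show ?thesis .
  qed
  have p_exp: "norm (p z) \<le> exp ((ln B + n) * (1 + norm z))" for z
  proof -
    have "(1 + norm z) ^ n \<le> exp (norm z) ^ n" by (intro power_mono) auto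
    hence "norm (p z) \<le> B * exp (norm z) ^ n" using p_le[of z] B
      by (meson order.trans mult_left_mono zero_le_one)
    also have "\<dots> = exp (ln B + n * norm z)" using B by (simp add: exp_add exp_of_nat_mult)
    also have "\<dots> \<le> exp ((ln B + n) * (1 + norm z))" using B by (simp add: algebra_simps)
    finally show ?thesis .
  qed
  obtain C where C: "\<And>k. norm (den k) \<le> exp (C * (1 + norm k))" using den_exponential_type by blast
  have "p holomorphic_on UNIV" unfolding p_def using g(3) by (auto intro!: holomorphic_intros)
  moreover have "p 0 \<noteq> 0" by (simp add: p_def)
  moreover have "norm (g z * p z) \<le> exp (C * (1 + norm z))" for z
    using C[of z] g(4)[of z] by (simp add: p_def mult.commute)
  ultimately obtain \<alpha> \<beta> where g_exp: "\<And>z. g z = exp (\<alpha> + \<beta> * z)"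
    using entire_quotient_exp_linear[of p _ g C] p_exp g(1) g_nz by blast
  define h where "h t = (ln (norm (den (\<i> * of_real t))) / t + ln (norm (den (- \<i> * of_real t))) / t)" for t
  have lim1: "(h \<longlongrightarrow> 2 * a + L + L) at_top"
    unfolding h_def by (intro tendsto_add den_growth_upper den_growth_lower)
  have h_le: "h t \<le> (2 * ln B + 2 * real n * ln (1 + t) + 2 * Re \<alpha>) / t" if t: "t > 0" for t
  proof -
    have ln_le: "ln (norm (den z)) \<le> ln B + real n * ln (1 + t) + Re (\<alpha> + \<beta> * z)" if "norm z = t" "den z \<noteq> 0" for z
    proof -
      have pz: "p z \<noteq> 0" using g(4)[of z] that by (auto simp: p_def)
      have "ln (norm (den z)) = ln (norm (p z)) + Re (\<alpha> + \<beta> * z)"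
        using pz unfolding g(4)[of z] p_def[symmetric] g_exp by (simp add: norm_mult ln_mult_pos)
      also have "ln (norm (p z)) \<le> ln (B * (1 + t) ^ n)" using p_le[of z] pz that(1) by (intro ln_mono) auto
      also have "\<dots> = ln B + real n * ln (1 + t)" using B t by (simp add: ln_mult_pos ln_realpow)
      finally show ?thesis by simp
    qed
    have 1: "ln (norm (den (\<i> * of_real t))) \<le> ln B + real n * ln (1 + t) + Re (\<alpha> + \<beta> * (\<i> * of_real t))"
      by (rule ln_le) (use t den_nonzero_imag in \<open>auto simp: norm_mult\<close>)
    have 2: "ln (norm (den (- \<i> * of_real t))) \<le> ln B + real n * ln (1 + t) + Re (\<alpha> + \<beta> * (- \<i> * of_real t))"
      by (rule ln_le) (use t den_nonzero_imag[of "-t"] in \<open>auto simp: norm_mult\<close>)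
    have "ln (norm (den (\<i> * of_real t))) + ln (norm (den (- \<i> * of_real t))) \<le> 2 * ln B + 2 * real n * ln (1 + t) + 2 * Re \<alpha>"
      using add_mono[OF 1 2] by simp
    thus ?thesis unfolding h_def add_divide_distrib[symmetric] using t by (intro divide_right_mono) auto
  qed
  have lim2: "((\<lambda>t. (u + 2 * real n * ln (1 + t) + v) / t) \<longlongrightarrow> 0) at_top" for u v :: real
    by real_asymp
  have "2 * a + L + L \<le> 0"
    by (rule tendsto_le[OF _ lim2 lim1]) (auto intro!: eventually_mono[OF eventually_gt_at_top[of 0]] h_le)
  thus False using a_pos length_pos by simp
qed

text \<open>Zeros of \<open>den\<close> are finitely many in each disc, so they can be enumerated by
  modulus. This enumeration shows that \<open>SOME\<close> in \<open>pole_sequence\<close> picks a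
  genuine list.\<close>

lemma poles_plus_spec:
  assumes "c > 0" "\<mu> > 0"
  obtains s where "poles_plus c \<mu> L r = (\<infinity>, s)" "\<And>j. s j \<in> first_quadrant"
    "\<And>k. k \<in> first_quadrant \<Longrightarrow> finite (s -` {k}) \<and> card (s -` {k}) = nat (zorder den k)"
    "\<And>i j. i \<le> j \<Longrightarrow> norm (s i) \<le> norm (s j)"
proof -
  define P where "P = lip_pressure c \<mu> L r"
  define A where "A = {k\<in>first_quadrant. den k = 0}"
  have infA: "infinite A" unfolding A_def by (rule den_zeros_infinite)
  have A_eq: "A = {k. den k = 0} \<inter> {k. Re k \<ge> 0}"
    unfolding A_def using den_zero_location by force
  have "continuous_on UNIV den" by (rule holomorphic_on_imp_continuous_on[OF den_holomorphic])
  hence "closed (den -` {0})" by (intro closed_vimage) auto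
  moreover have "closed {k. Re k \<ge> 0}" by (rule closed_halfspace_Re_ge)
  ultimately have clA: "closed A" unfolding A_eq by (auto simp: vimage_def intro: closed_Int)
  have finA: "finite (A \<inter> cball 0 R)" for R
    by (rule finite_subset[OF _ entire_zeros_finite_cball[OF den_holomorphic, of 0 R]])
       (auto simp: A_def den_0)
  have pos: "nat (zorder den k) > 0" if "k \<in> A" for k
    using that den_zorder_eq_0_iff[of k] den_zorder_nonneg[of k] by (auto simp: A_def)
  have "\<exists>b :: nat \<Rightarrow> complex. mono (norm \<circ> b) \<and> range b = A \<and>
      (\<forall>z\<in>A. finite (b -` {z}) \<and> card (b -` {z}) = nat (zorder den z))"
  proof (rule sequence_of_sparse_set_exists'[where c = "\<lambda>k. nat (zorder den k)", OF infA clA finA pos])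
    fix b :: "nat \<Rightarrow> complex"
    assume "mono (norm \<circ> b)" "range b = A"
      "\<And>z. z \<in> A \<Longrightarrow> finite (b -` {z}) \<and> card (b -` {z}) = nat (zorder den z)"
    thus ?thesis by (intro exI[of _ b]) simp
  qed
  then obtain b :: "nat \<Rightarrow> complex" where b: "mono (norm \<circ> b)" "range b = A"
      "\<And>z. z \<in> A \<Longrightarrow> finite (b -` {z}) \<and> card (b -` {z}) = nat (zorder den z)"
    by blast
  have "b -` {z} = {}" if "z \<notin> A" for z using b(2) that by auto
  moreover have "nat (zorder den z) = 0" if "z \<in> first_quadrant" "z \<notin> A" for z
    using that den_zorder_eq_0_iff[of z] by (auto simp: A_def)
  ultimately have b': "finite (b -` {z}) \<and> card (b -` {z}) = nat (zorder den z)" if "z \<in> first_quadrant" for z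
    using b(3)[of z] that by (cases "z \<in> A") auto
  have "lists_poles P first_quadrant \<infinity> b"
    unfolding lists_poles_def P_def lip_pole_multiplicity[OF assms]
    using b' b(1,2) by (auto simp: A_def mono_def vimage_def)
  hence ex: "\<exists>x. case x of (N, s) \<Rightarrow> lists_poles P first_quadrant N s" by blast
  obtain N s where Ns: "poles_plus c \<mu> L r = (N, s)" by fastforce
  have lp: "lists_poles P first_quadrant N s"
    using someI_ex[OF ex] Ns unfolding poles_plus_def pole_sequence_def P_def by simp
  \<comment> \<open>A list of finite length has finite range and cannot cover the infinite zero
    set.\<close>
  have N: "N = \<infinity>"
  proof (cases N)
    case (enat n)
    have "A \<subseteq> s ` {..<n}"
    proof
      fix k assume k: "k \<in> A"
      hence "card {j. enat j < N \<and> s j = k} = nat (zorder den k)"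
        using lp unfolding lists_poles_def P_def lip_pole_multiplicity[OF assms] by (auto simp: A_def)
      hence "{j. enat j < N \<and> s j = k} \<noteq> {}" using pos[OF k] by (metis card.empty less_numeral_extra(3))
      thus "k \<in> s ` {..<n}" using enat by auto
    qed
    thus ?thesis using infA finite_surj by blast
  qed auto
  show ?thesis
  proof (rule that)
    show "poles_plus c \<mu> L r = (\<infinity>, s)" using Ns N by simp
    show "s j \<in> first_quadrant" for j using lp unfolding lists_poles_def N by auto
    show "finite (s -` {k}) \<and> card (s -` {k}) = nat (zorder den k)" if "k \<in> first_quadrant" for k
      using lp that unfolding lists_poles_def N P_def lip_pole_multiplicity[OF assms] by (auto simp: vimage_def)
    show "norm (s i) \<le> norm (s j)" if "i \<le> j" for i j
      using lp that unfolding lists_poles_def N by auto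
  qed
qed

text \<open>Without zeros of \<open>den\<close> in the lower half plane the list is empty, and the
  padding by zeros then makes it unique, so the choice is forced.\<close>

lemma poles_minus_eq:
  assumes "c > 0" "\<mu> > 0"
  shows "poles_minus c \<mu> L r = (0, \<lambda>_. 0)"
proof -
  define P where "P = lip_pressure c \<mu> L r"
  let ?S = "{k. Re k > 0 \<and> Im k < 0}"
  have mult: "nat (zorder den k) = 0" if "k \<in> ?S" for k
    using that den_nonzero_lower[of k] den_zorder_eq_0_iff[of k] by auto
  have iff: "lists_poles P ?S N s \<longleftrightarrow> N = 0 \<and> s = (\<lambda>_. 0)" for N s
  proof
    assume lp: "lists_poles P ?S N s"
    have "\<not> enat j < N" for j
    proof
      assume j: "enat j < N"
      have "s j \<in> ?S" using lp j unfolding lists_poles_def by blast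
      hence "finite {i. enat i < N \<and> s i = s j} \<and> card {i. enat i < N \<and> s i = s j} = 0"
        using lp mult unfolding lists_poles_def P_def lip_pole_multiplicity[OF assms] by auto
      thus False using j by auto
    qed
    hence "N = 0" using not_less_zero enat_0 by (metis not_gr_zero)
    moreover have "s = (\<lambda>_. 0)" using lp \<open>N = 0\<close> unfolding lists_poles_def by auto
    ultimately show "N = 0 \<and> s = (\<lambda>_. 0)" ..
  next
    assume "N = 0 \<and> s = (\<lambda>_. 0)"
    thus "lists_poles P ?S N s"
      unfolding lists_poles_def P_def lip_pole_multiplicity[OF assms] using mult by auto
  qed
  have "poles_minus c \<mu> L r = (SOME x. x = (0, \<lambda>_. 0))"
    unfolding poles_minus_def pole_sequence_def P_def[symmetric] iff
    by (rule arg_cong[of _ _ Eps]) (auto simp: fun_eq_iff)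
  thus ?thesis by simp
qed

text \<open>The linear zero count makes the squared reciprocals of the poles summable, so the
  genus-one product converges. It vanishes at the listed poles and at their mirror images
  \<open>- cnj (s j)\<close> in the second quadrant, and the prefactor vanishes at 0; in the first
  quadrant only the listed poles count.\<close>

lemma E_fun_zorder:
  assumes "c > 0" "\<mu> > 0" and k: "k \<in> first_quadrant"
  shows "zorder (E_fun c \<mu> L r) k = zorder den k"
proof -
  obtain s where s: "poles_plus c \<mu> L r = (\<infinity>, s)" "\<And>j. s j \<in> first_quadrant"
    "\<And>k. k \<in> first_quadrant \<Longrightarrow> finite (s -` {k}) \<and> card (s -` {k}) = nat (zorder den k)"
    "\<And>i j. i \<le> j \<Longrightarrow> norm (s i) \<le> norm (s j)"
    using poles_plus_spec[OF assms(1,2)] by blast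
  have s0: "s j \<noteq> 0" for j using s(2)[of j] by auto
  obtain C where C: "\<And>k. norm (den k) \<le> exp (C * (1 + norm k))" using den_exponential_type by blast
  have "\<exists>B. \<forall>R>0. \<forall>(I::nat set) a. finite I \<longrightarrow> (\<forall>i\<in>I. norm (a i) \<le> R) \<longrightarrow>
           (\<forall>z. int (card {i\<in>I. a i = z}) \<le> zorder den z) \<longrightarrow> real (card I) \<le> B * (1 + R)"
    by (rule zero_count_linear_bound[OF den_holomorphic _ C]) (simp add: den_0)
  then obtain B where B: "\<forall>R>0. \<forall>(I::nat set) a. finite I \<longrightarrow> (\<forall>i\<in>I. norm (a i) \<le> R) \<longrightarrow>
           (\<forall>z. int (card {i\<in>I. a i = z}) \<le> zorder den z) \<longrightarrow> real (card I) \<le> B * (1 + R)"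
    by (rule exE)
  have growth: "real (Suc j) \<le> B * (1 + norm (s j))" for j
  proof -
    have "real (card {..j}) \<le> B * (1 + norm (s j))"
    proof (rule B[rule_format, of "norm (s j)" "{..j}" s])
      show "int (card {i\<in>{..j}. s i = z}) \<le> zorder den z" for z
      proof -
        show "int (card {i\<in>{..j}. s i = z}) \<le> zorder den z"
        proof (cases "z \<in> first_quadrant")
          case True
          have "card {i\<in>{..j}. s i = z} \<le> card (s -` {z})"
            using s(3)[OF True] by (intro card_mono) auto
          thus ?thesis using s(3)[OF True] den_zorder_nonneg[of z] by linarith
        next
          case False
          hence "{i\<in>{..j}. s i = z} = {}" using s(2) by blast
          thus ?thesis using den_zorder_nonneg[of z] by (simp only: card.empty)
        qed
      qed
    qed (use s0 s(4) in auto)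
    thus ?thesis by simp
  qed
  define b where "b = \<bar>B\<bar> + 1"
  have b: "b > 0" by (simp add: b_def)
  have growth': "real (Suc j) \<le> b * (1 + norm (s j))" for j
    by (rule order.trans[OF growth]) (auto simp: b_def intro!: mult_right_mono)
  \<comment> \<open>As soon as \<open>Suc j\<close> exceeds \<open>2 * b\<close>, half of it absorbs
    the additive \<open>b\<close> in \<open>growth'\<close>.\<close>
  have large: "eventually (\<lambda>j. real (Suc j) / (2 * b) \<le> norm (s j)) at_top"
    using eventually_ge_at_top[of "nat \<lceil>2 * b\<rceil>"]
  proof eventually_elim
    case (elim j)
    hence "2 * b \<le> real (Suc j)" by linarith
    moreover have "real (Suc j) \<le> b + b * norm (s j)" using growth'[of j] by (simp add: algebra_simps)
    ultimately have "real (Suc j) \<le> 2 * (b * norm (s j))" by linarith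
    thus ?case using b by (simp add: field_simps)
  qed
  have inf: "filterlim s at_infinity at_top"
  proof (rule filterlim_at_infinity_conv_norm_at_top[THEN iffD2], rule filterlim_at_top_mono[OF _ large])
    show "filterlim (\<lambda>j. real (Suc j) / (2 * b)) at_top at_top" using b by real_asymp
  qed
  have summ: "summable (\<lambda>j. (R / norm (s j)) ^ Suc 1)" if "R > 0" for R
  proof (rule summable_comparison_test_ev)
    show "eventually (\<lambda>j. norm ((R / norm (s j)) ^ Suc 1) \<le> (2 * b * R)\<^sup>2 * inverse (real (Suc j) ^ 2)) at_top"
      using large
    proof eventually_elim
      case (elim j)
      have "R / norm (s j) \<le> R / (real (Suc j) / (2 * b))"
        using elim that b s0[of j] by (intro divide_left_mono) (auto intro!: mult_pos_pos divide_pos_pos)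
      hence "(R / norm (s j))\<^sup>2 \<le> (R / (real (Suc j) / (2 * b)))\<^sup>2" using that by (intro power_mono) auto
      also have "R / (real (Suc j) / (2 * b)) = 2 * b * R / real (Suc j)" by simp
      also have "\<dots>\<^sup>2 = (2 * b * R)\<^sup>2 * inverse (real (Suc j) ^ 2)" unfolding power_divide by (rule divide_inverse)
      finally show ?case by (simp add: numeral_2_eq_2)
    qed
    show "summable (\<lambda>j. (2 * b * R)\<^sup>2 * inverse (real (Suc j) ^ 2))"
      by (intro summable_mult, subst summable_Suc_iff) (rule inverse_power_summable, simp)
  qed
  \<comment> \<open>The factors of \<open>pole_product\<close> are split into two Weierstrass
    products of genus one, over the poles and over their mirror images.\<close>
  interpret W: weierstrass_product s "\<lambda>_. 1"
    by standard (use s0 inf summ in auto)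
  interpret W': weierstrass_product "\<lambda>j. - cnj (s j)" "\<lambda>_. 1"
  proof
    show "filterlim (\<lambda>j. - cnj (s j)) at_infinity sequentially"
      using inf by (simp add: filterlim_at_infinity_conv_norm_at_top)
  qed (use s0 summ in auto)
  have prod: "pole_product (\<infinity>, s) z = W.f z * W'.f z" for z
  proof -
    have "(\<lambda>j. weierstrass_factor 1 (z / s j) * weierstrass_factor 1 (z / - cnj (s j))) has_prod (W.f z * W'.f z)"
      by (rule has_prod_mult[OF W.has_prod W'.has_prod])
    also have "(\<lambda>j. weierstrass_factor 1 (z / s j) * weierstrass_factor 1 (z / - cnj (s j))) =
       (\<lambda>j. (1 - z / s j) * exp (z / s j) * (1 + z / cnj (s j)) * exp (- (z / cnj (s j))))"
      by (simp add: weierstrass_factor_1_eq fun_eq_iff mult.assoc)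
    finally show ?thesis using has_prod_unique by (force simp: pole_product_def)
  qed
  have E: "E_fun c \<mu> L r = (\<lambda>z. (- \<i> * z) * (W.f z * W'.f z))"
    unfolding E_fun_def[abs_def] poles_minus_eq[OF assms(1,2)] s(1) prod
    by (simp add: pole_product_def fun_eq_iff)
  have ev: "eventually (\<lambda>z. (- \<i> * z) * (W.f z * W'.f z) \<noteq> 0) (at k)"
  proof -
    have "eventually (\<lambda>z. W.f z \<noteq> 0) (at k)" "eventually (\<lambda>z. W'.f z \<noteq> 0) (at k)"
      using W.not_islimpt_range_a[of k] W'.not_islimpt_range_a[of k]
      unfolding islimpt_iff_eventually W.zero W'.zero not_not .
    thus ?thesis using eventually_neq_at_within[of 0 k] by eventually_elim auto
  qed
  have ev2: "eventually (\<lambda>z. W.f z * W'.f z \<noteq> 0) (at k)" using ev by eventually_elim auto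
  have "zorder (E_fun c \<mu> L r) k = zorder (\<lambda>z. - \<i> * z) k + zorder (\<lambda>z. W.f z * W'.f z) k"
    unfolding E by (intro zorder_times_analytic ev analytic_intros W.analytic W'.analytic)
  also have "zorder (\<lambda>z. W.f z * W'.f z) k = zorder W.f k + zorder W'.f k"
    by (intro zorder_times_analytic ev2 W.analytic W'.analytic)
  also have "zorder (\<lambda>z. - \<i> * z) k = 0"
    by (rule zorder_eq_0I) (use k in \<open>auto intro!: analytic_intros\<close>)
  also have "zorder W'.f k = 0"
  proof -
    have "(\<lambda>j. - cnj (s j)) -` {k} = {}"
    proof -
      have "- cnj (s j) \<noteq> k" for j using s(2)[of j] k by (auto simp: complex_eq_iff)
      thus ?thesis by auto
    qed
    thus ?thesis unfolding W'.zorder by simp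
  qed
  also have "zorder W.f k = zorder den k" using s(3)[OF k] den_zorder_nonneg[of k] unfolding W.zorder by simp
  finally show ?thesis by simp
qed

end

section \<open>Two tracts\<close>

text \<open>Conjugating the local factorisation at \<open>z\<close> gives one at
  \<open>- cnj z\<close>; each linear factor picks up the sign -1, which is moved into the cofactor.
  This carries orders from the first to the second quadrant.\<close>

lemma zorder_reflect:
  fixes f :: "complex \<Rightarrow> complex"
  assumes "f holomorphic_on UNIV" "f w \<noteq> 0" and refl: "\<And>z. f (- cnj z) = cnj (f z)"
  shows "zorder f (- cnj z) = zorder f z"
proof -
  define n where "n = zorder f z"
  obtain g R where n: "n \<ge> 0" and g: "g z \<noteq> 0" "R > 0" "g holomorphic_on cball z R"
      "\<And>w. w \<in> cball z R \<Longrightarrow> f w = g w * (w - z) ^ nat n"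
    using zorder_exist_zero[OF assms(1) open_UNIV connected_UNIV UNIV_I, of z] assms(2)
    unfolding n_def by (metis UNIV_I centre_in_cball less_imp_le order_refl)
  define h where "h w = (-1) ^ nat n * cnj (g (- cnj w))" for w
  have mem: "- cnj v \<in> cball z R" if "v \<in> ball (- cnj z) R" for v
  proof -
    have "dist z (- cnj v) = norm (- cnj (- cnj z - v))" by (simp add: dist_norm add.commute)
    also have "\<dots> = dist (- cnj z) v" unfolding norm_minus_cancel complex_mod_cnj dist_norm ..
    finally show ?thesis using that by simp
  qed
  have "zorder f (- cnj z) = n"
  proof (rule zorder_eqI[of "ball (- cnj z) R" _ h])
    have "(g \<circ> uminus) holomorphic_on cnj ` ball (- cnj z) R"
      by (rule holomorphic_on_compose_gen[OF holomorphic_on_minus[OF holomorphic_on_ident] g(3)]) (use mem in auto)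
    hence "(\<lambda>v. g (- v)) holomorphic_on cnj ` ball (- cnj z) R" by (simp add: o_def)
    hence "(cnj \<circ> (\<lambda>v. g (- v)) \<circ> cnj) holomorphic_on ball (- cnj z) R"
      by (rule holomorphic_on_compose_cnj_cnj) auto
    thus "h holomorphic_on ball (- cnj z) R"
      unfolding h_def o_def by (intro holomorphic_intros)
    show "h (- cnj z) \<noteq> 0" using g by (simp add: h_def)
    fix v assume v: "v \<in> ball (- cnj z) R"
    have "f v = cnj (f (- cnj v))" using refl[of v] by simp
    also have "\<dots> = cnj (g (- cnj v)) * cnj (- cnj v - z) ^ nat n" using g(4)[OF mem[OF v]] by simp
    also have "cnj (- cnj v - z) = (-1) * (v - - cnj z)" by simp
    also have "\<dots> ^ nat n = (-1) ^ nat n * (v - - cnj z) ^ nat n" by (rule power_mult_distrib)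
    also have "(v - - cnj z) ^ nat n = (v - - cnj z) powi n" using n by (simp add: power_int_def)
    finally show "f v = h v * (v - - cnj z) powi n" by (simp add: h_def mult_ac)
  qed (use g in auto)
  thus ?thesis by (simp add: n_def)
qed

locale two_tracts = T: tract L r + T': tract L' r' for L r L' r'
begin

text \<open>Restricted to the first quadrant because the data speak of it directly; reflection and
  \<open>den_zero_location\<close> supply the rest of the plane.\<close>

definition same_zeros where "same_zeros \<longleftrightarrow> (\<forall>k\<in>first_quadrant. zorder T.den k = zorder T'.den k)"

lemma quotient_exp_linear:
  assumes same_zeros
  obtains \<alpha> \<beta> where "\<And>z. T'.den z = exp (\<alpha> + \<beta> * z) * T.den z"
proof -
  have z0: "zorder T.den k = 0 \<and> zorder T'.den k = 0" if "\<not> (Re k \<noteq> 0 \<and> Im k > 0)" for k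
    using T.den_zero_location[of k] T'.den_zero_location[of k] that
      T.den_zorder_eq_0_iff T'.den_zorder_eq_0_iff by blast
  have zorder_eq: "zorder T.den k = zorder T'.den k" for k
  proof (cases "Re k \<noteq> 0 \<and> Im k > 0")
    case True
    show ?thesis
    proof (cases "Re k > 0")
      case False
      hence "- cnj k \<in> first_quadrant" using True by simp
      hence "zorder T.den (- cnj k) = zorder T'.den (- cnj k)" using assms unfolding same_zeros_def by blast
      thus ?thesis
        using zorder_reflect[OF T.den_holomorphic _ T.den_cnj, of 0 k]
          zorder_reflect[OF T'.den_holomorphic _ T'.den_cnj, of 0 k] by (simp add: T.den_0 T'.den_0)
    qed (use True assms in \<open>auto simp: same_zeros_def\<close>)
  qed (use z0 in auto)
  have "T.den z = 0 \<longleftrightarrow> T'.den z = 0" for z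
    using zorder_eq[of z] T.den_zorder_eq_0_iff[of z] T'.den_zorder_eq_0_iff[of z] by auto
  then obtain q where q: "q holomorphic_on UNIV" "\<And>z. q z \<noteq> 0" "\<And>z. T'.den z = q z * T.den z"
    using holomorphic_zorder_factorization[OF T'.den_holomorphic open_UNIV connected_UNIV T.den_holomorphic] zorder_eq
    by (metis UNIV_I)
  obtain C where C: "\<And>k. norm (T.den k) \<le> exp (C * (1 + norm k))" using T.den_exponential_type by blast
  obtain D where D: "\<And>k. norm (T'.den k) \<le> exp (D * (1 + norm k))" using T'.den_exponential_type by blast
  have "T.den 0 \<noteq> 0" by (simp add: T.den_0)
  then obtain \<alpha> \<beta> where "\<And>z. q z = exp (\<alpha> + \<beta> * z)"
    using entire_quotient_exp_linear[OF T.den_holomorphic _ C q(1,2), of D] D unfolding q(3) by blast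
  thus ?thesis using that q(3) by metis
qed

text \<open>In the sum of the rates at \<open>\<i> * t\<close> and \<open>- \<i> * t\<close> the
  unknown \<beta> drops out and \<alpha> is divided by \<open>t\<close>, so
  \<open>2 * a + 2 * L\<close> is common to both tracts.\<close>

lemma same_zeros_sum:
  assumes same_zeros
  shows "r L + L = r' L' + L'"
proof -
  obtain \<alpha> \<beta> where q: "\<And>z. T'.den z = exp (\<alpha> + \<beta> * z) * T.den z"
    using quotient_exp_linear[OF assms] by blast
  define h where "h t = ln (norm (T.den (\<i> * of_real t))) / t + ln (norm (T.den (- \<i> * of_real t))) / t" for t
  define h' where "h' t = ln (norm (T'.den (\<i> * of_real t))) / t + ln (norm (T'.den (- \<i> * of_real t))) / t" for t
  have ln_q: "ln (norm (T'.den z)) = Re (\<alpha> + \<beta> * z) + ln (norm (T.den z))" if "T.den z \<noteq> 0" for z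
    using that unfolding q by (simp add: norm_mult ln_mult_pos)
  have h': "h' t = h t + 2 * Re \<alpha> / t" for t
  proof -
    have "T.den (\<i> * of_real t) \<noteq> 0" "T.den (- \<i> * of_real t) \<noteq> 0"
      using T.den_nonzero_imag[of t] T.den_nonzero_imag[of "-t"] by simp_all
    hence "ln (norm (T'.den (\<i> * of_real t))) + ln (norm (T'.den (- \<i> * of_real t))) =
        ln (norm (T.den (\<i> * of_real t))) + ln (norm (T.den (- \<i> * of_real t))) + 2 * Re \<alpha>"
      by (simp add: ln_q)
    thus ?thesis unfolding h_def h'_def by (simp add: add_divide_distrib[symmetric])
  qed
  have "(h' \<longlongrightarrow> 2 * T'.a + L' + L') at_top"
    unfolding h'_def by (intro tendsto_add T'.den_growth_upper T'.den_growth_lower)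
  moreover have "((\<lambda>t. h t + 2 * Re \<alpha> / t) \<longlongrightarrow> 2 * T.a + L + L + 0) at_top"
    unfolding h_def
    by (intro tendsto_add T.den_growth_upper T.den_growth_lower) real_asymp
  ultimately have "2 * T'.a + L' + L' = 2 * T.a + L + L + 0"
    unfolding h'[symmetric] by (intro tendsto_unique[OF trivial_limit_at_top_linorder])
  thus ?thesis by (simp add: T.a_def T'.a_def)
qed

text \<open>Three normalisations fix the quotient: the value 1 at 0 gives
  \<open>exp \<alpha> = 1\<close>, the rate along the negative imaginary axis gives
  \<open>Im \<beta> = L' - L\<close>, and equal moduli at 1 and -1 give
  \<open>Re \<beta> = 0\<close>.\<close>

lemma same_zeros_den_eq:
  assumes same_zeros "L = L'"
  shows "T'.den = T.den"
proof -
  obtain \<alpha> \<beta> where q: "\<And>z. T'.den z = exp (\<alpha> + \<beta> * z) * T.den z"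
    using quotient_exp_linear[OF assms(1)] by blast
  have exp\<alpha>: "exp \<alpha> = 1" using q[of 0] by (simp add: T.den_0 T'.den_0)
  have "ln (norm (T'.den (- \<i> * of_real t))) / t = ln (norm (T.den (- \<i> * of_real t))) / t + (Re \<alpha> / t + Im \<beta>)"
    if "t > 0" for t
  proof -
    have "T.den (- \<i> * of_real t) \<noteq> 0" using T.den_nonzero_imag[of "-t"] by simp
    hence "ln (norm (T'.den (- \<i> * of_real t))) = ln (norm (T.den (- \<i> * of_real t))) + (Re \<alpha> + Im \<beta> * t)"
      unfolding q by (simp add: norm_mult ln_mult_pos)
    thus ?thesis using that by (simp add: field_simps)
  qed
  hence "eventually (\<lambda>t. ln (norm (T.den (- \<i> * of_real t))) / t + (Re \<alpha> / t + Im \<beta>) =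
      ln (norm (T'.den (- \<i> * of_real t))) / t) at_top"
    by (intro eventually_mono[OF eventually_gt_at_top[of 0]]) simp
  moreover have "((\<lambda>t. Re \<alpha> / t + Im \<beta>) \<longlongrightarrow> Im \<beta>) at_top" by real_asymp
  hence "((\<lambda>t. ln (norm (T.den (- \<i> * of_real t))) / t + (Re \<alpha> / t + Im \<beta>)) \<longlongrightarrow> L + Im \<beta>) at_top"
    by (intro tendsto_add T.den_growth_lower)
  ultimately have "((\<lambda>t. ln (norm (T'.den (- \<i> * of_real t))) / t) \<longlongrightarrow> L + Im \<beta>) at_top"
    by (rule Lim_transform_eventually[rotated])
  hence "L + Im \<beta> = L'" using T'.den_growth_lower tendsto_unique trivial_limit_at_top_linorder by blast
  hence Im: "Im \<beta> = 0" using assms by simp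
  have nz: "T.den 1 \<noteq> 0" "T.den (-1) \<noteq> 0" by (simp_all add: T.den_nonzero_lower)
  have refl: "norm (T.den (-1)) = norm (T.den 1)" "norm (T'.den (-1)) = norm (T'.den 1)"
    using T.den_cnj[of 1] T'.den_cnj[of 1] by simp_all
  have "exp (Re (\<alpha> + \<beta> * 1)) = exp (Re (\<alpha> + \<beta> * (-1)))"
    using refl nz unfolding q norm_mult norm_exp_eq_Re by simp
  hence "Re \<beta> = 0" by simp
  with Im have "\<beta> = 0" by (simp add: complex_eq_iff)
  thus ?thesis using exp\<alpha> by (simp add: q fun_eq_iff)
qed

lemma same_zeros_same_pressure:
  assumes same_zeros and "L = L' \<or> r L = r' L'"
  shows "L = L' \<and> r L = r' L' \<and> lip_pressure c \<mu> L r = lip_pressure c \<mu> L' r'"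
proof -
  have 1: "L = L'" "r L = r' L'" using same_zeros_sum[OF assms(1)] assms(2) by auto
  have a: "T'.a = T.a" using 1(2) unfolding T.a_def T'.a_def by simp
  have "T'.lip_fun q = T.lip_fun q" for q
    unfolding T.lip_fun_def[abs_def] T'.lip_fun_def[abs_def] same_zeros_den_eq[OF assms(1) 1(1)] a ..
  hence "lip_pressure c \<mu> L r = lip_pressure c \<mu> L' r'"
    unfolding T.lip_pressure_eq T'.lip_pressure_eq by (simp only:)
  thus ?thesis using 1 by blast
qed

lemma same_poles_same_zeros:
  assumes "c > 0" "\<mu> > 0" "poles_plus c \<mu> L r = poles_plus c \<mu> L' r'"
  shows same_zeros
proof -
  obtain s where s: "poles_plus c \<mu> L r = (\<infinity>, s)"
    "\<And>k. k \<in> first_quadrant \<Longrightarrow> card (s -` {k}) = nat (zorder T.den k)"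
    using T.poles_plus_spec[OF assms(1,2)] by metis
  obtain s' where s': "poles_plus c \<mu> L' r' = (\<infinity>, s')"
    "\<And>k. k \<in> first_quadrant \<Longrightarrow> card (s' -` {k}) = nat (zorder T'.den k)"
    using T'.poles_plus_spec[OF assms(1,2)] by metis
  have "s = s'" using s(1) s'(1) assms(3) by simp
  hence "nat (zorder T.den k) = nat (zorder T'.den k)" if "k \<in> first_quadrant" for k
    using s(2)[OF that] s'(2)[OF that] by simp
  thus ?thesis unfolding same_zeros_def
    using T.den_zorder_nonneg T'.den_zorder_nonneg by (metis eq_nat_nat_iff)
qed

lemma same_E_same_zeros:
  assumes "c > 0" "\<mu> > 0" "E_fun c \<mu> L r = E_fun c \<mu> L' r'"
  shows same_zeros
  unfolding same_zeros_def
  using T.E_fun_zorder[OF assms(1,2)] T'.E_fun_zorder[OF assms(1,2)] assms(3) by metis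

text \<open>For \<open>k > 0\<close> the squared modulus is the product of the pressures at
  \<open>k\<close> and \<open>- k\<close>, which continues analytically. For \<open>k\<close> in the
  first quadrant \<open>- k\<close> lies in the lower half plane, where impedance and
  \<open>den\<close> have no zeros, so only the orders at \<open>k\<close> remain to be
  compared.\<close>

lemma same_modulus_same_zeros:
  assumes "c > 0" "\<mu> > 0"
    and modulus: "\<And>x. x > 0 \<Longrightarrow> norm (lip_pressure c \<mu> L r (of_real x)) = norm (lip_pressure c \<mu> L' r' (of_real x))"
  shows "same_zeros \<and> r L = r' L'"
proof -
  define Z where "Z k = piston (\<i> * k * of_real T.a)" for k
  define Z' where "Z' k = piston (\<i> * k * of_real T'.a)" for k
  \<comment> \<open>Equality of the two products with denominators cleared; the fourth powers come
    from the factor \<open>a\<^sup>2\<close> in each of two denominators. \<open>H\<close> and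
    \<open>H'\<close> are entire.\<close>
  define H where "H k = Z k * T'.den k * (Z (- k) * of_real (T'.a ^ 4) * T'.den (- k))" for k
  define H' where "H' k = Z' k * T.den k * (Z' (- k) * of_real (T.a ^ 4) * T.den (- k))" for k
  have Z_hol: "Z holomorphic_on UNIV" "Z' holomorphic_on UNIV"
    unfolding Z_def Z'_def by (intro holomorphic_intros)+
  have minus: "(\<lambda>k. f (- k)) holomorphic_on UNIV" if "f holomorphic_on UNIV" for f :: "complex \<Rightarrow> complex"
  proof -
    have "(f \<circ> uminus) holomorphic_on UNIV"
      by (rule holomorphic_on_compose_gen[OF holomorphic_on_minus[OF holomorphic_on_ident] that]) auto
    thus ?thesis by (simp add: o_def)
  qed
  have Z_lower: "Z k \<noteq> 0" "Z' k \<noteq> 0" if "Im k < 0" for k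
  proof -
    have "k \<noteq> 0" using that by auto
    thus "Z k \<noteq> 0" "Z' k \<noteq> 0"
      using Re_piston_pos[of "\<i> * k * of_real T.a"] Re_piston_pos[of "\<i> * k * of_real T'.a"] that T.a_pos T'.a_pos
      by (auto simp: Z_def Z'_def mult_le_0_iff)
  qed
  have real_eq: "H (of_real x) = H' (of_real x)" if x: "x > 0" for x
  proof -
    define q where "q = c * \<mu> / pi"
    have q: "q > 0" using assms by (simp add: q_def)
    have den: "T.den (of_real x) \<noteq> 0" "T'.den (of_real x) \<noteq> 0"
      by (simp_all add: T.den_nonzero_lower T'.den_nonzero_lower)
    have "T.lip_fun q analytic_on {of_real x}" "T'.lip_fun q analytic_on {of_real x}"
      unfolding T.lip_fun_def[abs_def] T'.lip_fun_def[abs_def] Z_def[symmetric] Z'_def[symmetric]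
      using den T.a_pos T'.a_pos
      by (auto intro!: analytic_intros entire_analytic[OF Z_hol(1)] entire_analytic[OF Z_hol(2)]
          entire_analytic[OF T.den_holomorphic] entire_analytic[OF T'.den_holomorphic])
    hence "norm (T.lip_fun q (of_real x)) = norm (T'.lip_fun q (of_real x))"
      using modulus[OF x] by (simp add: T.lip_pressure_eq T'.lip_pressure_eq q_def)
    hence "q * (norm (Z (of_real x)) / (T.a\<^sup>2 * norm (T.den (of_real x)))) =
        q * (norm (Z' (of_real x)) / (T'.a\<^sup>2 * norm (T'.den (of_real x))))"
      using q unfolding T.lip_fun_def T'.lip_fun_def Z_def[symmetric] Z'_def[symmetric]
      by (simp add: norm_mult norm_divide norm_power)
    hence "norm (Z (of_real x)) / (T.a\<^sup>2 * norm (T.den (of_real x))) = norm (Z' (of_real x)) / (T'.a\<^sup>2 * norm (T'.den (of_real x)))"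
      using q unfolding mult_cancel_left by auto
    hence "norm (Z (of_real x)) * (T'.a\<^sup>2 * norm (T'.den (of_real x))) = norm (Z' (of_real x)) * (T.a\<^sup>2 * norm (T.den (of_real x)))"
      using den T.a_pos T'.a_pos by (simp add: frac_eq_eq)
    hence "(norm (Z (of_real x)) * (T'.a\<^sup>2 * norm (T'.den (of_real x))))\<^sup>2 = (norm (Z' (of_real x)) * (T.a\<^sup>2 * norm (T.den (of_real x))))\<^sup>2"
      by simp
    hence eq: "(norm (Z (of_real x)))\<^sup>2 * T'.a ^ 4 * (norm (T'.den (of_real x)))\<^sup>2 = (norm (Z' (of_real x)))\<^sup>2 * T.a ^ 4 * (norm (T.den (of_real x)))\<^sup>2"
      by (simp add: power_mult_distrib mult.assoc flip: power_mult)
    have cnj: "Z (- of_real x) = cnj (Z (of_real x))" "Z' (- of_real x) = cnj (Z' (of_real x))"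
      by (simp_all add: Z_def Z'_def flip: piston_cnj)
    have cnj2: "T.den (- of_real x) = cnj (T.den (of_real x))" "T'.den (- of_real x) = cnj (T'.den (of_real x))"
      using T.den_cnj[of "of_real x"] T'.den_cnj[of "of_real x"] by simp_all
    have "H (of_real x) = of_real ((norm (Z (of_real x)))\<^sup>2 * T'.a ^ 4 * (norm (T'.den (of_real x)))\<^sup>2)"
      unfolding H_def cnj cnj2 of_real_mult complex_norm_square by (simp only: mult_ac)
    also have "\<dots> = of_real ((norm (Z' (of_real x)))\<^sup>2 * T.a ^ 4 * (norm (T.den (of_real x)))\<^sup>2)"
      by (simp only: eq)
    also have "\<dots> = H' (of_real x)"
      unfolding H'_def cnj cnj2 of_real_mult complex_norm_square by (simp only: mult_ac)
    finally show ?thesis .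
  qed
  have hol: "H holomorphic_on UNIV" "H' holomorphic_on UNIV"
    unfolding H_def H'_def
    by (intro holomorphic_intros Z_hol T.den_holomorphic T'.den_holomorphic minus)+
  have HH': "H k = H' k" for k
  proof -
    \<comment> \<open>Any point of the positive axis would do as accumulation point for the identity
      theorem.\<close>
    have "(1::complex) islimpt (of_real ` {0<..})"
      unfolding islimpt_approachable
    proof (intro allI impI)
      fix e :: real assume e: "e > 0"
      show "\<exists>x'\<in>of_real ` {0<..}. x' \<noteq> (1::complex) \<and> dist x' 1 < e"
        by (rule bexI[of _ "of_real (1 + e / 2)"]) (use e in \<open>auto simp: dist_norm simp del: of_real_add\<close>, simp add: dist_norm)
    qed
    hence "H k - H' k = 0"
      by (rule analytic_continuation[of "\<lambda>k. H k - H' k" UNIV "of_real ` {0<..}" 1 k, rotated 5])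
         (use hol real_eq in \<open>auto intro!: holomorphic_intros\<close>)
    thus ?thesis by simp
  qed
  have zorder_sum: "zorder Z k + zorder T'.den k = zorder Z' k + zorder T.den k" if k: "k \<in> first_quadrant" for k
  proof -
    have ana: "f analytic_on {k}" if "f holomorphic_on UNIV" for f by (rule entire_analytic[OF that])
    have ev: "eventually (\<lambda>k. Z k \<noteq> 0) (at k)" "eventually (\<lambda>k. Z' k \<noteq> 0) (at k)"
      by (rule entire_eventually_nonzero[OF Z_hol(1), of "-\<i>"], use Z_lower in simp)
         (rule entire_eventually_nonzero[OF Z_hol(2), of "-\<i>"], use Z_lower in simp)
    have ev': "eventually (\<lambda>k. T.den k \<noteq> 0) (at k)" "eventually (\<lambda>k. T'.den k \<noteq> 0) (at k)"
      using T.eventually_generic[of k] T'.eventually_generic[of k] by (auto elim: eventually_mono)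
    define \<rho> where "\<rho> k = Z (- k) * of_real (T'.a ^ 4) * T'.den (- k)" for k
    define \<rho>' where "\<rho>' k = Z' (- k) * of_real (T.a ^ 4) * T.den (- k)" for k
    have \<rho>_hol: "\<rho> holomorphic_on UNIV" "\<rho>' holomorphic_on UNIV"
      unfolding \<rho>_def \<rho>'_def by (intro holomorphic_intros Z_hol T.den_holomorphic T'.den_holomorphic minus)+
    have nz: "\<rho> k \<noteq> 0" "\<rho>' k \<noteq> 0"
      using k Z_lower[of "-k"] T.den_nonzero_lower[of "-k"] T'.den_nonzero_lower[of "-k"] T.a_pos T'.a_pos
      by (auto simp: \<rho>_def \<rho>'_def)
    have ev\<rho>: "eventually (\<lambda>k. \<rho> k \<noteq> 0) (at k)" "eventually (\<lambda>k. \<rho>' k \<noteq> 0) (at k)"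
      by (rule entire_eventually_nonzero[OF \<rho>_hol(1) nz(1)], rule entire_eventually_nonzero[OF \<rho>_hol(2) nz(2)])
    have z: "zorder (\<lambda>k. u k * v k * w k) k = zorder u k + zorder v k"
      if "u holomorphic_on UNIV" "v holomorphic_on UNIV" "w holomorphic_on UNIV" "w k \<noteq> 0"
        "eventually (\<lambda>k. u k \<noteq> 0) (at k)" "eventually (\<lambda>k. v k \<noteq> 0) (at k)" "eventually (\<lambda>k. w k \<noteq> 0) (at k)"
      for u v w :: "complex \<Rightarrow> complex"
    proof -
      have "eventually (\<lambda>k. u k * v k \<noteq> 0) (at k)" "eventually (\<lambda>k. u k * v k * w k \<noteq> 0) (at k)"
        using that(5-7) by (eventually_elim, simp)+
      hence "zorder (\<lambda>k. u k * v k * w k) k = zorder u k + zorder v k + zorder w k"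
        using that(1-3) by (subst zorder_times_analytic; (subst zorder_times_analytic)?) (auto intro!: ana holomorphic_intros)
      thus ?thesis using zorder_eq_0I[OF ana[OF that(3)] that(4)] by simp
    qed
    have "(\<lambda>k. Z k * T'.den k * \<rho> k) = (\<lambda>k. Z' k * T.den k * \<rho>' k)"
      using HH' unfolding H_def H'_def \<rho>_def \<rho>'_def by blast
    thus ?thesis
      using z[OF Z_hol(1) T'.den_holomorphic \<rho>_hol(1) nz(1) ev(1) ev'(2) ev\<rho>(1)]
        z[OF Z_hol(2) T.den_holomorphic \<rho>_hol(2) nz(2) ev(2) ev'(1) ev\<rho>(2)] by simp
  qed
  have zorder_Z: "zorder Z k = 0 \<longleftrightarrow> Z k \<noteq> 0" "zorder Z' k = 0 \<longleftrightarrow> Z' k \<noteq> 0" "zorder Z k \<ge> 0" "zorder Z' k \<ge> 0" for k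
    using entire_zorder_eq_0_iff[OF Z_hol(1), of "-\<i>" k] entire_zorder_eq_0_iff[OF Z_hol(2), of "-\<i>" k]
      entire_zorder_nonneg[OF Z_hol(1), of "-\<i>" k] entire_zorder_nonneg[OF Z_hol(2), of "-\<i>" k] Z_lower by auto
  \<comment> \<open>If \<open>T.den\<close> vanishes at \<open>k\<close> then \<open>Z\<close> does
    not, so \<open>zorder_sum\<close> forces \<open>T'.den\<close> to vanish there; then
    \<open>Z'\<close> does not vanish and the orders agree. The other case is symmetric.\<close>
  have "zorder T.den k = zorder T'.den k" if k: "k \<in> first_quadrant" for k
  proof -
    have "zorder T.den k = 0 \<or> zorder Z k = 0"
      using T.den_piston_no_common_zero[of k] T.den_zorder_eq_0_iff[of k] zorder_Z[of k] by (auto simp: Z_def)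
    moreover have "zorder T'.den k = 0 \<or> zorder Z' k = 0"
      using T'.den_piston_no_common_zero[of k] T'.den_zorder_eq_0_iff[of k] zorder_Z[of k] by (auto simp: Z'_def)
    ultimately show ?thesis
      using zorder_sum[OF k] zorder_Z(3,4)[of k] T.den_zorder_nonneg[of k] T'.den_zorder_nonneg[of k] by auto
  qed
  hence sz: same_zeros unfolding same_zeros_def by blast
  \<comment> \<open>Slope of \<open>piston\<close> at 0. Dividing \<open>H\<close> and
    \<open>H'\<close> by \<open>- k\<^sup>2\<close> and letting \<open>k\<close> tend to 0 compares
    \<open>T.a\<^sup>2 * T'.a ^ 4\<close> with \<open>T'.a\<^sup>2 * T.a ^ 4\<close>, since
    \<open>den 0 = 1\<close> for both tracts.\<close>
  define d where "d = 8 / (3 * complex_of_real pi)"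
  have d0: "d \<noteq> 0" by (simp add: d_def)
  have lim: "((\<lambda>k. piston (\<i> * k * of_real b) / k) \<longlongrightarrow> d * (\<i> * of_real b)) (at 0)" for b :: real
  proof -
    have "((\<lambda>k. piston (\<i> * k * of_real b)) has_field_derivative d * (\<i> * of_real b)) (at 0)"
      by (rule DERIV_chain2[where f = piston]) (use piston_has_deriv_0 in \<open>auto simp: d_def intro!: derivative_eq_intros\<close>)
    thus ?thesis by (simp add: DERIV_def)
  qed
  have neg: "filterlim (\<lambda>k::complex. - k) (at 0) (at 0)"
    unfolding filterlim_at by (auto intro!: tendsto_eq_intros simp: eventually_at_filter)
  have lim_neg: "((\<lambda>k. piston (\<i> * - k * of_real b) / - k) \<longlongrightarrow> d * (\<i> * of_real b)) (at 0)" for b :: real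
    by (rule filterlim_compose[OF lim neg])
  have den_lim: "(f \<longlongrightarrow> f 0) (at 0)" "((\<lambda>k. f (- k)) \<longlongrightarrow> f 0) (at 0)" if "f holomorphic_on UNIV" for f :: "complex \<Rightarrow> complex"
  proof -
    show "(f \<longlongrightarrow> f 0) (at 0)"
      using holomorphic_on_imp_continuous_on[OF that] by (simp add: continuous_on_eq_continuous_at isCont_def)
    thus "((\<lambda>k. f (- k)) \<longlongrightarrow> f 0) (at 0)" by (rule filterlim_compose[OF _ neg])
  qed
  define lhs where "lhs k = Z k / k * T'.den k * (Z (- k) / - k * of_real (T'.a ^ 4) * T'.den (- k))" for k
  define rhs where "rhs k = Z' k / k * T.den k * (Z' (- k) / - k * of_real (T.a ^ 4) * T.den (- k))" for k
  have l: "(lhs \<longlongrightarrow> d * (\<i> * of_real T.a) * 1 * (d * (\<i> * of_real T.a) * of_real (T'.a ^ 4) * 1)) (at 0)"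
    unfolding lhs_def Z_def using den_lim[OF T'.den_holomorphic, unfolded T'.den_0]
    by (intro tendsto_intros lim lim_neg)
  have r: "(rhs \<longlongrightarrow> d * (\<i> * of_real T'.a) * 1 * (d * (\<i> * of_real T'.a) * of_real (T.a ^ 4) * 1)) (at 0)"
    unfolding rhs_def Z'_def using den_lim[OF T.den_holomorphic, unfolded T.den_0]
    by (intro tendsto_intros lim lim_neg)
  have "lhs = rhs"
  proof
    fix k
    have "lhs k = H k * (inverse k * inverse (- k))" "rhs k = H' k * (inverse k * inverse (- k))"
      by (simp_all only: lhs_def rhs_def H_def H'_def divide_inverse mult_ac)
    thus "lhs k = rhs k" by (simp only: HH')
  qed
  hence "d * (\<i> * of_real T.a) * 1 * (d * (\<i> * of_real T.a) * of_real (T'.a ^ 4) * 1) =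
      d * (\<i> * of_real T'.a) * 1 * (d * (\<i> * of_real T'.a) * of_real (T.a ^ 4) * 1)"
    using tendsto_unique[OF at_neq_bot l] r by simp
  hence "(d * \<i>)\<^sup>2 * of_real (T.a\<^sup>2 * T'.a ^ 4) = (d * \<i>)\<^sup>2 * of_real (T'.a\<^sup>2 * T.a ^ 4)"
    by (simp add: power2_eq_square mult_ac)
  hence "complex_of_real (T.a\<^sup>2 * T'.a ^ 4) = of_real (T'.a\<^sup>2 * T.a ^ 4)" using d0 by simp
  hence "T.a\<^sup>2 * T'.a ^ 4 = T'.a\<^sup>2 * T.a ^ 4" by (simp only: of_real_eq_iff)
  hence "(T.a\<^sup>2 * T'.a\<^sup>2) * T'.a\<^sup>2 = (T.a\<^sup>2 * T'.a\<^sup>2) * T.a\<^sup>2"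
    by (simp add: power2_eq_square power4_eq_xxxx mult_ac)
  hence "T'.a\<^sup>2 = T.a\<^sup>2" using T.a_pos T'.a_pos by simp
  hence "T.a = T'.a" using T.a_pos T'.a_pos by (simp add: power2_eq_iff_nonneg)
  thus ?thesis using sz by (simp add: T.a_def T'.a_def)
qed

end

theorem proposition6p3:
  fixes c \<mu> L L' :: real and r r' :: "real \<Rightarrow> real" and i j :: nat
  assumes "c > 0" and "\<mu> > 0"
    and "L > 0" and "class_A L r"
    and "L' > 0" and "class_A L' r'"
    and "i \<in> {1..6}" and "j \<in> {1..6}"
    and "same_data c \<mu> i L r L' r'"
  shows "same_data c \<mu> j L r L' r'"
proof -
  interpret two_tracts L r L' r' using assms by unfold_locales auto
  have modulus: "same_zeros \<and> r L = r' L'"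
    if "\<And>x. x > 0 \<Longrightarrow> norm (lip_pressure c \<mu> L r (of_real x)) = norm (lip_pressure c \<mu> L' r' (of_real x))"
    using same_modulus_same_zeros[OF assms(1,2) that] .
  \<comment> \<open>The common core of all six data sets: the zeros, and one of the two lengths. For
    the first two the lip radius comes from the modulus near \<open>k = 0\<close>, otherwise a
    length is listed.\<close>
  have "same_zeros \<and> (L = L' \<or> r L = r' L')"
    using assms(9) unfolding same_data_def
  proof (elim disjE conjE)
    assume eq: "D1 c \<mu> L r = D1 c \<mu> L' r'"
    have "lip_pressure c \<mu> L r (of_real x) = lip_pressure c \<mu> L' r' (of_real x)" if "x > 0" for x :: real
      using fun_cong[OF eq[unfolded D1_def], of x] that by simp
    thus ?thesis using modulus by simp
  next
    assume "D2 c \<mu> L r = D2 c \<mu> L' r'"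
    hence eq: "(\<lambda>k::real\<in>{0<..}. cmod (lip_pressure c \<mu> L r (of_real k))) =
        (\<lambda>k::real\<in>{0<..}. cmod (lip_pressure c \<mu> L' r' (of_real k)))" by (simp add: D2_def)
    have "norm (lip_pressure c \<mu> L r (of_real x)) = norm (lip_pressure c \<mu> L' r' (of_real x))" if "x > 0" for x :: real
      using fun_cong[OF eq, of x] that by simp
    thus ?thesis using modulus by simp
  qed (use same_poles_same_zeros[OF assms(1,2)] same_E_same_zeros[OF assms(1,2)] in \<open>auto simp: D3_def D4_def D5_def D6_def\<close>)
  hence "L = L' \<and> r L = r' L' \<and> lip_pressure c \<mu> L r = lip_pressure c \<mu> L' r'"
    using same_zeros_same_pressure by blast
  hence eq: "L = L'" "r L = r' L'" "lip_pressure c \<mu> L r = lip_pressure c \<mu> L' r'" by auto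
  \<comment> \<open>Pole sequences, and through them \<open>E_fun\<close>, are functions of
    \<open>lip_pressure\<close> alone, so equality of length, lip radius and pressure returns every
    data set.\<close>
  have poles: "poles_plus c \<mu> L r = poles_plus c \<mu> L' r'" "poles_minus c \<mu> L r = poles_minus c \<mu> L' r'"
    by (simp_all only: poles_plus_def poles_minus_def eq(3))
  have E: "E_fun c \<mu> L r = E_fun c \<mu> L' r'" by (simp only: E_fun_def[abs_def] poles)
  have "j = 1 \<or> j = 2 \<or> j = 3 \<or> j = 4 \<or> j = 5 \<or> j = 6" using assms(8) by auto
  thus ?thesis
    unfolding same_data_def D1_def D2_def D3_def D4_def D5_def D6_def poles E eq(2,3)
    using eq(1) by auto
qed

end
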